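(* Let $W=(W_s:0\le s\le1)$ be a standard Brownian motion starting at $0$ and let $\mathfrak{u}_s=s$ for $0\le s\le 1$. As $t\to\infty$ the following weak convergences hold (as random elements of $\mathcal{C}([0,1];\mathbb{R})$ with the uniform topology): 1. If $(\nu,h)\in R_2$, then $\left(\dfrac{X_{st}-(\nu+h)t\,\mathfrak{u}_s}{\sqrt t}:0\le s\le1\right)$ converges weakly to $W$ both under $Q^{\nu,h}|_{\mathcal{F}_t}$ and under $Q^{\nu,h}_t|_{\mathcal{F}_t}$. 2. If $(\nu,h)\in L_3$, then $\left(\dfrac{X_{st}-(\nu+h)t\,\mathfrak{u}_s}{\sqrt t}:0\le s\le1\right)$ under $Q^{\nu,h}|_{\mathcal{F}_t}$ converges weakly to $W$. 3. If $(\nu,h)\in R_3$, then $\left(\dfrac{X_{st}-h\,t\,\mathfrak{u}_s}{\sqrt t}:0\le s\le1\right)$ converges weakly to $W$ both under $Q^{\nu,h}|_{\mathcal{F}_t}$ and under $Q^{\nu,h}_t|_{\mathcal{F}_t}$.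
   Context: Setting. $X=(X_t:t\ge0)$ is the canonical process on $\mathcal{C}(\mathbb{R}_+;\mathbb{R})$, $\mathcal{F}_t=\sigma(X_s:s\le t)$, $\mathcal{F}_\infty=\sigma(\cup_{t\ge0}\mathcal{F}_t)$. $P_0$ is Wiener measure (under which $X$ is standard Brownian motion from $0$), with expectation $E_0$; $P_0^{h}$ is the law of Brownian motion with drift $h$ started at $0$. $S_t=\sup_{s\le t}X_s$ and $S_\infty=\lim_{t\to\infty}S_t$. Parameter regions of $(\nu,h)\in\mathbb{R}^2$: $R_2=\{h>-\nu,\ h>-\tfrac12\nu\}$; $L_3=\{h=-\tfrac12\nu,\ \nu>0\}$; $R_3=\{h<0,\ h<-\tfrac12\nu\}$. Gibbs and penalized measures. For $t\ge0$, $Q_t^{\nu,h}(\Lambda)=\dfrac{E_0[1_\Lambda\exp(\nu S_t+hX_t)]}{E_0[\exp(\nu S_t+hX_t)]}$ for $\Lambda\in\mathcal{F}_\infty$. The penalized measure $Q^{\nu,h}$ is the probability measure on $\mathcal{F}_\infty$ such that $\lim_{t\to\infty}Q_t^{\nu,h}(\Lambda_s)=Q^{\nu,h}(\Lambda_s)$ for all $s\ge0$, $\Lambda_s\in\mathcal{F}_s$. It is known (Roynette–Vallois–Yor) that it exists and that $Q^{\nu,h}=P_0^{\nu+h}$ on $R_2\cup L_3$, while $dQ^{\nu,h}=\frac{\nu+2h}{2h}\exp(\nu S_\infty)\,dP_0^h$ on $R_3$. *)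

theory Defs
  imports "HOL-Probability.Probability"
begin

section \<open>The canonical path space\<close>

text \<open>
  A path is a function on the whole real line that is continuous on the half-line of nonnegative
  reals and takes the value \<^const>\<open>undefined\<close> elsewhere, so that paths correspond one-to-one to the
  continuous functions on the half-line. The canonical process is evaluation,
  \<open>X\<^sub>t(\<omega>) = \<omega> t\<close>.
\<close>

definition paths :: "(real \<Rightarrow> real) set" where
  "paths = {\<omega> \<in> extensional {0..}. continuous_on {0..} \<omega>}"

definition path_filtration :: "real \<Rightarrow> (real \<Rightarrow> real) measure" where
  "path_filtration t =
     sigma paths {(\<lambda>\<omega>. \<omega> s) -` B \<inter> paths | s B. 0 \<le> s \<and> s \<le> t \<and> B \<in> sets borel}"

definition path_sigma :: "(real \<Rightarrow> real) measure" where
  "path_sigma = sigma paths (\<Union>t\<in>{0..}. sets (path_filtration t))"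

definition running_sup :: "real \<Rightarrow> (real \<Rightarrow> real) \<Rightarrow> real" where
  "running_sup t \<omega> = (SUP s\<in>{0..t}. \<omega> s)"


section \<open>Brownian motion\<close>

text \<open>
  The time set \<open>T\<close> is meant to be an interval of nonnegative reals containing 0. All sample paths
  are required to be continuous (not just almost all), so that the process is a random element of
  the corresponding space of continuous functions. The last argument of \<^const>\<open>normal_density\<close> that
  precedes the variable is the standard deviation, not the variance.
\<close>

definition standard_BM :: "real set \<Rightarrow> 'a measure \<Rightarrow> (real \<Rightarrow> 'a \<Rightarrow> real) \<Rightarrow> bool" where
  "standard_BM T M B \<longleftrightarrow>
     prob_space M \<and>
     (\<forall>t\<in>T. B t \<in> borel_measurable M) \<and>
     (\<forall>\<omega>\<in>space M. continuous_on T (\<lambda>t. B t \<omega>)) \<and>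
     (AE \<omega> in M. B 0 \<omega> = 0) \<and>
     (\<forall>s\<in>T. \<forall>t\<in>T. s < t \<longrightarrow>
        distributed M lborel (\<lambda>\<omega>. B t \<omega> - B s \<omega>) (\<lambda>x. ennreal (normal_density 0 (sqrt (t - s)) x))) \<and>
     (\<forall>(n::nat) \<tau>. strict_mono_on {..n} \<tau> \<and> \<tau> ` {..n} \<subseteq> T \<longrightarrow>
        prob_space.indep_vars M (\<lambda>_. borel) (\<lambda>i \<omega>. B (\<tau> (Suc i)) \<omega> - B (\<tau> i) \<omega>) {..<n})"

definition wiener_measure :: "(real \<Rightarrow> real) measure \<Rightarrow> bool" where
  "wiener_measure P \<longleftrightarrow> sets P = sets path_sigma \<and> standard_BM {0..} P (\<lambda>t \<omega>. \<omega> t)"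


section \<open>Gibbs and penalized measures\<close>

text \<open>See \<open>emeasure_gibbs\<close> below for the formula for the probability of an event.\<close>

definition gibbs :: "(real \<Rightarrow> real) measure \<Rightarrow> real \<Rightarrow> real \<Rightarrow> real \<Rightarrow> (real \<Rightarrow> real) measure" where
  "gibbs P0 \<nu> h t =
     density P0 (\<lambda>\<omega>. ennreal (exp (\<nu> * running_sup t \<omega> + h * \<omega> t)) /
                     (\<integral>\<^sup>+\<omega>'. ennreal (exp (\<nu> * running_sup t \<omega>' + h * \<omega>' t)) \<partial>P0))"

definition is_penalized ::
    "(real \<Rightarrow> real) measure \<Rightarrow> real \<Rightarrow> real \<Rightarrow> (real \<Rightarrow> real) measure \<Rightarrow> bool" where
  "is_penalized P0 \<nu> h Q \<longleftrightarrow>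
     prob_space Q \<and> sets Q = sets path_sigma \<and>
     (\<forall>s\<ge>0. \<forall>\<Lambda>\<in>sets (path_filtration s).
        ((\<lambda>t. measure (gibbs P0 \<nu> h t) \<Lambda>) \<longlongrightarrow> measure Q \<Lambda>) at_top)"

text \<open>
  There is at most one such measure (\<open>is_penalized_unique\<close> below); its existence is a
  theorem of Roynette, Vallois and Yor.
\<close>

definition penalized :: "(real \<Rightarrow> real) measure \<Rightarrow> real \<Rightarrow> real \<Rightarrow> (real \<Rightarrow> real) measure" where
  "penalized P0 \<nu> h = (THE Q. is_penalized P0 \<nu> h Q)"

definition R2 :: "(real \<times> real) set" where
  "R2 = {(\<nu>, h). h > - \<nu> \<and> h > - (1/2) * \<nu>}"

definition L3 :: "(real \<times> real) set" where
  "L3 = {(\<nu>, h). h = - (1/2) * \<nu> \<and> \<nu> > 0}"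

definition R3 :: "(real \<times> real) set" where
  "R3 = {(\<nu>, h). h < 0 \<and> h < - (1/2) * \<nu>}"


section \<open>Weak convergence of random continuous functions\<close>

definition borel_of :: "'a topology \<Rightarrow> 'a measure" where
  "borel_of T = sigma (topspace T) {U. openin T U}"

text \<open>Weak convergence, along a filter, of Borel probability measures on a topological space.\<close>

definition weakly_converges ::
    "'a topology \<Rightarrow> ('i \<Rightarrow> 'a measure) \<Rightarrow> 'a measure \<Rightarrow> 'i filter \<Rightarrow> bool" where
  "weakly_converges T M N F \<longleftrightarrow>
     (\<forall>\<^sub>F i in F. prob_space (M i) \<and> sets (M i) = sets (borel_of T)) \<and>
     prob_space N \<and> sets N = sets (borel_of T) \<and>
     (\<forall>f. continuous_map T euclideanreal f \<and> bounded (f ` topspace T) \<longrightarrow>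
        ((\<lambda>i. \<integral>x. f x \<partial>M i) \<longlongrightarrow> (\<integral>x. f x \<partial>N)) F)"

text \<open>Continuous real functions on the unit interval (extensional), with the supremum metric.\<close>

definition C01 :: "(real \<Rightarrow> real) topology" where
  "C01 = mtopology_of (cfunspace (top_of_set {0..1}) euclidean_metric)"

definition rescaled :: "real \<Rightarrow> real \<Rightarrow> (real \<Rightarrow> real) \<Rightarrow> (real \<Rightarrow> real)" where
  "rescaled c t \<omega> = (\<lambda>s\<in>{0..1}. (\<omega> (s * t) - c * t * s) / sqrt t)"

text \<open>Law of the rescaled path under the restriction of \<open>Q\<close> to \<open>\<F>\<^sub>t\<close>.\<close>

definition rescaled_law ::
    "(real \<Rightarrow> real) measure \<Rightarrow> real \<Rightarrow> real \<Rightarrow> (real \<Rightarrow> real) measure" where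
  "rescaled_law Q c t =
     distr (restr_to_subalg Q (path_filtration t)) (borel_of C01) (rescaled c t)"

definition law_on_C01 :: "'a measure \<Rightarrow> (real \<Rightarrow> 'a \<Rightarrow> real) \<Rightarrow> (real \<Rightarrow> real) measure" where
  "law_on_C01 M W = distr M (borel_of C01) (\<lambda>\<omega>. \<lambda>s\<in>{0..1}. W s \<omega>)"


section \<open>Basic facts about the definitions\<close>

lemma space_path_filtration [simp]: "space (path_filtration t) = paths"
  unfolding path_filtration_def by (rule space_measure_of) auto

lemma gens_path_sigma: "(\<Union>t\<in>{0..}. sets (path_filtration t)) \<subseteq> Pow paths"
  using sets.sets_into_space by fastforce

lemma space_path_sigma [simp]: "space path_sigma = paths"
  unfolding path_sigma_def using gens_path_sigma by (rule space_measure_of)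

lemma sets_path_sigma:
  "sets path_sigma = sigma_sets paths (\<Union>t\<in>{0..}. sets (path_filtration t))"
  unfolding path_sigma_def using gens_path_sigma by (rule sets_measure_of)

lemma sets_path_filtration:
  "sets (path_filtration t) =
     sigma_sets paths {(\<lambda>\<omega>. \<omega> s) -` B \<inter> paths | s B. 0 \<le> s \<and> s \<le> t \<and> B \<in> sets borel}"
  unfolding path_filtration_def by (rule sets_measure_of) auto

lemma sets_path_filtration_mono:
  "s \<le> t \<Longrightarrow> sets (path_filtration s) \<subseteq> sets (path_filtration t)"
  unfolding sets_path_filtration by (rule sigma_sets_mono') force

lemma path_filtration_subset: "sets (path_filtration t) \<subseteq> sets path_sigma"
proof -
  have "sets (path_filtration t) \<subseteq> sets (path_filtration (max t 0))"
    by (rule sets_path_filtration_mono) simp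
  also have "\<dots> \<subseteq> sets path_sigma"
    unfolding sets_path_sigma by (intro subsetI sigma_sets.Basic) auto
  finally show ?thesis .
qed

lemma is_penalized_unique:
  assumes Q: "is_penalized P0 \<nu> h Q" and Q': "is_penalized P0 \<nu> h Q'"
  shows "Q = Q'"
proof -
  let ?E = "\<Union>t\<in>{0..}. sets (path_filtration t)"
  interpret Q: prob_space Q using Q by (simp add: is_penalized_def)
  interpret Q': prob_space Q' using Q' by (simp add: is_penalized_def)
  have sQ: "sets Q = sets path_sigma" "sets Q' = sets path_sigma"
    using Q Q' by (auto simp: is_penalized_def)
  have eq: "measure Q A = measure Q' A" if "A \<in> ?E" for A
  proof -
    from that obtain s where s: "s \<ge> 0" "A \<in> sets (path_filtration s)" by auto
    then show ?thesis
      using Q Q' tendsto_unique[OF trivial_limit_at_top_linorder] unfolding is_penalized_def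
      by meson
  qed
  have Int: "Int_stable ?E"
  proof (rule Int_stableI)
    fix a b assume "a \<in> ?E" "b \<in> ?E"
    then obtain s t where st: "s \<ge> 0" "t \<ge> 0" "a \<in> sets (path_filtration s)"
      "b \<in> sets (path_filtration t)" by auto
    then have "a \<in> sets (path_filtration (max s t))" "b \<in> sets (path_filtration (max s t))"
      using sets_path_filtration_mono[of s "max s t"] sets_path_filtration_mono[of t "max s t"]
      by auto
    then have "a \<inter> b \<in> sets (path_filtration (max s t))" by blast
    then show "a \<inter> b \<in> ?E" using st by (auto intro!: bexI[of _ "max s t"])
  qed
  have top: "paths \<in> ?E"
    using sets.top[of "path_filtration 0"] by (auto intro!: bexI[of _ 0])
  show ?thesis
  proof (rule measure_eqI_generator_eq[OF Int gens_path_sigma])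
    show "emeasure Q X = emeasure Q' X" if "X \<in> ?E" for X
      using eq[OF that] by (simp add: Q.emeasure_eq_measure Q'.emeasure_eq_measure)
    show "sets Q = sigma_sets paths ?E" "sets Q' = sigma_sets paths ?E"
      using sQ by (simp_all add: sets_path_sigma)
    show "range (\<lambda>_::nat. paths) \<subseteq> ?E" using top by blast
  qed auto
qed

lemma penalized_eqI: "is_penalized P0 \<nu> h Q \<Longrightarrow> penalized P0 \<nu> h = Q"
  unfolding penalized_def using is_penalized_unique by blast

lemma measurable_eval:
  assumes "0 \<le> s" "s \<le> t"
  shows "(\<lambda>\<omega>. \<omega> s) \<in> borel_measurable (path_filtration t)"
proof (rule measurableI)
  fix B :: "real set" assume "B \<in> sets borel"
  then show "(\<lambda>\<omega>. \<omega> s) -` B \<inter> space (path_filtration t) \<in> sets (path_filtration t)"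
    using assms unfolding sets_path_filtration space_path_filtration
    by (intro sigma_sets.Basic) blast
qed simp

lemma measurable_path_sigma:
  "f \<in> measurable (path_filtration t) M \<Longrightarrow> f \<in> measurable path_sigma M"
  unfolding measurable_def using path_filtration_subset[of t] by auto

lemma bdd_above_path:
  assumes "\<omega> \<in> paths" shows "bdd_above (\<omega> ` {0..t})"
proof -
  have "continuous_on {0..t} \<omega>"
    using assms unfolding paths_def by (auto intro: continuous_on_subset)
  then show ?thesis
    by (intro bounded_imp_bdd_above compact_imp_bounded compact_continuous_image compact_Icc)
qed

lemma measurable_running_sup:
  assumes t: "0 \<le> t"
  shows "running_sup t \<in> borel_measurable (path_filtration t)"
proof -
  define D where "D = (\<lambda>q::real. q * t) ` (\<rat> \<inter> {0..1})"
  have D: "D \<subseteq> {0..t}"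
    unfolding D_def using t by (auto simp: mult_left_le_one_le)
  have cD: "countable D" unfolding D_def by (simp add: countable_rat)
  have neD: "D \<noteq> {}" unfolding D_def by (auto intro!: exI[of _ 0])
  have dense: "{0..t} \<subseteq> closure D"
  proof
    fix x assume x: "x \<in> {0..t}"
    show "x \<in> closure D"
    proof (cases "t = 0")
      case True
      then have "x \<in> D" using x unfolding D_def by (auto intro!: image_eqI[of _ _ 0])
      then show ?thesis using closure_subset by blast
    next
      case False
      then have t: "0 < t" using t by simp
      show ?thesis
        unfolding closure_approachable
      proof (intro allI impI)
        fix e :: real assume e: "0 < e"
        have "\<exists>q\<in>\<rat> \<inter> {0..1}. \<bar>q * t - x\<bar> < e"
        proof (cases "x = 0")
          case True then show ?thesis using e by (intro bexI[of _ 0]) auto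
        next
          case False
          have "max 0 ((x - e) / t) < x / t" using False x t e by (auto simp: field_simps)
          then obtain q where q: "q \<in> \<rat>" "max 0 ((x - e) / t) < q" "q < x / t"
            using Rats_dense_in_real by blast
          have "x / t \<le> 1" using x t by simp
          moreover have "x - e < q * t" "q * t < x" using q t by (auto simp: field_simps)
          ultimately show ?thesis using q by (intro bexI[of _ q]) auto
        qed
        then show "\<exists>y\<in>D. dist y x < e" unfolding D_def dist_real_def by auto
      qed
    qed
  qed
  have eq: "running_sup t \<omega> = (SUP s\<in>D. \<omega> s)" if w: "\<omega> \<in> paths" for \<omega>
  proof (rule antisym)
    have bD: "bdd_above (\<omega> ` D)" using bdd_above_path[OF w, of t] D by (meson bdd_above_mono image_mono)
    show "(SUP s\<in>D. \<omega> s) \<le> running_sup t \<omega>"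
      unfolding running_sup_def by (rule cSUP_subset_mono[OF neD bdd_above_path[OF w] D]) simp
    have "\<omega> s \<le> (SUP s\<in>D. \<omega> s)" if "s \<in> {0..t}" for s
    proof (rule continuous_le_on_closure[of D \<omega>])
      have "closure D \<subseteq> {0..t}" using D closed_atLeastAtMost by (rule closure_minimal)
      then have "closure D \<subseteq> {0..}" by auto
      then show "continuous_on (closure D) \<omega>"
        using w unfolding paths_def by (blast intro: continuous_on_subset)
      show "s \<in> closure D" using dense that by blast
      show "\<And>x. x \<in> D \<Longrightarrow> \<omega> x \<le> (SUP s\<in>D. \<omega> s)" by (rule cSUP_upper[OF _ bD])
    qed
    then show "running_sup t \<omega> \<le> (SUP s\<in>D. \<omega> s)"
      unfolding running_sup_def using t by (intro cSUP_least) auto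
  qed
  have "(\<lambda>\<omega>. SUP s\<in>D. \<omega> s) \<in> borel_measurable (path_filtration t)"
  proof (rule borel_measurable_cSUP[OF cD])
    show "\<And>s. s \<in> D \<Longrightarrow> (\<lambda>\<omega>. \<omega> s) \<in> borel_measurable (path_filtration t)"
      using D by (intro measurable_eval) auto
    show "\<And>\<omega>. \<omega> \<in> space (path_filtration t) \<Longrightarrow> bdd_above ((\<lambda>s. \<omega> s) ` D)"
      using bdd_above_path D by (metis bdd_above_mono image_mono space_path_filtration)
  qed
  then show ?thesis by (rule measurable_cong[THEN iffD2, rotated]) (simp add: eq)
qed

lemma emeasure_gibbs:
  assumes P0: "wiener_measure P0" and t: "0 \<le> t" and L: "\<Lambda> \<in> sets path_sigma"
  shows "emeasure (gibbs P0 \<nu> h t) \<Lambda> =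
    (\<integral>\<^sup>+\<omega>. indicator \<Lambda> \<omega> * ennreal (exp (\<nu> * running_sup t \<omega> + h * \<omega> t)) \<partial>P0) /
    (\<integral>\<^sup>+\<omega>. ennreal (exp (\<nu> * running_sup t \<omega> + h * \<omega> t)) \<partial>P0)"
proof -
  have s: "sets P0 = sets path_sigma" using P0 by (simp add: wiener_measure_def)
  have [measurable]: "running_sup t \<in> borel_measurable P0" "(\<lambda>\<omega>. \<omega> t) \<in> borel_measurable P0"
    unfolding measurable_cong_sets[OF s refl]
    by (auto intro!: measurable_path_sigma[of _ t] measurable_running_sup measurable_eval t)
  have [measurable]: "\<Lambda> \<in> sets P0" using L s by simp
  show ?thesis
    unfolding gibbs_def
    by (simp add: emeasure_density nn_integral_divide[symmetric] ennreal_times_divide mult.commute)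
qed

end

theory Submission
  imports Defs
begin

text \<open>
  By Girsanov's theorem the Gibbs measure is, on \<open>\<F>\<^sub>t\<close>, the law of Brownian motion with drift \<open>b\<close>
  tilted by a density; the choice \<open>b = h\<close> gives the density \<open>exp (\<nu> S\<^sub>t)\<close> and \<open>b = \<nu> + h\<close> gives
  \<open>exp (\<nu> (S\<^sub>t - X\<^sub>t))\<close>, both up to normalization. In \<open>R3\<close> the first density converges in \<open>L\<^sup>1\<close> to
  \<open>exp (\<nu> S\<^sub>\<infinity>)\<close>, because the maximum of Brownian motion with drift \<open>-c < 0\<close> exceeds \<open>a\<close> with probability
  at most \<open>exp (-2 c a)\<close>. An \<open>L\<^sup>1\<close> tilt is asymptotically measurable with respect to an initial segment
  of the path, and the rescaled path is asymptotically independent of each initial segment, so it still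
  converges to Brownian motion. In \<open>R2\<close> time reversal turns \<open>S\<^sub>t - X\<^sub>t\<close> into the maximum of Brownian
  motion with the negative drift \<open>-(\<nu> + h)\<close>, and the same argument applies to the reversed path.

  For the penalized measure in \<open>R2\<close> and \<open>L3\<close>, the density \<open>exp (\<nu> (S\<^sub>t - X\<^sub>t))\<close> differs from the same
  quantity computed after time \<open>s\<close>, which is independent of \<open>\<F>\<^sub>s\<close>, by \<open>|a(t) - a(t - s)|\<close> in \<open>L\<^sup>1\<close>, where
  \<open>a(t)\<close> is its mean. This is \<open>o(a(t))\<close>: in \<open>R2\<close> since \<open>a\<close> has a positive finite limit, and in \<open>L3\<close>
  since \<open>a(t) \<le> a(t - s) + a(s)\<close> and \<open>a(t) \<rightarrow> \<infinity>\<close>. Hence the limit is Brownian motion with drift \<open>\<nu> + h\<close>,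
  whose rescaled law is exactly that of \<open>W\<close>.
\<close>

section \<open>Sigma-algebras generated by coordinates\<close>

text \<open>All computations take place under the single measure \<open>P\<close>. Brownian motion
  with drift b is the image of \<open>P\<close> under \<open>drift b\<close>, and centring cancels
  the drift exactly, so every law in the theorem is that of \<open>unit_scale t\<close> under a
  density with respect to \<open>P\<close>. By Brownian scaling the law of
  \<open>unit_scale t\<close> under \<open>P\<close> itself does not depend on t and equals that of
  W. The obstacle is that the density and the rescaled path are functions of the same path up to
  time t.

  The regions come from one condition. With drift -c < 0, the tail bound makes exp (\<nu> * S)
  integrable for \<nu> < 2 * c, where S is the total maximum. The choice c = -h turns c > 0 and
  \<nu> < 2 * c into \<open>R3\<close>, the choice c = \<nu> + h turns them into \<open>R2\<close>,
  and \<open>L3\<close> is the boundary \<nu> = 2 * c of both, where the mean of exp (\<nu> * S) is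
  infinite. The tail bound itself comes from a change of drift from -c to c at the first exceedance.

  Since \<open>penalized\<close> is a definite description, its value is found by exhibiting a
  measure with the defining limits.\<close>

definition coord_sigma :: "(real \<Rightarrow> real) set \<Rightarrow> real set \<Rightarrow> (real \<Rightarrow> real) measure" where
  "coord_sigma \<Omega> T = vimage_algebra \<Omega> (\<lambda>\<omega>. restrict \<omega> T) (PiM T (\<lambda>_. borel))"

lemma space_coord_sigma [simp]: "space (coord_sigma \<Omega> T) = \<Omega>"
  by (simp add: coord_sigma_def)

lemma measurable_coord: "s \<in> T \<Longrightarrow> (\<lambda>\<omega>. \<omega> s) \<in> borel_measurable (coord_sigma \<Omega> T)"
proof -
  assume s: "s \<in> T"
  have "(\<lambda>\<omega>. restrict \<omega> T) \<in> coord_sigma \<Omega> T \<rightarrow>\<^sub>M PiM T (\<lambda>_. borel)"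
    unfolding coord_sigma_def by (rule measurable_vimage_algebra1) (auto simp: space_PiM)
  from measurable_compose[OF this measurable_component_singleton[OF s]] show ?thesis
    using s by simp
qed

lemma measurable_coord_sigmaI:
  assumes "\<And>x. x \<in> space M \<Longrightarrow> f x \<in> \<Omega>" and "\<And>s. s \<in> T \<Longrightarrow> (\<lambda>x. f x s) \<in> borel_measurable M"
  shows "f \<in> M \<rightarrow>\<^sub>M coord_sigma \<Omega> T"
  unfolding coord_sigma_def
  by (rule measurable_vimage_algebra2) (use assms in \<open>auto intro!: measurable_restrict\<close>)

text \<open>Sigma-algebras given by different generators are compared through the identity map,
  whose measurability only has to be checked on generators or on coordinates.\<close>

lemma sets_eqI_measurable_ident:
  assumes "space M = space N" "(\<lambda>x. x) \<in> M \<rightarrow>\<^sub>M N" "(\<lambda>x. x) \<in> N \<rightarrow>\<^sub>M M"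
  shows "sets M = sets N"
proof (intro subset_antisym subsetI)
  fix A assume "A \<in> sets M"
  from measurable_sets[OF assms(3) this] sets.sets_into_space[OF this] assms(1)
  show "A \<in> sets N" by (simp add: Int_absorb2)
next
  fix A assume "A \<in> sets N"
  from measurable_sets[OF assms(2) this] sets.sets_into_space[OF this] assms(1)
  show "A \<in> sets M" by (simp add: Int_absorb2)
qed

lemma sets_Collect_cylinder:
  assumes "finite J" "\<And>j. j \<in> J \<Longrightarrow> X j \<in> M \<rightarrow>\<^sub>M N" "\<And>j. j \<in> J \<Longrightarrow> A j \<in> sets N"
  shows "{x \<in> space M. \<forall>j\<in>J. X j x \<in> A j} \<in> sets M"
proof (rule sets.sets_Collect_finite_All[OF _ assms(1)])
  fix j assume "j \<in> J"
  from measurable_sets[OF assms(2,3)[OF this]] show "{x \<in> space M. X j x \<in> A j} \<in> sets M"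
    by (simp add: vimage_def Int_def conj_commute)
qed

lemma sets_path_filtration_coord: "sets (path_filtration t) = sets (coord_sigma paths {0..t})"
proof (rule sets_eqI_measurable_ident)
  show "(\<lambda>x. x) \<in> path_filtration t \<rightarrow>\<^sub>M coord_sigma paths {0..t}"
    by (rule measurable_coord_sigmaI) (auto intro: measurable_eval)
  show "(\<lambda>x. x) \<in> coord_sigma paths {0..t} \<rightarrow>\<^sub>M path_filtration t"
    unfolding path_filtration_def
  proof (rule measurable_measure_of)
    fix A assume "A \<in> {(\<lambda>\<omega>. \<omega> s) -` B \<inter> paths | s B. 0 \<le> s \<and> s \<le> t \<and> B \<in> sets borel}"
    then obtain s B where A: "A = (\<lambda>\<omega>. \<omega> s) -` B \<inter> paths" "s \<in> {0..t}" "B \<in> sets borel"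
      by auto
    show "(\<lambda>x. x) -` A \<inter> space (coord_sigma paths {0..t}) \<in> sets (coord_sigma paths {0..t})"
      using measurable_sets[OF measurable_coord[OF A(2), of paths] A(3)] A(1)
      by (simp add: Int_assoc vimage_def)
  qed auto
qed simp

lemma sets_path_sigma_coord: "sets path_sigma = sets (coord_sigma paths {0..})"
proof (rule sets_eqI_measurable_ident)
  show "(\<lambda>x. x) \<in> path_sigma \<rightarrow>\<^sub>M coord_sigma paths {0..}"
    by (rule measurable_coord_sigmaI)
      (auto intro!: measurable_path_sigma[OF measurable_eval, OF _ order_refl])
  show "(\<lambda>x. x) \<in> coord_sigma paths {0..} \<rightarrow>\<^sub>M path_sigma"
    unfolding path_sigma_def
  proof (rule measurable_measure_of[OF gens_path_sigma])
    fix A assume "A \<in> (\<Union>t\<in>{0..}. sets (path_filtration t))"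
    then obtain t where t: "0 \<le> t" "A \<in> sets (coord_sigma paths {0..t})"
      unfolding sets_path_filtration_coord by auto
    have "(\<lambda>x. x) \<in> coord_sigma paths {0..} \<rightarrow>\<^sub>M coord_sigma paths {0..t}"
      by (rule measurable_coord_sigmaI) (auto intro: measurable_coord)
    from measurable_sets[OF this t(2)]
    show "(\<lambda>x. x) -` A \<inter> space (coord_sigma paths {0..}) \<in> sets (coord_sigma paths {0..})"
      by simp
  qed auto
qed simp

text \<open>Every set of \<open>coord_sigma\<close> is the preimage, under restriction to T, of a
  set in the product sigma-algebra, where finite cylinders determine a finite measure. The
  filtration, its limit and the Borel sets of \<open>C01\<close> are all of this form, so one
  uniqueness principle covers the three spaces.\<close>

lemma coord_sigma_eqI:
  assumes sets: "sets \<mu> = sets (coord_sigma \<Omega> T)" "sets \<mu>' = sets (coord_sigma \<Omega> T)"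
    and fin: "finite_measure \<mu>"
    and eq: "\<And>J A. finite J \<Longrightarrow> J \<subseteq> T \<Longrightarrow> (\<And>j. A j \<in> sets borel) \<Longrightarrow>
      emeasure \<mu> {\<omega> \<in> \<Omega>. \<forall>j\<in>J. \<omega> j \<in> A j} = emeasure \<mu>' {\<omega> \<in> \<Omega>. \<forall>j\<in>J. \<omega> j \<in> A j}"
  shows "\<mu> = \<mu>'"
proof -
  let ?P = "PiM T (\<lambda>_. borel :: real measure)"
  let ?r = "\<lambda>\<omega>::real \<Rightarrow> real. restrict \<omega> T"
  have sp: "space \<mu> = \<Omega>" "space \<mu>' = \<Omega>"
    using sets_eq_imp_space_eq[OF sets(1)] sets_eq_imp_space_eq[OF sets(2)] by auto
  have r: "?r \<in> coord_sigma \<Omega> T \<rightarrow>\<^sub>M ?P"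
    unfolding coord_sigma_def by (rule measurable_vimage_algebra1) (auto simp: space_PiM)
  have rm: "?r \<in> \<mu> \<rightarrow>\<^sub>M ?P" "?r \<in> \<mu>' \<rightarrow>\<^sub>M ?P"
    using r sets by (simp_all cong: measurable_cong_sets)
  have D: "distr \<mu> ?P ?r = distr \<mu>' ?P ?r"
  proof (rule measure_eqI_PiM_infinite)
    show "finite_measure (distr \<mu> ?P ?r)"
      using rm(1) fin by (simp add: finite_measure.finite_measure_distr)
    fix A :: "real \<Rightarrow> real set" and J
    assume J: "finite J" "J \<subseteq> T" "\<And>i. i \<in> J \<Longrightarrow> A i \<in> sets borel"
    \<comment> \<open>The hypothesis \<open>eq\<close> asks for a Borel set at every index, while
      only those in J are known to be Borel; the whole line fills the others.\<close>
    define A' where "A' i = (if i \<in> J then A i else UNIV)" for i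
    have A': "A' i \<in> sets borel" for i using J by (auto simp: A'_def)
    have 1: "?r -` prod_emb T (\<lambda>_. borel) J (Pi\<^sub>E J A) \<inter> \<Omega> = {\<omega> \<in> \<Omega>. \<forall>j\<in>J. \<omega> j \<in> A' j}"
    proof (intro set_eqI iffI)
      fix \<omega> assume "\<omega> \<in> ?r -` prod_emb T (\<lambda>_. borel) J (Pi\<^sub>E J A) \<inter> \<Omega>"
      then have "\<omega> \<in> \<Omega>" "restrict (restrict \<omega> T) J \<in> Pi\<^sub>E J A"
        by (auto simp: prod_emb_def)
      then show "\<omega> \<in> {\<omega> \<in> \<Omega>. \<forall>j\<in>J. \<omega> j \<in> A' j}"
        using J(2) by (auto simp: A'_def PiE_iff subset_eq)
    next
      fix \<omega> assume "\<omega> \<in> {\<omega> \<in> \<Omega>. \<forall>j\<in>J. \<omega> j \<in> A' j}"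
      then show "\<omega> \<in> ?r -` prod_emb T (\<lambda>_. borel) J (Pi\<^sub>E J A) \<inter> \<Omega>"
        using J(2) by (auto simp: A'_def PiE_iff subset_eq prod_emb_def)
    qed
    have "prod_emb T (\<lambda>_. borel) J (Pi\<^sub>E J A) \<in> sets ?P"
      using J by (intro sets_PiM_I) auto
    then show "emeasure (distr \<mu> ?P ?r) (prod_emb T (\<lambda>_. borel) J (Pi\<^sub>E J A)) =
      emeasure (distr \<mu>' ?P ?r) (prod_emb T (\<lambda>_. borel) J (Pi\<^sub>E J A))"
      using eq[OF J(1,2) A'] rm by (simp add: emeasure_distr sp 1)
  qed auto
  show ?thesis
  proof (rule measure_eqI)
    show "sets \<mu> = sets \<mu>'" using sets by simp
    fix A assume "A \<in> sets \<mu>"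
    then have "A \<in> sets (coord_sigma \<Omega> T)" using sets by simp
    then obtain B where B: "B \<in> sets ?P" "A = ?r -` B \<inter> \<Omega>"
      unfolding coord_sigma_def by (subst (asm) sets_vimage_algebra2) (auto simp: space_PiM)
    have "emeasure \<mu> A = emeasure (distr \<mu> ?P ?r) B"
      using rm B by (simp add: emeasure_distr sp)
    also have "\<dots> = emeasure \<mu>' A"
      unfolding D using rm B by (simp add: emeasure_distr sp)
    finally show "emeasure \<mu> A = emeasure \<mu>' A" .
  qed
qed

lemma distr_coord_sigma_eqI:
  assumes f: "f \<in> M \<rightarrow>\<^sub>M coord_sigma \<Omega> T" and f': "f' \<in> M' \<rightarrow>\<^sub>M coord_sigma \<Omega> T"
    and fin: "finite_measure M"
    and eq: "\<And>J A. finite J \<Longrightarrow> J \<subseteq> T \<Longrightarrow> (\<And>j. A j \<in> sets borel) \<Longrightarrow>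
      emeasure M {x \<in> space M. \<forall>j\<in>J. f x j \<in> A j} =
      emeasure M' {x \<in> space M'. \<forall>j\<in>J. f' x j \<in> A j}"
  shows "distr M (coord_sigma \<Omega> T) f = distr M' (coord_sigma \<Omega> T) f'"
proof (rule coord_sigma_eqI)
  show "finite_measure (distr M (coord_sigma \<Omega> T) f)"
    using f fin by (simp add: finite_measure.finite_measure_distr)
  fix J and A :: "real \<Rightarrow> real set" assume J: "finite J" "J \<subseteq> T" "\<And>j. A j \<in> sets borel"
  have m: "{\<omega> \<in> \<Omega>. \<forall>j\<in>J. \<omega> j \<in> A j} \<in> sets (coord_sigma \<Omega> T)"
  proof -
    have "(\<lambda>\<omega>. \<omega> j) \<in> borel_measurable (coord_sigma \<Omega> T)" if "j \<in> J" for j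
      using that J by (intro measurable_coord) auto
    from sets_Collect_cylinder[OF J(1) this J(3)] show ?thesis by simp
  qed
  have "f -` {\<omega> \<in> \<Omega>. \<forall>j\<in>J. \<omega> j \<in> A j} \<inter> space M = {x \<in> space M. \<forall>j\<in>J. f x j \<in> A j}"
    using measurable_space[OF f] by auto
  moreover have "f' -` {\<omega> \<in> \<Omega>. \<forall>j\<in>J. \<omega> j \<in> A j} \<inter> space M' = {x \<in> space M'. \<forall>j\<in>J. f' x j \<in> A j}"
    using measurable_space[OF f'] by auto
  ultimately show "emeasure (distr M (coord_sigma \<Omega> T) f) {\<omega> \<in> \<Omega>. \<forall>j\<in>J. \<omega> j \<in> A j} =
      emeasure (distr M' (coord_sigma \<Omega> T) f') {\<omega> \<in> \<Omega>. \<forall>j\<in>J. \<omega> j \<in> A j}"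
    using eq[OF J] f f' m by (simp add: emeasure_distr)
qed simp_all

section \<open>The space of continuous functions on the unit interval\<close>

definition C01_set :: "(real \<Rightarrow> real) set" where
  "C01_set = {x \<in> extensional {0..1}. continuous_on {0..1} x}"

lemma mspace_C01: "mspace (cfunspace (top_of_set {0..1::real}) (euclidean_metric :: real metric)) = C01_set"
proof -
  have "Met_TC.mbounded (f ` {0..1})" if "continuous_on {0..1} f" for f :: "real \<Rightarrow> real"
    using compact_imp_bounded[OF compact_continuous_image[OF that]] by simp
  then show ?thesis
    by (auto simp: C01_set_def)
qed

lemma topspace_C01 [simp]: "topspace C01 = C01_set"
  unfolding C01_def topspace_mtopology_of mspace_C01 ..

abbreviation dist01 :: "(real \<Rightarrow> real) \<Rightarrow> (real \<Rightarrow> real) \<Rightarrow> real" where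
  "dist01 \<equiv> mdist (cfunspace (top_of_set {0..1}) euclidean_metric)"

lemma dist01_le_iff:
  "x \<in> C01_set \<Longrightarrow> y \<in> C01_set \<Longrightarrow> dist01 x y \<le> e \<longleftrightarrow> (\<forall>s\<in>{0..1}. \<bar>x s - y s\<bar> \<le> e)"
  using cfunspace_mdist_le[of x "top_of_set {0..1}" euclidean_metric y e, unfolded mspace_C01]
  by (simp add: dist_real_def)

lemma openin_C01:
  "openin C01 U \<longleftrightarrow> U \<subseteq> C01_set \<and> (\<forall>x\<in>U. \<exists>e>0. \<forall>y\<in>C01_set. dist01 x y < e \<longrightarrow> y \<in> U)"
proof -
  let ?m = "cfunspace (top_of_set {0..1}) euclidean_metric :: (real \<Rightarrow> real) metric"
  have ms: "Metric_space C01_set dist01"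
    using Metric_space_mspace_mdist[of ?m] unfolding mspace_C01 .
  have *: "Metric_space.mball C01_set dist01 x r \<subseteq> U \<longleftrightarrow>
      (\<forall>y\<in>C01_set. dist01 x y < r \<longrightarrow> y \<in> U)" if "U \<subseteq> C01_set" "x \<in> U" for x r
    unfolding Metric_space.mball_def[OF ms] using that by blast
  show ?thesis
    unfolding C01_def mtopology_of_def mspace_C01 Metric_space.openin_mtopology[OF ms]
    using * by blast
qed

text \<open>Bernstein polynomials with rational coefficients. A polynomial is coded by its
  coefficient list, the degree being one less than the length, which makes the set
  countable.\<close>

lemma C01_countable_dense:
  obtains D where "countable D" "D \<subseteq> C01_set"
    "\<And>x e. x \<in> C01_set \<Longrightarrow> e > 0 \<Longrightarrow> \<exists>y\<in>D. dist01 x y < e"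
proof -
  define p where "p qs = (\<lambda>x\<in>{0..1::real}. \<Sum>k<length qs. qs ! k * Bernstein (length qs - 1) k x)"
    for qs :: "real list"
  define D where "D = p ` lists \<rat>"
  show thesis
  proof
    show "countable D" unfolding D_def by (intro countable_image countable_lists countable_rat)
    have p: "p qs \<in> C01_set" for qs
    proof -
      have "continuous_on {0..1} (\<lambda>x. \<Sum>k<length qs. qs ! k * Bernstein (length qs - 1) k x)"
        unfolding Bernstein_def by (intro continuous_intros)
      then have "continuous_on {0..1} (p qs)"
        by (rule continuous_on_eq) (simp add: p_def)
      then show ?thesis by (simp add: p_def C01_set_def)
    qed
    then show "D \<subseteq> C01_set" unfolding D_def by auto
    fix x :: "real \<Rightarrow> real" and e :: real assume x: "x \<in> C01_set" and e: "e > 0"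
    have cx: "continuous_on {0..1} x" using x by (simp add: C01_set_def)
    have "0 < e / 4" using e by simp
    from Bernstein_Weierstrass[OF cx this] obtain n :: nat where
      n: "\<And>s. s \<in> {0..1} \<Longrightarrow> \<bar>x s - (\<Sum>k\<le>n. x (k/n) * Bernstein n k s)\<bar> < e / 4"
      by blast
    have "\<exists>q\<in>\<rat>. \<bar>x (k/n) - q\<bar> < e / 4" for k :: nat
    proof -
      obtain q where "q \<in> \<rat>" "x (k/n) - e/4 < q" "q < x (k/n) + e/4"
        using Rats_dense_in_real[of "x (k/n) - e/4" "x (k/n) + e/4"] e by auto
      then show ?thesis by (intro bexI[of _ q]) linarith+
    qed
    then have "\<exists>q. \<forall>k::nat. q k \<in> \<rat> \<and> \<bar>x (k/n) - q k\<bar> < e / 4"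
      by (intro choice allI) blast
    then obtain q where q: "\<And>k::nat. q k \<in> \<rat>" "\<And>k::nat. \<bar>x (k/n) - q k\<bar> < e / 4" by blast
    define qs where "qs = map q [0..<Suc n]"
    have qs: "p qs s = (\<Sum>k\<le>n. q k * Bernstein n k s)" if "s \<in> {0..1}" for s
      using that unfolding p_def qs_def lessThan_Suc_atMost[symmetric]
      by (auto simp del: upt_Suc intro!: sum.cong)
    have "\<bar>x s - p qs s\<bar> \<le> e / 2" if s: "s \<in> {0..1}" for s
    proof -
      have "\<bar>(\<Sum>k\<le>n. x (k/n) * Bernstein n k s) - p qs s\<bar> = \<bar>\<Sum>k\<le>n. (x (k/n) - q k) * Bernstein n k s\<bar>"
        by (simp add: qs[OF s] sum_subtractf algebra_simps)
      also have "\<dots> \<le> (\<Sum>k\<le>n. \<bar>(x (k/n) - q k) * Bernstein n k s\<bar>)" by (rule sum_abs)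
      \<comment> \<open>The Bernstein basis is nonnegative and sums to 1, so moving every
        coefficient by at most e / 4 moves the polynomial by at most e / 4.\<close>
      also have "\<dots> \<le> (\<Sum>k\<le>n. e / 4 * Bernstein n k s)"
      proof (intro sum_mono)
        fix k
        have "0 \<le> Bernstein n k s" using s by (intro Bernstein_nonneg) auto
        then show "\<bar>(x (k/n) - q k) * Bernstein n k s\<bar> \<le> e / 4 * Bernstein n k s"
          unfolding abs_mult using q(2)[of k] e by (intro mult_mono) auto
      qed
      also have "\<dots> = e / 4" unfolding sum_distrib_left[symmetric] by simp
      finally show ?thesis using n[OF s] by linarith
    qed
    then have "dist01 x (p qs) \<le> e / 2" using dist01_le_iff[OF x p[of qs], of "e/2"] by blast
    then have "dist01 x (p qs) < e" using e by linarith
    moreover have "qs \<in> lists \<rat>" unfolding qs_def using q(1) by auto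
    then have "p qs \<in> D" unfolding D_def by (rule imageI)
    ultimately show "\<exists>y\<in>D. dist01 x y < e" by blast
  qed
qed

text \<open>Rational points of the unit interval are dense and both functions are continuous, so a
  bound on the supremum distance is a countable conjunction of conditions on coordinates.\<close>

lemma C01_le_rat:
  assumes "x \<in> C01_set" "y \<in> C01_set" "\<And>s. s \<in> \<rat> \<inter> {0..1} \<Longrightarrow> \<bar>x s - y s\<bar> \<le> e"
  shows "dist01 x y \<le> e"
proof -
  have cl: "closure (\<rat> \<inter> {0..1::real}) = {0..1}"
  proof -
    have "closure (\<rat> \<inter> {0<..<1::real}) = {0..1}"
      using closure_open_Int_superset[of "{0<..<1::real}" "\<rat>"]
      by (simp add: Int_commute Rats_closure_real)
    moreover have "closure (\<rat> \<inter> {0<..<1::real}) \<subseteq> closure (\<rat> \<inter> {0..1::real})"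
      by (intro closure_mono) auto
    moreover have "closure (\<rat> \<inter> {0..1::real}) \<subseteq> {0..1}"
      by (rule closure_minimal) auto
    ultimately show ?thesis by auto
  qed
  have "\<bar>x s - y s\<bar> \<le> e" if "s \<in> {0..1}" for s
  proof (rule continuous_le_on_closure[of "\<rat> \<inter> {0..1::real}" "\<lambda>s. \<bar>x s - y s\<bar>"])
    show "continuous_on (closure (\<rat> \<inter> {0..1})) (\<lambda>s. \<bar>x s - y s\<bar>)"
      using assms(1,2) unfolding cl C01_set_def by (auto intro!: continuous_intros)
  qed (use that assms(3) cl in auto)
  then show ?thesis using assms by (simp add: dist01_le_iff)
qed

text \<open>One inclusion is the continuity of evaluations. For the other, separability writes an
  open set as a countable union of closed balls, and each closed ball is a countable intersection of
  coordinate conditions.\<close>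

lemma sets_borel_of_C01: "sets (borel_of C01) = sets (coord_sigma C01_set {0..1})"
proof (rule sets_eqI_measurable_ident)
  have sp: "{U. openin C01 U} \<subseteq> Pow (topspace C01)" using openin_subset[of C01] by blast
  show sp': "space (borel_of C01) = space (coord_sigma C01_set {0..1})"
    unfolding borel_of_def using sp by (simp add: space_measure_of)
  show "(\<lambda>x. x) \<in> borel_of C01 \<rightarrow>\<^sub>M coord_sigma C01_set {0..1}"
  proof (rule measurable_coord_sigmaI)
    fix s :: real assume s: "s \<in> {0..1}"
    show "(\<lambda>x. x s) \<in> borel_measurable (borel_of C01)"
      unfolding borel_def
    proof (rule measurable_measure_of)
      fix V :: "real set" assume "V \<in> {S. open S}"
      then have V: "open V" by simp
      have "openin C01 ((\<lambda>x. x s) -` V \<inter> C01_set)"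
        unfolding openin_C01
      proof (intro conjI ballI)
        fix x assume x: "x \<in> (\<lambda>x. x s) -` V \<inter> C01_set"
        then obtain e where e: "e > 0" "\<And>z. \<bar>z - x s\<bar> < e \<Longrightarrow> z \<in> V"
          using V unfolding open_dist dist_real_def by auto
        show "\<exists>e>0. \<forall>y\<in>C01_set. dist01 x y < e \<longrightarrow> y \<in> (\<lambda>x. x s) -` V \<inter> C01_set"
        proof (intro exI[of _ e] conjI ballI impI e(1))
          fix y assume y: "y \<in> C01_set" "dist01 x y < e"
          have "\<bar>x s - y s\<bar> \<le> dist01 x y" using dist01_le_iff[of x y "dist01 x y"] x y s by auto
          then show "y \<in> (\<lambda>x. x s) -` V \<inter> C01_set"
            using y e(2)[of "y s"] by auto
        qed
      qed auto
      then show "(\<lambda>x. x s) -` V \<inter> space (borel_of C01) \<in> sets (borel_of C01)"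
        unfolding sp' unfolding borel_of_def using sp by (simp add: sets_measure_of sigma_sets.Basic)
    qed auto
  qed (simp add: sp')
  show "(\<lambda>x. x) \<in> coord_sigma C01_set {0..1} \<rightarrow>\<^sub>M borel_of C01"
    unfolding borel_of_def
  proof (rule measurable_measure_of[OF sp])
    fix U assume "U \<in> {U. openin C01 U}"
    then have U: "openin C01 U" by simp
    obtain D where D: "countable D" "D \<subseteq> C01_set"
      "\<And>x e. x \<in> C01_set \<Longrightarrow> e > 0 \<Longrightarrow> \<exists>y\<in>D. dist01 x y < e"
      using C01_countable_dense by blast
    define B where "B y r = {x \<in> C01_set. \<forall>s\<in>\<rat> \<inter> {0..1}. \<bar>x s - y s\<bar> \<le> r}" for y and r :: real
    define I where "I = {(y, r). y \<in> D \<and> r \<in> \<rat> \<and> B y r \<subseteq> U}"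
    have BU: "U = (\<Union>(y, r)\<in>I. B y r)"
    proof (intro subset_antisym subsetI)
      fix x assume x: "x \<in> U"
      then have xC: "x \<in> C01_set" using U unfolding openin_C01 by auto
      obtain e where e: "e > 0" "\<And>y. y \<in> C01_set \<Longrightarrow> dist01 x y < e \<Longrightarrow> y \<in> U"
        using U x unfolding openin_C01 by blast
      \<comment> \<open>The bound r < e / 2 is used twice: y lies within r of x, and the ball of
        radius r about y stays within 2 * r < e of x.\<close>
      obtain r where r: "r \<in> \<rat>" "0 < r" "r < e / 2"
        using Rats_dense_in_real[of 0 "e/2"] e by auto
      obtain y where y: "y \<in> D" "dist01 x y < r" using D(3)[OF xC r(2)] by auto
      have yC: "y \<in> C01_set" using y D by auto
      have xy: "\<bar>x s - y s\<bar> \<le> r" if "s \<in> {0..1}" for s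
        using dist01_le_iff[OF xC yC, of r] y(2) that by auto
      have "B y r \<subseteq> U"
      proof
        fix z assume z: "z \<in> B y r"
        have "dist01 x z \<le> 2 * r"
        proof (rule C01_le_rat[OF xC])
          show "\<bar>x s - z s\<bar> \<le> 2 * r" if "s \<in> \<rat> \<inter> {0..1}" for s
          proof -
            have "\<bar>x s - y s\<bar> \<le> r" "\<bar>z s - y s\<bar> \<le> r" using xy[of s] z that unfolding B_def by auto
            then show ?thesis by linarith
          qed
        qed (use z in \<open>auto simp: B_def\<close>)
        then show "z \<in> U" using z r e(2)[of z] unfolding B_def by auto
      qed
      moreover have "x \<in> B y r" using xy xC unfolding B_def by auto
      ultimately show "x \<in> (\<Union>(y, r)\<in>I. B y r)" using y r unfolding I_def by auto
    qed (auto simp: I_def)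
    have "I \<subseteq> D \<times> \<rat>" unfolding I_def by auto
    then have cI: "countable I" using D(1) countable_rat by (meson countable_SIGMA countable_subset)
    have Bm: "B y r \<in> sets (coord_sigma C01_set {0..1})" for y r
    proof -
      have "{x \<in> space (coord_sigma C01_set {0..1}). \<forall>s\<in>\<rat> \<inter> {0..1}. \<bar>x s - y s\<bar> \<le> r}
          \<in> sets (coord_sigma C01_set {0..1})"
      proof (rule sets.sets_Collect_countable_All')
        fix s :: real assume s: "s \<in> \<rat> \<inter> {0..1}"
        have [measurable]: "(\<lambda>x. x s) \<in> borel_measurable (coord_sigma C01_set {0..1})"
          by (rule measurable_coord) (use s in auto)
        show "{x \<in> space (coord_sigma C01_set {0..1}). \<bar>x s - y s\<bar> \<le> r} \<in> sets (coord_sigma C01_set {0..1})"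
          by measurable
      qed (simp add: countable_rat)
      then show ?thesis unfolding B_def by simp
    qed
    have "U \<in> sets (coord_sigma C01_set {0..1})"
      unfolding BU by (rule sets.countable_UN'[OF cI]) (auto simp: Bm)
    moreover have "(\<lambda>x. x) -` U \<inter> space (coord_sigma C01_set {0..1}) = U"
      using openin_subset[OF U] by auto
    ultimately show "(\<lambda>x. x) -` U \<inter> space (coord_sigma C01_set {0..1}) \<in> sets (coord_sigma C01_set {0..1})"
      by simp
  qed simp
qed

section \<open>Increments of Brownian motion\<close>

text \<open>The point t > 0 of J guarantees two distinct grid points, hence n > 0; the product form
  of the joint law of the increments requires a nonempty index set.\<close>

lemma ex_strict_mono_enumeration:
  fixes J :: "real set"
  assumes "finite J" "J \<subseteq> {0..}" "t \<in> J" "t > 0"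
  obtains n :: nat and \<tau> where "n > 0" "\<tau> 0 = 0" "strict_mono_on {..n} \<tau>" "\<tau> ` {..n} = insert 0 J"
proof -
  define xs where "xs = sorted_list_of_set (insert 0 J)"
  define n where "n = length xs - 1"
  have set: "set xs = insert 0 J" and sorted: "sorted_wrt (<) xs"
    using assms(1) unfolding xs_def
    by (simp_all only: set_sorted_list_of_set finite_insert strict_sorted_list_of_set)
  have "card (insert 0 J) \<ge> card {0, t}" using assms by (intro card_mono) auto
  then have len: "length xs \<ge> 2" using assms by (simp only: xs_def length_sorted_list_of_set) auto
  have less: "xs ! i < xs ! j" if "i < j" "j < length xs" for i j
    using sorted_wrt_nth_less[OF sorted that] .
  have lt: "{..n} = {..<length xs}" using len by (auto simp: n_def)
  show thesis
  proof
    show "n > 0" using len by (simp add: n_def)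
    show "strict_mono_on {..n} ((!) xs)" unfolding lt by (auto intro!: strict_mono_onI less)
    show im: "(!) xs ` {..n} = insert 0 J" unfolding lt set[symmetric]
      by (auto simp: set_conv_nth)
    have "0 \<in> (!) xs ` {..n}" unfolding im by simp
    then obtain k where k: "k < length xs" "xs ! k = 0" unfolding lt by auto
    have "xs ! 0 \<in> set xs" using len by (intro nth_mem) auto
    then have "xs ! 0 \<in> insert 0 J" unfolding set .
    then have "xs ! 0 \<ge> 0" using assms by auto
    then show "xs ! 0 = 0" using less[of 0 k] k by (cases "k = 0") auto
  qed
qed

lemma standard_BM_prob_space: "standard_BM T M B \<Longrightarrow> prob_space M"
  by (simp add: standard_BM_def)

lemma standard_BM_measurable: "standard_BM T M B \<Longrightarrow> t \<in> T \<Longrightarrow> B t \<in> borel_measurable M"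
  by (simp add: standard_BM_def)

lemma standard_BM_0: "standard_BM T M B \<Longrightarrow> AE \<omega> in M. B 0 \<omega> = 0"
  by (simp add: standard_BM_def)

lemma standard_BM_distributed:
  "standard_BM T M B \<Longrightarrow> s \<in> T \<Longrightarrow> t \<in> T \<Longrightarrow> s < t \<Longrightarrow>
    distributed M lborel (\<lambda>\<omega>. B t \<omega> - B s \<omega>) (\<lambda>x. ennreal (normal_density 0 (sqrt (t - s)) x))"
  by (simp add: standard_BM_def)

lemma standard_BM_indep:
  "standard_BM T M B \<Longrightarrow> strict_mono_on {..n} \<tau> \<Longrightarrow> \<tau> ` {..n} \<subseteq> T \<Longrightarrow>
    prob_space.indep_vars M (\<lambda>_. borel) (\<lambda>i \<omega>. B (\<tau> (Suc i)) \<omega> - B (\<tau> i) \<omega>) {..<n}"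
  unfolding standard_BM_def by blast

lemma distr_increments:
  assumes BM: "standard_BM T M B" and \<tau>: "strict_mono_on {..n} \<tau>" "\<tau> ` {..n} \<subseteq> T" and n: "n > 0"
  shows "distr M (PiM {..<n} (\<lambda>_. borel))
      (\<lambda>\<omega>. \<lambda>i\<in>{..<n}. B (\<tau> (Suc i)) \<omega> - B (\<tau> i) \<omega> + h * (\<tau> (Suc i) - \<tau> i)) =
    PiM {..<n} (\<lambda>i. density lborel (normal_density (h * (\<tau> (Suc i) - \<tau> i)) (sqrt (\<tau> (Suc i) - \<tau> i))))"
proof -
  interpret prob_space M using BM by (rule standard_BM_prob_space)
  let ?X = "\<lambda>i \<omega>. B (\<tau> (Suc i)) \<omega> - B (\<tau> i) \<omega> + h * (\<tau> (Suc i) - \<tau> i)"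
  have "indep_vars (\<lambda>_. borel) ?X {..<n}"
    by (rule indep_vars_compose2[OF standard_BM_indep[OF BM \<tau>], where Y = "\<lambda>i x. x + h * (\<tau> (Suc i) - \<tau> i)"]) simp
  moreover have T: "\<tau> i \<in> T" "\<tau> (Suc i) \<in> T" "\<tau> i < \<tau> (Suc i)" if "i < n" for i
    using \<tau> that by (auto intro: strict_mono_onD)
  have "?X i \<in> borel_measurable M" if "i < n" for i
    using standard_BM_measurable[OF BM] T[OF that] by simp
  ultimately have "distr M (PiM {..<n} (\<lambda>_. borel)) (\<lambda>\<omega>. \<lambda>i\<in>{..<n}. ?X i \<omega>) =
      PiM {..<n} (\<lambda>i. distr M borel (?X i))"
    using n by (subst (asm) indep_vars_iff_distr_eq_PiM') auto
  also have "\<dots> = PiM {..<n} (\<lambda>i. density lborel (normal_density (h * (\<tau> (Suc i) - \<tau> i)) (sqrt (\<tau> (Suc i) - \<tau> i))))"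
  proof (intro PiM_cong refl)
    fix i assume "i \<in> {..<n}"
    then have i: "i < n" by simp
    have "distributed M lborel (\<lambda>\<omega>. h * (\<tau> (Suc i) - \<tau> i) + 1 * (B (\<tau> (Suc i)) \<omega> - B (\<tau> i) \<omega>))
      (\<lambda>x. ennreal (normal_density (h * (\<tau> (Suc i) - \<tau> i) + 1 * 0) (\<bar>1\<bar> * sqrt (\<tau> (Suc i) - \<tau> i)) x))"
      by (rule normal_density_affine[OF standard_BM_distributed[OF BM T(1,2,3)[OF i]]])
        (use T(3)[OF i] in auto)
    then have "distributed M lborel (?X i)
        (normal_density (h * (\<tau> (Suc i) - \<tau> i)) (sqrt (\<tau> (Suc i) - \<tau> i)))"
      by (simp add: add.commute)
    then show "distr M borel (?X i) =
        density lborel (normal_density (h * (\<tau> (Suc i) - \<tau> i)) (sqrt (\<tau> (Suc i) - \<tau> i)))"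
      by (simp add: distributed_def cong: distr_cong)
  qed
  finally show ?thesis .
qed

text \<open>The cylinder of paths x with x j in A j for all j in J, in increment coordinates: a path
  from 0 has at time \<open>\<tau> k\<close> the sum of the first k increments as its value.\<close>

definition increment_cylinder ::
    "(nat \<Rightarrow> real) \<Rightarrow> nat \<Rightarrow> real set \<Rightarrow> (real \<Rightarrow> real set) \<Rightarrow> (nat \<Rightarrow> real) set" where
  "increment_cylinder \<tau> n J A =
     {x \<in> space (PiM {..<n} (\<lambda>_. borel)). \<forall>k\<in>{k\<in>{..n}. \<tau> k \<in> J}. (\<Sum>i<k. x i) \<in> A (\<tau> k)}"

lemma increment_cylinder_measurable:
  assumes "\<And>j. A j \<in> sets borel"
  shows "increment_cylinder \<tau> n J A \<in> sets (PiM {..<n} (\<lambda>_. borel))"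
  unfolding increment_cylinder_def
  by (rule sets_Collect_cylinder[where N = borel])
    (auto intro!: borel_measurable_sum measurable_component_singleton assms)

lemma mem_increment_cylinder_iff:
  assumes J: "J \<subseteq> \<tau> ` {..n}" and x0: "x (\<tau> 0) = 0"
  shows "(\<lambda>i\<in>{..<n}. x (\<tau> (Suc i)) - x (\<tau> i)) \<in> increment_cylinder \<tau> n J A \<longleftrightarrow> (\<forall>j\<in>J. x j \<in> A j)"
proof -
  have "(\<Sum>i<k. (\<lambda>i\<in>{..<n}. x (\<tau> (Suc i)) - x (\<tau> i)) i) = x (\<tau> k)" if "k \<le> n" for k
  proof -
    have "(\<Sum>i<k. (\<lambda>i\<in>{..<n}. x (\<tau> (Suc i)) - x (\<tau> i)) i) = (\<Sum>i<k. x (\<tau> (Suc i)) - x (\<tau> i))"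
      using that by (intro sum.cong) auto
    then show ?thesis using x0 sum_lessThan_telescope[of "\<lambda>i. x (\<tau> i)" k] by simp
  qed
  then have "(\<lambda>i\<in>{..<n}. x (\<tau> (Suc i)) - x (\<tau> i)) \<in> increment_cylinder \<tau> n J A \<longleftrightarrow>
      (\<forall>k\<le>n. \<tau> k \<in> J \<longrightarrow> x (\<tau> k) \<in> A (\<tau> k))"
    by (auto simp: increment_cylinder_def space_PiM)
  also have "\<dots> \<longleftrightarrow> (\<forall>j\<in>J. x j \<in> A j)" using J by fastforce
  finally show ?thesis .
qed

text \<open>The right-hand side involves neither M nor B. With h = 0 it therefore says that two
  Brownian motions have the same finite-dimensional distributions; general h provides the shifted
  side of Girsanov's formula.\<close>

lemma emeasure_BM_cylinder:
  assumes BM: "standard_BM T M B" and \<tau>: "strict_mono_on {..n} \<tau>" "\<tau> ` {..n} \<subseteq> T" and n: "n > 0"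
    and \<tau>0: "\<tau> 0 = 0" and J: "J \<subseteq> \<tau> ` {..n}" and A: "\<And>j. A j \<in> sets borel"
  shows "emeasure M {\<omega> \<in> space M. \<forall>j\<in>J. B j \<omega> + h * j \<in> A j} =
    emeasure (PiM {..<n} (\<lambda>i. density lborel (normal_density (h * (\<tau> (Suc i) - \<tau> i)) (sqrt (\<tau> (Suc i) - \<tau> i)))))
      (increment_cylinder \<tau> n J A)"
proof -
  let ?X = "\<lambda>\<omega>. \<lambda>i\<in>{..<n}. B (\<tau> (Suc i)) \<omega> - B (\<tau> i) \<omega> + h * (\<tau> (Suc i) - \<tau> i)"
  have Bm: "B (\<tau> i) \<in> borel_measurable M" if "i \<le> n" for i
    using standard_BM_measurable[OF BM] \<tau>(2) that by auto
  have X: "?X \<in> M \<rightarrow>\<^sub>M PiM {..<n} (\<lambda>_. borel)"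
    by (intro measurable_restrict borel_measurable_add borel_measurable_diff) (auto intro: Bm)
  have finJ: "finite J" using J by (rule finite_subset) simp
  have "{\<omega> \<in> space M. \<forall>j\<in>J. B j \<omega> + h * j \<in> A j} \<in> sets M"
  proof (rule sets_Collect_cylinder[OF finJ _ A])
    fix j assume "j \<in> J"
    then have "B j \<in> borel_measurable M" using J Bm by auto
    then show "(\<lambda>\<omega>. B j \<omega> + h * j) \<in> borel_measurable M" by simp
  qed
  \<comment> \<open>B starts at 0 only almost surely, so the two events agree only up to a null
    set.\<close>
  moreover have "AE \<omega> in M. \<omega> \<in> {\<omega> \<in> space M. \<forall>j\<in>J. B j \<omega> + h * j \<in> A j} \<longleftrightarrow>
      \<omega> \<in> ?X -` increment_cylinder \<tau> n J A \<inter> space M"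
    using standard_BM_0[OF BM] AE_space
  proof eventually_elim
    fix \<omega> assume "B 0 \<omega> = 0" "\<omega> \<in> space M"
    then show "\<omega> \<in> {\<omega> \<in> space M. \<forall>j\<in>J. B j \<omega> + h * j \<in> A j} \<longleftrightarrow>
      \<omega> \<in> ?X -` increment_cylinder \<tau> n J A \<inter> space M"
      using mem_increment_cylinder_iff[OF J, of "\<lambda>s. B s \<omega> + h * s" A] \<tau>0
      by (simp add: algebra_simps)
  qed
  ultimately have "emeasure M {\<omega> \<in> space M. \<forall>j\<in>J. B j \<omega> + h * j \<in> A j} =
      emeasure M (?X -` increment_cylinder \<tau> n J A \<inter> space M)"
    using measurable_sets[OF X increment_cylinder_measurable[OF A]] by (intro emeasure_eq_AE)
  also have "\<dots> = emeasure (distr M (PiM {..<n} (\<lambda>_. borel)) ?X) (increment_cylinder \<tau> n J A)"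
    using increment_cylinder_measurable[OF A] X by (simp add: emeasure_distr)
  finally show ?thesis unfolding distr_increments[OF BM \<tau> n] .
qed

section \<open>Girsanov's formula on finitely many increments\<close>

lemma density_PiM:
  assumes I: "finite I" and "\<And>i. sigma_finite_measure (M i)"
    and f [measurable]: "\<And>i. f i \<in> borel_measurable (M i)"
    and "\<And>i. sigma_finite_measure (density (M i) (f i))"
  shows "density (PiM I M) (\<lambda>x. \<Prod>i\<in>I. f i (x i)) = PiM I (\<lambda>i. density (M i) (f i))"
proof -
  interpret M: product_sigma_finite M using assms by (simp add: product_sigma_finite_def)
  interpret D: product_sigma_finite "\<lambda>i. density (M i) (f i)" using assms by (simp add: product_sigma_finite_def)
  show ?thesis
  proof (rule D.PiM_eqI[OF I])
    show "sets (density (PiM I M) (\<lambda>x. \<Prod>i\<in>I. f i (x i))) = sets (PiM I (\<lambda>i. density (M i) (f i)))"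
      by (simp cong: sets_PiM_cong)
    fix A assume "\<And>i. i \<in> I \<Longrightarrow> A i \<in> sets (density (M i) (f i))"
    then have A: "A i \<in> sets (M i)" if "i \<in> I" for i using that by simp
    have 1: "(\<lambda>x. f i (x i)) \<in> borel_measurable (PiM I M)" if "i \<in> I" for i
      by (rule measurable_compose[OF measurable_component_singleton[OF that] f])
    have "emeasure (density (PiM I M) (\<lambda>x. \<Prod>i\<in>I. f i (x i))) (Pi\<^sub>E I A) =
        (\<integral>\<^sup>+x. (\<Prod>i\<in>I. f i (x i)) * indicator (Pi\<^sub>E I A) x \<partial>PiM I M)"
      using A I 1 by (intro emeasure_density borel_measurable_prod sets_PiM_I_finite) auto
    also have "\<dots> = (\<integral>\<^sup>+x. (\<Prod>i\<in>I. f i (x i) * indicator (A i) (x i)) \<partial>PiM I M)"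
    proof (rule nn_integral_cong)
      fix x assume x: "x \<in> space (PiM I M)"
      have "indicator (Pi\<^sub>E I A) x = (\<Prod>i\<in>I. indicator (A i) (x i) :: ennreal)"
        using x I by (auto simp: indicator_def PiE_iff space_PiM prod.If_cases intro: prod_zero)
      then show "(\<Prod>i\<in>I. f i (x i)) * indicator (Pi\<^sub>E I A) x = (\<Prod>i\<in>I. f i (x i) * indicator (A i) (x i))"
        by (simp add: prod.distrib)
    qed
    also have "\<dots> = (\<Prod>i\<in>I. \<integral>\<^sup>+x. f i x * indicator (A i) x \<partial>M i)"
      using A by (intro M.product_nn_integral_prod I) simp
    also have "\<dots> = (\<Prod>i\<in>I. emeasure (density (M i) (f i)) (A i))"
      using A by (intro prod.cong refl) (simp add: emeasure_density)
    finally show "emeasure (density (PiM I M) (\<lambda>x. \<Prod>i\<in>I. f i (x i))) (Pi\<^sub>E I A) =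
      (\<Prod>i\<in>I. emeasure (density (M i) (f i)) (A i))" .
  qed
qed

text \<open>Completing the square in the exponent.\<close>

lemma normal_density_tilt:
  assumes "d > 0"
  shows "normal_density 0 (sqrt d) x * exp (h * x - h\<^sup>2 * d / 2) = normal_density (h * d) (sqrt d) x"
proof -
  have "- x\<^sup>2 / (2 * d) + (h * x - h\<^sup>2 * d / 2) = - (x - h * d)\<^sup>2 / (2 * d)"
    using assms by (simp add: field_simps power2_eq_square)
  then show ?thesis
    using assms by (simp add: normal_density_def flip: exp_add)
qed

lemma density_PiM_normal:
  fixes n :: nat
  assumes "\<And>i. i < n \<Longrightarrow> d i > 0"
  shows "density (PiM {..<n} (\<lambda>i. density lborel (normal_density 0 (sqrt (d i)))))
      (\<lambda>x. \<Prod>i<n. ennreal (exp (h * x i - h\<^sup>2 * d i / 2))) =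
    PiM {..<n} (\<lambda>i. density lborel (normal_density (h * d i) (sqrt (d i))))"
proof -
  \<comment> \<open>\<open>density_PiM\<close> asks for sigma-finiteness at every index, while d is
    positive only below n; the value 1 elsewhere supplies genuine normal laws.\<close>
  define d' where "d' i = (if i < n then d i else 1)" for i
  have d': "d' i > 0" for i using assms by (simp add: d'_def)
  have tilt: "density (density lborel (normal_density 0 (sqrt (d' i)))) (\<lambda>x. ennreal (exp (h * x - h\<^sup>2 * d' i / 2))) =
      density lborel (normal_density (h * d' i) (sqrt (d' i)))" for i
    by (subst density_density_eq)
      (simp_all add: normal_density_tilt[OF d'] flip: ennreal_mult')
  have sf: "sigma_finite_measure (density lborel (\<lambda>x. ennreal (normal_density m (sqrt (d' i)) x)))" for m i
    using prob_space_normal_density[of "sqrt (d' i)" m] d'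
    by (simp add: prob_space_imp_sigma_finite)
  have "density (PiM {..<n} (\<lambda>i. density lborel (normal_density 0 (sqrt (d i)))))
      (\<lambda>x. \<Prod>i<n. ennreal (exp (h * x i - h\<^sup>2 * d i / 2))) =
    density (PiM {..<n} (\<lambda>i. density lborel (normal_density 0 (sqrt (d' i)))))
      (\<lambda>x. \<Prod>i<n. ennreal (exp (h * x i - h\<^sup>2 * d' i / 2)))"
    by (intro arg_cong2[where f = density] PiM_cong ext prod.cong) (auto simp: d'_def)
  also have "\<dots> = PiM {..<n} (\<lambda>i. density (density lborel (normal_density 0 (sqrt (d' i))))
      (\<lambda>x. ennreal (exp (h * x - h\<^sup>2 * d' i / 2))))"
    by (rule density_PiM[where M = "\<lambda>i. density lborel (normal_density 0 (sqrt (d' i)))"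
          and f = "\<lambda>i x. ennreal (exp (h * x - h\<^sup>2 * d' i / 2))"]) (auto simp: tilt sf)
  also have "\<dots> = PiM {..<n} (\<lambda>i. density lborel (normal_density (h * d i) (sqrt (d i))))"
    unfolding tilt by (intro PiM_cong) (auto simp: d'_def)
  finally show ?thesis .
qed

text \<open>The exponent h * B t - h^2 * t / 2 telescopes into the same expression for each
  increment, so the weight is a product over independent increments and shifts the mean of each from
  0 to h times its length. The times 0 and t are added to the grid so that the sum ends at B
  t.\<close>

lemma girsanov_cylinder:
  assumes BM: "standard_BM T M B" and T: "{0..t} \<subseteq> T" and t: "t > 0"
    and J: "finite J" "J \<subseteq> {0..t}" and A: "\<And>j. A j \<in> sets borel"
  shows "(\<integral>\<^sup>+\<omega>. ennreal (exp (h * B t \<omega> - h\<^sup>2 * t / 2)) * indicator {\<omega> \<in> space M. \<forall>j\<in>J. B j \<omega> \<in> A j} \<omega> \<partial>M) =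
    emeasure M {\<omega> \<in> space M. \<forall>j\<in>J. B j \<omega> + h * j \<in> A j}"
proof -
  obtain n :: nat and \<tau> where n: "n > 0" and \<tau>0: "\<tau> 0 = 0" and mono: "strict_mono_on {..n} \<tau>"
    and im: "\<tau> ` {..n} = insert 0 (insert t J)"
  proof (rule ex_strict_mono_enumeration[OF _ _ insertI1 t])
    show "finite (insert t J)" "insert t J \<subseteq> {0..}" using J t by auto
  qed
  have sub: "\<tau> ` {..n} \<subseteq> T" using J T t unfolding im by auto
  have d: "\<tau> (Suc i) - \<tau> i > 0" if "i < n" for i using strict_mono_onD[OF mono, of i "Suc i"] that by simp
  have \<tau>n: "\<tau> n = t"
  proof -
    have "t \<in> \<tau> ` {..n}" unfolding im by simp
    then obtain k where k: "k \<le> n" "\<tau> k = t" by auto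
    have "\<tau> n \<in> insert 0 (insert t J)" unfolding im[symmetric] by simp
    then have "\<tau> n \<le> t" using J t by auto
    then show ?thesis using strict_mono_onD[OF mono, of k n] k by (cases "k = n") auto
  qed
  let ?X = "\<lambda>\<omega>. \<lambda>i\<in>{..<n}. B (\<tau> (Suc i)) \<omega> - B (\<tau> i) \<omega>"
  let ?P = "PiM {..<n} (\<lambda>i. density lborel (normal_density 0 (sqrt (\<tau> (Suc i) - \<tau> i))))"
  let ?g = "\<lambda>x. \<Prod>i<n. ennreal (exp (h * x i - h\<^sup>2 * (\<tau> (Suc i) - \<tau> i) / 2))"
  let ?C = "increment_cylinder \<tau> n J A"
  have J': "J \<subseteq> \<tau> ` {..n}" unfolding im by auto
  have Bm: "B (\<tau> i) \<in> borel_measurable M" if "i \<le> n" for i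
    using standard_BM_measurable[OF BM] sub that by auto
  have X: "?X \<in> M \<rightarrow>\<^sub>M PiM {..<n} (\<lambda>_. borel)"
    by (intro measurable_restrict borel_measurable_diff) (auto intro: Bm)
  have setsP: "sets ?P = sets (PiM {..<n} (\<lambda>_. borel))" by (intro sets_PiM_cong) auto
  have C: "?C \<in> sets (PiM {..<n} (\<lambda>_. borel))" by (rule increment_cylinder_measurable[OF A])
  have g: "?g \<in> borel_measurable (PiM {..<n} (\<lambda>_. borel))"
  proof (rule borel_measurable_prod_ennreal)
    fix i assume "i \<in> {..<n}"
    then have [measurable]: "(\<lambda>x. x i) \<in> borel_measurable (PiM {..<n} (\<lambda>_. borel :: real measure))"
      by (rule measurable_component_singleton)
    show "(\<lambda>x. ennreal (exp (h * x i - h\<^sup>2 * (\<tau> (Suc i) - \<tau> i) / 2))) \<in> borel_measurable (PiM {..<n} (\<lambda>_. borel))"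
      by measurable
  qed
  have law: "distr M (PiM {..<n} (\<lambda>_. borel)) ?X = ?P"
    using distr_increments[OF BM mono sub n, of 0] by simp
  have "(\<integral>\<^sup>+\<omega>. ennreal (exp (h * B t \<omega> - h\<^sup>2 * t / 2)) * indicator {\<omega> \<in> space M. \<forall>j\<in>J. B j \<omega> \<in> A j} \<omega> \<partial>M)
      = (\<integral>\<^sup>+\<omega>. ?g (?X \<omega>) * indicator ?C (?X \<omega>) \<partial>M)"
  proof (rule nn_integral_cong_AE)
    show "AE \<omega> in M. ennreal (exp (h * B t \<omega> - h\<^sup>2 * t / 2)) * indicator {\<omega> \<in> space M. \<forall>j\<in>J. B j \<omega> \<in> A j} \<omega> =
        ?g (?X \<omega>) * indicator ?C (?X \<omega>)"
      using standard_BM_0[OF BM] AE_space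
    proof eventually_elim
      fix \<omega> assume \<omega>: "B 0 \<omega> = 0" "\<omega> \<in> space M"
      have "(\<Sum>i<n. h * (B (\<tau> (Suc i)) \<omega> - B (\<tau> i) \<omega>) - h\<^sup>2 * (\<tau> (Suc i) - \<tau> i) / 2) =
          h * (\<Sum>i<n. B (\<tau> (Suc i)) \<omega> - B (\<tau> i) \<omega>) - h\<^sup>2 * (\<Sum>i<n. \<tau> (Suc i) - \<tau> i) / 2"
        by (subst sum_subtractf) (simp only: sum_distrib_left sum_divide_distrib)
      also have "\<dots> = h * B t \<omega> - h\<^sup>2 * t / 2"
        using \<omega> \<tau>0 \<tau>n sum_lessThan_telescope[of "\<lambda>i. B (\<tau> i) \<omega>" n] sum_lessThan_telescope[of \<tau> n] by simp
      finally have "?g (?X \<omega>) = ennreal (exp (h * B t \<omega> - h\<^sup>2 * t / 2))"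
        by (simp add: prod_ennreal flip: exp_sum)
      moreover have "?X \<omega> \<in> ?C \<longleftrightarrow> (\<forall>j\<in>J. B j \<omega> \<in> A j)"
        by (rule mem_increment_cylinder_iff[OF J']) (simp add: \<tau>0 \<omega>)
      ultimately show "ennreal (exp (h * B t \<omega> - h\<^sup>2 * t / 2)) * indicator {\<omega> \<in> space M. \<forall>j\<in>J. B j \<omega> \<in> A j} \<omega> =
        ?g (?X \<omega>) * indicator ?C (?X \<omega>)"
        using \<omega> by (simp add: indicator_def)
    qed
  qed
  also have "\<dots> = (\<integral>\<^sup>+x. ?g x * indicator ?C x \<partial>distr M (PiM {..<n} (\<lambda>_. borel)) ?X)"
    using X g C by (subst nn_integral_distr) auto
  also have "\<dots> = emeasure (density ?P ?g) ?C"
    unfolding law using g C by (subst emeasure_density) (simp_all add: setsP cong: measurable_cong_sets)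
  also have "\<dots> = emeasure M {\<omega> \<in> space M. \<forall>j\<in>J. B j \<omega> + h * j \<in> A j}"
    using density_PiM_normal[of n "\<lambda>i. \<tau> (Suc i) - \<tau> i" h] d
      emeasure_BM_cylinder[OF BM mono sub n \<tau>0 J' A, of h] by simp
  finally show ?thesis .
qed

section \<open>Uniqueness in law and symmetries of Brownian motion\<close>

lemma standard_BM_law_unique:
  assumes BM: "standard_BM T M B" and BM': "standard_BM T M' B'"
    and T: "0 \<in> T" "T \<subseteq> {0..}" "t \<in> T" "t > 0"
    and f: "\<And>\<omega>. \<omega> \<in> space M \<Longrightarrow> f \<omega> \<in> \<Omega>" "\<And>\<omega> s. \<omega> \<in> space M \<Longrightarrow> s \<in> T \<Longrightarrow> f \<omega> s = B s \<omega>"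
    and f': "\<And>\<omega>. \<omega> \<in> space M' \<Longrightarrow> f' \<omega> \<in> \<Omega>" "\<And>\<omega> s. \<omega> \<in> space M' \<Longrightarrow> s \<in> T \<Longrightarrow> f' \<omega> s = B' s \<omega>"
  shows "distr M (coord_sigma \<Omega> T) f = distr M' (coord_sigma \<Omega> T) f'"
proof (rule distr_coord_sigma_eqI)
  show "f \<in> M \<rightarrow>\<^sub>M coord_sigma \<Omega> T"
    using f standard_BM_measurable[OF BM] by (intro measurable_coord_sigmaI) (auto cong: measurable_cong)
  show "f' \<in> M' \<rightarrow>\<^sub>M coord_sigma \<Omega> T"
    using f' standard_BM_measurable[OF BM'] by (intro measurable_coord_sigmaI) (auto cong: measurable_cong)
  interpret prob_space M by (rule standard_BM_prob_space[OF BM])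
  show "finite_measure M" by (rule finite_measure_axioms)
  fix J and A :: "real \<Rightarrow> real set" assume J: "finite J" "J \<subseteq> T" and A: "\<And>j. A j \<in> sets borel"
  obtain n :: nat and \<tau> where n: "n > 0" and \<tau>0: "\<tau> 0 = 0" and mono: "strict_mono_on {..n} \<tau>"
    and im: "\<tau> ` {..n} = insert 0 (insert t J)"
  proof (rule ex_strict_mono_enumeration[OF _ _ insertI1 T(4)])
    show "finite (insert t J)" "insert t J \<subseteq> {0..}" using J T by auto
  qed
  have sub: "\<tau> ` {..n} \<subseteq> T" and J': "J \<subseteq> \<tau> ` {..n}" using J T unfolding im by auto
  have "{x \<in> space M. \<forall>j\<in>J. f x j \<in> A j} = {x \<in> space M. \<forall>j\<in>J. B j x + 0 * j \<in> A j}"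
    using f(2) J(2) by (auto simp: subset_iff)
  moreover have "{x \<in> space M'. \<forall>j\<in>J. f' x j \<in> A j} = {x \<in> space M'. \<forall>j\<in>J. B' j x + 0 * j \<in> A j}"
    using f'(2) J(2) by (auto simp: subset_iff)
  ultimately show "emeasure M {x \<in> space M. \<forall>j\<in>J. f x j \<in> A j} = emeasure M' {x \<in> space M'. \<forall>j\<in>J. f' x j \<in> A j}"
    using emeasure_BM_cylinder[OF BM mono sub n \<tau>0 J' A, of 0]
      emeasure_BM_cylinder[OF BM' mono sub n \<tau>0 J' A, of 0] by simp
qed

text \<open>Restarting (q = 1), time reversal (q = -1) and Brownian scaling (q = t, a = 1 / sqrt t)
  in one statement; \<open>a\<^sup>2 * \<bar>q\<bar> = 1\<close> keeps the variance. The random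
  shift d does not affect increments and brings the process back to 0 at time 0.\<close>

lemma standard_BM_affine:
  fixes a p q :: real
  assumes BM: "standard_BM T M B" and q: "q \<noteq> 0" and a: "a\<^sup>2 * \<bar>q\<bar> = 1"
    and T': "\<And>u. u \<in> T' \<Longrightarrow> p + q * u \<in> T"
    and d: "d \<in> borel_measurable M"
    and B0: "AE \<omega> in M. a * B (p + q * 0) \<omega> + d \<omega> = 0"
  shows "standard_BM T' M (\<lambda>u \<omega>. a * B (p + q * u) \<omega> + d \<omega>)"
  unfolding standard_BM_def
proof (intro conjI ballI allI impI)
  show "prob_space M" using BM by (rule standard_BM_prob_space)
  then interpret prob_space M .
  have a0: "a \<noteq> 0" using a by auto
  let ?B = "\<lambda>u \<omega>. a * B (p + q * u) \<omega> + d \<omega>"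
  show "?B t \<in> borel_measurable M" if "t \<in> T'" for t
    using standard_BM_measurable[OF BM T'[OF that]] d by simp
  show "continuous_on T' (\<lambda>t. ?B t \<omega>)" if "\<omega> \<in> space M" for \<omega>
  proof -
    have "continuous_on T (\<lambda>t. B t \<omega>)" using BM that by (simp add: standard_BM_def)
    then have "continuous_on T' (\<lambda>u. B (p + q * u) \<omega>)"
      by (rule continuous_on_compose2) (use T' in \<open>auto intro!: continuous_intros\<close>)
    then show ?thesis by (intro continuous_intros)
  qed
  show "AE \<omega> in M. ?B 0 \<omega> = 0" by (rule B0)
  show "distributed M lborel (\<lambda>\<omega>. ?B t \<omega> - ?B s \<omega>) (\<lambda>x. ennreal (normal_density 0 (sqrt (t - s)) x))"
    if st: "s \<in> T'" "t \<in> T'" "s < t" for s t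
  proof -
    have sq: "\<bar>a\<bar> * sqrt (\<bar>q\<bar> * (t - s)) = sqrt (t - s)"
    proof -
      have "\<bar>a\<bar> * sqrt (\<bar>q\<bar> * (t - s)) = sqrt (a\<^sup>2 * (\<bar>q\<bar> * (t - s)))" by (simp add: real_sqrt_mult)
      also have "a\<^sup>2 * (\<bar>q\<bar> * (t - s)) = t - s" using a by (simp add: mult.assoc[symmetric])
      finally show ?thesis .
    qed
    show ?thesis
    proof (cases "q > 0")
      case True
      then have "p + q * s < p + q * t" using st by simp
      from normal_density_affine[OF standard_BM_distributed[OF BM T'[OF st(1)] T'[OF st(2)] this], of a 0]
      show ?thesis using True st a0 sq by (simp add: algebra_simps abs_of_pos)
    next
      case False
      then have q': "q < 0" using q by simp
      then have "p + q * t < p + q * s" using st by simp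
      moreover have "sqrt (q * s - q * t) = sqrt (\<bar>q\<bar> * (t - s))" using q' by (simp add: algebra_simps)
      ultimately show ?thesis
        using normal_density_affine[OF standard_BM_distributed[OF BM T'[OF st(2)] T'[OF st(1)]], of "- a" 0]
          st a0 sq q' by (simp add: algebra_simps abs_of_neg)
    qed
  qed
  fix n :: nat and \<tau> assume "strict_mono_on {..n} \<tau> \<and> \<tau> ` {..n} \<subseteq> T'"
  then have mono: "strict_mono_on {..n} \<tau>" and sub: "\<tau> ` {..n} \<subseteq> T'" by auto
  show "indep_vars (\<lambda>_. borel) (\<lambda>i \<omega>. ?B (\<tau> (Suc i)) \<omega> - ?B (\<tau> i) \<omega>) {..<n}"
  proof (cases "q > 0")
    case True
    have "strict_mono_on {..n} (\<lambda>i. p + q * \<tau> i)"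
      using True by (auto intro!: strict_mono_onI strict_mono_onD[OF mono])
    moreover have "(\<lambda>i. p + q * \<tau> i) ` {..n} \<subseteq> T" using sub T' by auto
    ultimately have "indep_vars (\<lambda>_. borel) (\<lambda>i \<omega>. B (p + q * \<tau> (Suc i)) \<omega> - B (p + q * \<tau> i) \<omega>) {..<n}"
      by (rule standard_BM_indep[OF BM])
    from indep_vars_compose2[OF this, of "\<lambda>_ x. a * x" "\<lambda>_. borel"]
    show ?thesis by (simp add: algebra_simps)
  next
    case False
    then have q': "q < 0" using q by simp
    \<comment> \<open>With q < 0 the grid must be run backwards to be increasing, so the increments
      appear in reverse order and with opposite sign.\<close>
    let ?\<sigma> = "\<lambda>i. p + q * \<tau> (n - i)"
    have "strict_mono_on {..n} ?\<sigma>"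
      using q' by (auto intro!: strict_mono_onI mult_strict_left_mono_neg strict_mono_onD[OF mono])
    moreover have "?\<sigma> ` {..n} \<subseteq> T" using sub T' by (auto simp: image_subset_iff)
    ultimately have ind: "indep_vars (\<lambda>_. borel) (\<lambda>i \<omega>. B (?\<sigma> (Suc i)) \<omega> - B (?\<sigma> i) \<omega>) {..<n}"
      by (rule standard_BM_indep[OF BM])
    \<comment> \<open>Restriction to the disjoint singletons {n - Suc j} serves to permute the
      independent family.\<close>
    have "indep_vars (\<lambda>j. PiM {n - Suc j} (\<lambda>_. borel))
        (\<lambda>j \<omega>. restrict (\<lambda>i. B (?\<sigma> (Suc i)) \<omega> - B (?\<sigma> i) \<omega>) {n - Suc j}) {..<n}"
      by (rule indep_vars_restrict[OF ind]) (auto simp: disjoint_family_on_def)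
    then have "indep_vars (\<lambda>_. borel)
        (\<lambda>j \<omega>. - a * (restrict (\<lambda>i. B (?\<sigma> (Suc i)) \<omega> - B (?\<sigma> i) \<omega>) {n - Suc j} (n - Suc j))) {..<n}"
      by (rule indep_vars_compose2[where Y = "\<lambda>j x. - a * x (n - Suc j)"]) simp
    then show ?thesis
    proof (rule indep_vars_cong[THEN iffD1, OF refl _ refl, rotated])
      fix i assume "i \<in> {..<n}"
      then have "n - (n - Suc i) = Suc i" "n - Suc (n - Suc i) = i" by auto
      then show "(\<lambda>\<omega>. - a * (restrict (\<lambda>i. B (?\<sigma> (Suc i)) \<omega> - B (?\<sigma> i) \<omega>) {n - Suc i} (n - Suc i))) =
          (\<lambda>\<omega>. ?B (\<tau> (Suc i)) \<omega> - ?B (\<tau> i) \<omega>)"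
        by (simp add: algebra_simps fun_eq_iff)
    qed
  qed
qed

text \<open>The grid contains s as its point number m, so the two events depend on the increments
  with index below m and from m on, which are disjoint blocks of an independent family.\<close>

lemma indep_increments_cylinder:
  assumes BM: "standard_BM {0..} M B" and s: "s > 0"
    and J: "finite J" "J \<subseteq> {0..s}" and K: "finite K" "K \<subseteq> {0..}"
    and A: "\<And>j. A j \<in> sets borel" and A': "\<And>j. A' j \<in> sets borel"
  shows "measure M {\<omega> \<in> space M. (\<forall>j\<in>J. B j \<omega> \<in> A j) \<and> (\<forall>k\<in>K. B (s + k) \<omega> - B s \<omega> \<in> A' k)} =
    measure M {\<omega> \<in> space M. \<forall>j\<in>J. B j \<omega> \<in> A j} *
    measure M {\<omega> \<in> space M. \<forall>k\<in>K. B (s + k) \<omega> - B s \<omega> \<in> A' k}"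
proof -
  interpret prob_space M by (rule standard_BM_prob_space[OF BM])
  let ?I = "insert s (J \<union> (+) s ` K)"
  obtain n :: nat and \<tau> where n: "n > 0" and \<tau>0: "\<tau> 0 = 0" and mono: "strict_mono_on {..n} \<tau>"
    and im: "\<tau> ` {..n} = insert 0 ?I"
  proof (rule ex_strict_mono_enumeration[OF _ _ insertI1 s])
    show "finite ?I" "?I \<subseteq> {0..}" using J K s by auto
  qed
  have sub: "\<tau> ` {..n} \<subseteq> {0..}" unfolding im using J K s by auto
  have Bm: "B u \<in> borel_measurable M" if "u \<ge> 0" for u
    using standard_BM_measurable[OF BM] that by auto
  have "s \<in> \<tau> ` {..n}" unfolding im by simp
  then obtain m where m: "m \<le> n" "\<tau> m = s" by auto
  have le_m: "k \<le> m \<longleftrightarrow> \<tau> k \<le> s" if "k \<le> n" for k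
    using strict_mono_onD[OF mono, of k m] strict_mono_onD[OF mono, of m k] that m
    by (cases k m rule: linorder_cases) auto
  define X where "X i \<omega> = B (\<tau> (Suc i)) \<omega> - B (\<tau> i) \<omega>" for i \<omega>
  have ind: "indep_vars (\<lambda>_. borel) X {..<n}"
    using standard_BM_indep[OF BM mono sub] unfolding X_def .
  define P1 P2 where "P1 = PiM {..<m} (\<lambda>_. borel :: real measure)"
    and "P2 = PiM {m..<n} (\<lambda>_. borel :: real measure)"
  define X1 X2 where "X1 = (\<lambda>\<omega>. restrict (\<lambda>i. X i \<omega>) {..<m})" and "X2 = (\<lambda>\<omega>. restrict (\<lambda>i. X i \<omega>) {m..<n})"
  have iv: "indep_var P1 X1 P2 X2"
    unfolding P1_def P2_def X1_def X2_def by (rule indep_var_restrict[OF ind]) (use m in auto)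
  define E1 where "E1 = {x \<in> space P1. \<forall>k\<in>{k\<in>{..m}. \<tau> k \<in> J}. (\<Sum>i<k. x i) \<in> A (\<tau> k)}"
  define E2 where "E2 = {x \<in> space P2. \<forall>k\<in>{k\<in>{m..n}. \<tau> k - s \<in> K}. (\<Sum>i=m..<k. x i) \<in> A' (\<tau> k - s)}"
  have E1: "E1 \<in> sets P1"
    unfolding E1_def P1_def
    by (rule sets_Collect_cylinder[where N = borel]) (auto intro!: borel_measurable_sum measurable_component_singleton A)
  have E2: "E2 \<in> sets P2"
    unfolding E2_def P2_def
    by (rule sets_Collect_cylinder[where N = borel]) (auto intro!: borel_measurable_sum measurable_component_singleton A')
  have sum1: "(\<Sum>i<k. X1 \<omega> i) = B (\<tau> k) \<omega> - B 0 \<omega>" if "k \<le> m" for k \<omega>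
  proof -
    have "(\<Sum>i<k. X1 \<omega> i) = (\<Sum>i<k. B (\<tau> (Suc i)) \<omega> - B (\<tau> i) \<omega>)"
      using that by (intro sum.cong) (auto simp: X1_def X_def)
    then show ?thesis using \<tau>0 sum_lessThan_telescope[of "\<lambda>i. B (\<tau> i) \<omega>" k] by simp
  qed
  have sum2: "(\<Sum>i=m..<k. X2 \<omega> i) = B (\<tau> k) \<omega> - B s \<omega>" if "m \<le> k" "k \<le> n" for k \<omega>
  proof -
    have "(\<Sum>i=m..<k. X2 \<omega> i) = (\<Sum>i=m..<k. B (\<tau> (Suc i)) \<omega> - B (\<tau> i) \<omega>)"
      using that by (intro sum.cong) (auto simp: X2_def X_def)
    then show ?thesis using m sum_Suc_diff'[OF that(1), of "\<lambda>i. B (\<tau> i) \<omega>"] by simp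
  qed
  have J': "J = \<tau> ` {k\<in>{..m}. \<tau> k \<in> J}"
  proof (intro subset_antisym subsetI)
    fix j assume j: "j \<in> J"
    then have "j \<in> \<tau> ` {..n}" unfolding im by simp
    then obtain k where "k \<le> n" "\<tau> k = j" by auto
    then show "j \<in> \<tau> ` {k\<in>{..m}. \<tau> k \<in> J}" using j J le_m[of k] by auto
  qed auto
  have K': "K = (\<lambda>k. \<tau> k - s) ` {k\<in>{m..n}. \<tau> k - s \<in> K}"
  proof (intro subset_antisym subsetI)
    fix j assume j: "j \<in> K"
    then have "s + j \<in> \<tau> ` {..n}" unfolding im by simp
    then obtain k where k: "k \<le> n" "\<tau> k = s + j" by auto
    have "m \<le> k"
    proof (cases "j = 0")
      case True
      then have "\<tau> k = \<tau> m" using k m by simp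
      then show ?thesis using strict_mono_onD[OF mono, of k m] k m by (cases "k < m") auto
    next
      case False
      then have "\<tau> k > s" using k j K by auto
      then show ?thesis using le_m[of k] k by auto
    qed
    then show "j \<in> (\<lambda>k. \<tau> k - s) ` {k\<in>{m..n}. \<tau> k - s \<in> K}" using k j by (intro image_eqI[of _ _ k]) auto
  qed auto
  have 1: "X1 \<omega> \<in> E1 \<longleftrightarrow> (\<forall>j\<in>J. B j \<omega> \<in> A j)" if "B 0 \<omega> = 0" for \<omega>
  proof -
    have "X1 \<omega> \<in> space P1" by (simp add: X1_def P1_def space_PiM)
    then have "X1 \<omega> \<in> E1 \<longleftrightarrow> (\<forall>k\<in>{k\<in>{..m}. \<tau> k \<in> J}. B (\<tau> k) \<omega> \<in> A (\<tau> k))"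
      using sum1[of _ \<omega>] that by (auto simp: E1_def)
    also have "\<dots> \<longleftrightarrow> (\<forall>j\<in>\<tau> ` {k\<in>{..m}. \<tau> k \<in> J}. B j \<omega> \<in> A j)" by simp
    also have "\<dots> \<longleftrightarrow> (\<forall>j\<in>J. B j \<omega> \<in> A j)" unfolding J'[symmetric] ..
    finally show ?thesis .
  qed
  have 2: "X2 \<omega> \<in> E2 \<longleftrightarrow> (\<forall>k\<in>K. B (s + k) \<omega> - B s \<omega> \<in> A' k)" for \<omega>
  proof -
    have "X2 \<omega> \<in> space P2" by (simp add: X2_def P2_def space_PiM)
    then have "X2 \<omega> \<in> E2 \<longleftrightarrow> (\<forall>k\<in>{k\<in>{m..n}. \<tau> k - s \<in> K}. B (s + (\<tau> k - s)) \<omega> - B s \<omega> \<in> A' (\<tau> k - s))"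
      using sum2[of _ \<omega>] by (auto simp: E2_def)
    also have "\<dots> \<longleftrightarrow> (\<forall>k\<in>(\<lambda>k. \<tau> k - s) ` {k\<in>{m..n}. \<tau> k - s \<in> K}. B (s + k) \<omega> - B s \<omega> \<in> A' k)"
      by simp
    also have "\<dots> \<longleftrightarrow> (\<forall>k\<in>K. B (s + k) \<omega> - B s \<omega> \<in> A' k)" unfolding K'[symmetric] ..
    finally show ?thesis .
  qed
  have X1: "X1 \<in> M \<rightarrow>\<^sub>M P1" and X2: "X2 \<in> M \<rightarrow>\<^sub>M P2" using iv indep_var_rv1 indep_var_rv2 by blast+
  have mJ: "{\<omega> \<in> space M. \<forall>j\<in>J. B j \<omega> \<in> A j} \<in> sets M"
    by (rule sets_Collect_cylinder[where N = borel]) (use J A Bm in auto)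
  have mK: "{\<omega> \<in> space M. \<forall>k\<in>K. B (s + k) \<omega> - B s \<omega> \<in> A' k} \<in> sets M"
    by (rule sets_Collect_cylinder[where N = borel]) (use K A' Bm s in \<open>auto intro!: borel_measurable_diff\<close>)
  have mJK: "{\<omega> \<in> space M. (\<forall>j\<in>J. B j \<omega> \<in> A j) \<and> (\<forall>k\<in>K. B (s + k) \<omega> - B s \<omega> \<in> A' k)} \<in> sets M"
    using sets.Int[OF mJ mK] by (simp add: Int_def conj_ac)
  have eJ: "measure M {\<omega> \<in> space M. \<forall>j\<in>J. B j \<omega> \<in> A j} = prob (X1 -` E1 \<inter> space M)"
    using standard_BM_0[OF BM] 1 mJ measurable_sets[OF X1 E1] by (intro measure_eq_AE) auto
  have eK: "{\<omega> \<in> space M. \<forall>k\<in>K. B (s + k) \<omega> - B s \<omega> \<in> A' k} = X2 -` E2 \<inter> space M"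
    using 2 by auto
  have "measure M {\<omega> \<in> space M. (\<forall>j\<in>J. B j \<omega> \<in> A j) \<and> (\<forall>k\<in>K. B (s + k) \<omega> - B s \<omega> \<in> A' k)}
      = prob ((\<lambda>\<omega>. (X1 \<omega>, X2 \<omega>)) -` (E1 \<times> E2) \<inter> space M)"
  proof (rule measure_eq_AE)
    have "(\<lambda>\<omega>. (X1 \<omega>, X2 \<omega>)) -` (E1 \<times> E2) \<inter> space M = (X1 -` E1 \<inter> space M) \<inter> (X2 -` E2 \<inter> space M)"
      by auto
    then show "(\<lambda>\<omega>. (X1 \<omega>, X2 \<omega>)) -` (E1 \<times> E2) \<inter> space M \<in> sets M"
      using measurable_sets[OF X1 E1] measurable_sets[OF X2 E2] by (metis sets.Int)
  qed (use standard_BM_0[OF BM] 1 2 mJK in auto)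
  also have "\<dots> = prob (X1 -` E1 \<inter> space M) * prob (X2 -` E2 \<inter> space M)"
    by (rule indep_varD[OF iv E1 E2])
  finally show ?thesis unfolding eJ eK .
qed

section \<open>Transformations of paths\<close>

definition drift :: "real \<Rightarrow> (real \<Rightarrow> real) \<Rightarrow> real \<Rightarrow> real" where
  "drift h \<omega> = (\<lambda>u\<in>{0..}. \<omega> u + h * u)"

definition incr :: "real \<Rightarrow> (real \<Rightarrow> real) \<Rightarrow> real \<Rightarrow> real" where
  "incr s \<omega> = (\<lambda>u\<in>{0..}. \<omega> (s + u) - \<omega> s)"

text \<open>The \<open>max 0\<close> freezes the reversed path after time t, so that it is defined
  on the whole half-line; only its values up to t matter, and its law is considered on
  \<open>path_filtration t\<close>.\<close>

definition backward :: "real \<Rightarrow> (real \<Rightarrow> real) \<Rightarrow> real \<Rightarrow> real" where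
  "backward t \<omega> = (\<lambda>u\<in>{0..}. \<omega> (max 0 (t - u)) - \<omega> t)"

text \<open>The same function as \<open>rescaled 0 t\<close>. The centring of
  \<open>rescaled b t\<close> is absorbed by \<open>drift b\<close>.\<close>

definition unit_scale :: "real \<Rightarrow> (real \<Rightarrow> real) \<Rightarrow> real \<Rightarrow> real" where
  "unit_scale t \<omega> = (\<lambda>v\<in>{0..1}. \<omega> (v * t) / sqrt t)"

lemma paths_continuous_on: "\<omega> \<in> paths \<Longrightarrow> S \<subseteq> {0..} \<Longrightarrow> continuous_on S \<omega>"
  unfolding paths_def by (auto intro: continuous_on_subset)

lemma restrict_in_paths: "continuous_on {0..} f \<Longrightarrow> restrict f {0..} \<in> paths"
  unfolding paths_def using continuous_on_eq[of "{0..}" f "restrict f {0..}"] by simp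

lemma restrict_in_C01_set: "continuous_on {0..1} f \<Longrightarrow> restrict f {0..1} \<in> C01_set"
  unfolding C01_set_def using continuous_on_eq[of "{0..1}" f "restrict f {0..1}"] by simp

lemma drift_in_paths: "\<omega> \<in> paths \<Longrightarrow> drift h \<omega> \<in> paths"
  unfolding drift_def
  by (intro restrict_in_paths continuous_intros paths_continuous_on) auto

lemma incr_in_paths: "\<omega> \<in> paths \<Longrightarrow> s \<ge> 0 \<Longrightarrow> incr s \<omega> \<in> paths"
  unfolding incr_def
  by (intro restrict_in_paths continuous_intros continuous_on_compose2[OF paths_continuous_on[of \<omega> "{0..}"]]) auto

lemma backward_in_paths: "\<omega> \<in> paths \<Longrightarrow> backward t \<omega> \<in> paths"
  unfolding backward_def
  by (intro restrict_in_paths continuous_intros continuous_on_compose2[OF paths_continuous_on[of \<omega> "{0..}"]]) auto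

lemma unit_scale_in_C01: "\<omega> \<in> paths \<Longrightarrow> t \<ge> 0 \<Longrightarrow> unit_scale t \<omega> \<in> C01_set"
  unfolding unit_scale_def divide_inverse
  by (intro restrict_in_C01_set continuous_intros continuous_on_compose2[OF paths_continuous_on[of \<omega> "{0..}"]]) auto

lemma measurable_path_filtrationI:
  assumes "\<And>x. x \<in> space M \<Longrightarrow> f x \<in> paths" and "\<And>s. 0 \<le> s \<Longrightarrow> s \<le> t \<Longrightarrow> (\<lambda>x. f x s) \<in> borel_measurable M"
  shows "f \<in> M \<rightarrow>\<^sub>M path_filtration t"
  unfolding measurable_cong_sets[OF refl sets_path_filtration_coord]
  by (rule measurable_coord_sigmaI) (use assms in auto)

lemma measurable_path_sigmaI:
  assumes "\<And>x. x \<in> space M \<Longrightarrow> f x \<in> paths" and "\<And>s. 0 \<le> s \<Longrightarrow> (\<lambda>x. f x s) \<in> borel_measurable M"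
  shows "f \<in> M \<rightarrow>\<^sub>M path_sigma"
  unfolding measurable_cong_sets[OF refl sets_path_sigma_coord]
  by (rule measurable_coord_sigmaI) (use assms in auto)

lemma measurable_C01I:
  assumes "\<And>x. x \<in> space M \<Longrightarrow> f x \<in> C01_set" and "\<And>s. 0 \<le> s \<Longrightarrow> s \<le> 1 \<Longrightarrow> (\<lambda>x. f x s) \<in> borel_measurable M"
  shows "f \<in> M \<rightarrow>\<^sub>M borel_of C01"
  unfolding measurable_cong_sets[OF refl sets_borel_of_C01]
  by (rule measurable_coord_sigmaI) (use assms in auto)

lemma space_borel_of_C01 [simp]: "space (borel_of C01) = C01_set"
  using sets_eq_imp_space_eq[OF sets_borel_of_C01] by simp

lemma measurable_coord_C01: "0 \<le> s \<Longrightarrow> s \<le> 1 \<Longrightarrow> (\<lambda>x. x s) \<in> borel_measurable (borel_of C01)"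
  unfolding measurable_cong_sets[OF sets_borel_of_C01 refl] by (rule measurable_coord) simp

lemma measurable_drift: "drift h \<in> path_filtration t \<rightarrow>\<^sub>M path_filtration t"
proof (rule measurable_path_filtrationI)
  fix s :: real assume "0 \<le> s" "s \<le> t"
  then have "(\<lambda>x. drift h x s) = (\<lambda>x. x s + h * s)" by (simp add: drift_def)
  also have "\<dots> \<in> borel_measurable (path_filtration t)"
    using \<open>0 \<le> s\<close> \<open>s \<le> t\<close> by (intro borel_measurable_add measurable_eval borel_measurable_const)
  finally show "(\<lambda>x. drift h x s) \<in> borel_measurable (path_filtration t)" .
qed (simp add: drift_in_paths)

lemma measurable_unit_scale: "t \<ge> 0 \<Longrightarrow> unit_scale t \<in> path_filtration t \<rightarrow>\<^sub>M borel_of C01"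
  by (rule measurable_C01I)
    (auto simp: unit_scale_in_C01, auto simp: unit_scale_def mult_left_le_one_le intro!: borel_measurable_divide measurable_eval)

lemma cylinder_in_path_filtration:
  assumes J: "finite J" "J \<subseteq> {0..t}" and A: "\<And>j. A j \<in> sets borel"
  shows "{\<omega> \<in> paths. \<forall>j\<in>J. \<omega> j \<in> A j} \<in> sets (path_filtration t)"
proof -
  have "(\<lambda>\<omega>. \<omega> j) \<in> borel_measurable (path_filtration t)" if "j \<in> J" for j
    using that J by (intro measurable_eval) auto
  from sets_Collect_cylinder[OF J(1) this A] show ?thesis by simp
qed

lemma cylinder_in_path_sigma:
  assumes J: "finite J" "J \<subseteq> {0..}" and A: "\<And>j. A j \<in> sets borel"
  shows "{\<omega> \<in> paths. \<forall>j\<in>J. \<omega> j \<in> A j} \<in> sets path_sigma"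
proof -
  have "(\<lambda>\<omega>. \<omega> j) \<in> borel_measurable path_sigma" if "j \<in> J" for j
    using that J by (intro measurable_path_sigma[OF measurable_eval[OF _ order_refl]]) auto
  from sets_Collect_cylinder[OF J(1) this A] show ?thesis by simp
qed

section \<open>Wiener measure\<close>

locale wiener =
  fixes P :: "(real \<Rightarrow> real) measure"
  assumes wiener: "wiener_measure P"
begin

lemma BM: "standard_BM {0..} P (\<lambda>t \<omega>. \<omega> t)"
  using wiener by (simp add: wiener_measure_def)

sublocale prob_space P
  by (rule standard_BM_prob_space[OF BM])

lemma sets_P: "sets P = sets path_sigma"
  using wiener by (simp add: wiener_measure_def)

lemma space_P [simp]: "space P = paths"
  using sets_eq_imp_space_eq[OF sets_P] by simp

lemma measurable_P: "f \<in> path_filtration t \<rightarrow>\<^sub>M N \<Longrightarrow> f \<in> P \<rightarrow>\<^sub>M N"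
  using measurable_path_sigma unfolding measurable_cong_sets[OF sets_P refl] .

lemma measurable_eval_P: "s \<ge> 0 \<Longrightarrow> (\<lambda>\<omega>. \<omega> s) \<in> borel_measurable P"
  using measurable_P[OF measurable_eval] by blast

lemma start_0: "AE \<omega> in P. \<omega> 0 = 0"
  by (rule standard_BM_0[OF BM])

lemma measurable_incr: "s \<ge> 0 \<Longrightarrow> incr s \<in> P \<rightarrow>\<^sub>M path_sigma"
  by (rule measurable_path_sigmaI)
    (auto simp: incr_in_paths, auto simp: incr_def intro!: borel_measurable_diff measurable_eval_P)

lemma measurable_backward: "t \<ge> 0 \<Longrightarrow> backward t \<in> P \<rightarrow>\<^sub>M path_filtration t"
  by (rule measurable_path_filtrationI)
    (auto simp: backward_in_paths, auto simp: backward_def intro!: borel_measurable_diff measurable_eval_P)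

lemma distr_incr: 
  assumes "s \<ge> 0"
  shows "distr P path_sigma (incr s) = P"
proof -
  have BM': "standard_BM {0..} P (\<lambda>u \<omega>. 1 * \<omega> (s + 1 * u) + - \<omega> s)"
    by (rule standard_BM_affine[OF BM]) (use assms in \<open>auto intro: measurable_eval_P\<close>)
  have "distr P (coord_sigma paths {0..}) (incr s) = distr P (coord_sigma paths {0..}) (\<lambda>\<omega>. \<omega>)"
    by (rule standard_BM_law_unique[OF BM' BM, of 1])
      (use assms in \<open>auto simp: incr_in_paths\<close>, auto simp: incr_def)
  then have "distr P path_sigma (incr s) = distr P P (\<lambda>\<omega>. \<omega>)"
    using distr_cong[OF refl sets_path_sigma_coord refl, of P "incr s"]
      distr_cong[OF refl trans[OF sets_P sets_path_sigma_coord] refl, of P "\<lambda>\<omega>. \<omega>"] by simp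
  then show ?thesis by simp
qed

text \<open>With p = t, q = -1 and shift -\<omega> t in \<open>standard_BM_affine\<close>, the
  reversed increments again form a Brownian motion on [0, t].\<close>

lemma distr_backward:
  assumes t: "t > 0"
  shows "distr P (path_filtration t) (backward t) = distr P (path_filtration t) (\<lambda>\<omega>. \<omega>)"
proof -
  have BM': "standard_BM {0..t} P (\<lambda>u \<omega>. 1 * \<omega> (t + (-1) * u) + - \<omega> t)"
    by (rule standard_BM_affine[OF BM]) (use t in \<open>auto intro: measurable_eval_P\<close>)
  have "standard_BM {0..t} P (\<lambda>u \<omega>. 1 * \<omega> (0 + 1 * u) + 0)"
    by (rule standard_BM_affine[OF BM]) (use t start_0 in auto)
  then have BM'': "standard_BM {0..t} P (\<lambda>u \<omega>. \<omega> u)" by simp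
  have "distr P (coord_sigma paths {0..t}) (backward t) = distr P (coord_sigma paths {0..t}) (\<lambda>\<omega>. \<omega>)"
    by (rule standard_BM_law_unique[OF BM' BM'', of t])
      (use t in \<open>auto simp: backward_in_paths\<close>, auto simp: backward_def max_def)
  then show ?thesis
    using distr_cong[OF refl sets_path_filtration_coord refl, of P t] by simp
qed

text \<open>The scaled path is a Brownian motion on [0, 1] for every t > 0, so its law is that of W
  and in particular does not depend on t.\<close>

lemma distr_unit_scale:
  assumes t: "t > 0" and W: "standard_BM {0..1} N W"
  shows "distr P (borel_of C01) (unit_scale t) = law_on_C01 N W"
proof -
  have BM': "standard_BM {0..1} P (\<lambda>u \<omega>. (1 / sqrt t) * \<omega> (0 + t * u) + 0)"
    by (rule standard_BM_affine[OF BM]) (use t start_0 in \<open>auto simp: power_divide\<close>)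
  have "distr P (coord_sigma C01_set {0..1}) (unit_scale t) =
      distr N (coord_sigma C01_set {0..1}) (\<lambda>\<omega>. \<lambda>s\<in>{0..1}. W s \<omega>)"
  proof (rule standard_BM_law_unique[OF BM' W, of 1])
    show "(\<lambda>s\<in>{0..1}. W s \<omega>) \<in> C01_set" if "\<omega> \<in> space N" for \<omega>
      using W that by (intro restrict_in_C01_set) (auto simp: standard_BM_def)
  qed (use t in \<open>auto simp: unit_scale_in_C01\<close>, auto simp: unit_scale_def mult.commute)
  then show ?thesis
    unfolding law_on_C01_def
    using distr_cong[OF refl sets_borel_of_C01 refl, of P] distr_cong[OF refl sets_borel_of_C01 refl, of N]
    by simp
qed

text \<open>Extension from cylinders in the past variable only: for a fixed future event C, the
  measures A \<mapsto> P (A \<inter> C) and A \<mapsto> P C * P A on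
  \<open>path_filtration s\<close> agree on cylinders. The extension in the future variable follows
  in \<open>indep_incr\<close>.\<close>

lemma indep_cylinder_incr:
  assumes s: "s > 0" and K: "finite K" "K \<subseteq> {0..}" and A': "\<And>j. A' j \<in> sets borel"
    and L: "\<Lambda> \<in> sets (path_filtration s)"
  shows "measure P (\<Lambda> \<inter> {\<omega> \<in> paths. \<forall>k\<in>K. incr s \<omega> k \<in> A' k}) =
    measure P \<Lambda> * measure P {\<omega> \<in> paths. \<forall>k\<in>K. incr s \<omega> k \<in> A' k}"
proof -
  define C where "C = {\<omega> \<in> paths. \<forall>k\<in>K. incr s \<omega> k \<in> A' k}"
  have C: "C \<in> sets P"
  proof -
    have "(\<lambda>\<omega>. incr s \<omega> k) \<in> borel_measurable P" if "k \<in> K" for k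
    proof -
      have k: "0 \<le> k" "0 \<le> s + k" "0 \<le> s" using that K s by auto
      have "(\<lambda>\<omega>. \<omega> (s + k) - \<omega> s) \<in> borel_measurable P"
        by (intro borel_measurable_diff measurable_eval_P k)
      then show ?thesis using k by (simp add: incr_def)
    qed
    from sets_Collect_cylinder[OF K(1) this A'] show ?thesis by (simp add: C_def)
  qed
  have id: "(\<lambda>\<omega>. \<omega>) \<in> P \<rightarrow>\<^sub>M path_filtration s" by (rule measurable_P[of _ s]) simp
  let ?\<mu> = "distr (density P (indicator C)) (path_filtration s) (\<lambda>\<omega>. \<omega>)"
  let ?\<mu>' = "scale_measure (emeasure P C) (distr P (path_filtration s) (\<lambda>\<omega>. \<omega>))"
  have FP: "sets (path_filtration s) \<subseteq> sets P" using path_filtration_subset sets_P by auto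
  have e1: "emeasure ?\<mu> X = emeasure P (X \<inter> C)" if "X \<in> sets (path_filtration s)" for X
  proof -
    have "X \<in> sets P" using that FP by auto
    from emeasure_restricted[OF C this]
    have "emeasure (density P (indicator C)) X = emeasure P (X \<inter> C)" by (simp add: Int_commute)
    moreover have "X \<subseteq> paths" using sets.sets_into_space[OF that] by simp
    ultimately show ?thesis using that id by (simp add: emeasure_distr Int_absorb2)
  qed
  have e2: "emeasure ?\<mu>' X = emeasure P C * emeasure P X" if "X \<in> sets (path_filtration s)" for X
  proof -
    have "X \<subseteq> paths" using sets.sets_into_space[OF that] by simp
    then show ?thesis using that id by (simp add: emeasure_distr Int_absorb2)
  qed
  have "?\<mu> = ?\<mu>'"
  proof (rule coord_sigma_eqI)
    show "finite_measure ?\<mu>"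
      using e1[of paths] sets.top[of "path_filtration s"] by (intro finite_measureI) simp
    fix J :: "real set" and A :: "real \<Rightarrow> real set" assume J: "finite J" "J \<subseteq> {0..s}" and A: "\<And>j. A j \<in> sets borel"
    have m: "{\<omega> \<in> paths. \<forall>j\<in>J. \<omega> j \<in> A j} \<in> sets (path_filtration s)"
      by (rule cylinder_in_path_filtration[OF J A])
    have "{\<omega> \<in> paths. \<forall>j\<in>J. \<omega> j \<in> A j} \<inter> C =
        {\<omega> \<in> paths. (\<forall>j\<in>J. \<omega> j \<in> A j) \<and> (\<forall>k\<in>K. \<omega> (s + k) - \<omega> s \<in> A' k)}"
      using K by (auto simp: C_def incr_def subset_iff)
    moreover have "C = {\<omega> \<in> paths. \<forall>k\<in>K. \<omega> (s + k) - \<omega> s \<in> A' k}"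
      using K by (auto simp: C_def incr_def subset_iff)
    ultimately show "emeasure ?\<mu> {\<omega> \<in> paths. \<forall>j\<in>J. \<omega> j \<in> A j} = emeasure ?\<mu>' {\<omega> \<in> paths. \<forall>j\<in>J. \<omega> j \<in> A j}"
      using indep_increments_cylinder[OF BM s J K A A']
      unfolding e1[OF m] e2[OF m] by (simp add: emeasure_eq_measure mult.commute flip: ennreal_mult)
  qed (simp_all add: sets_path_filtration_coord)
  then have "emeasure P (\<Lambda> \<inter> C) = emeasure P C * emeasure P \<Lambda>" using e1[OF L] e2[OF L] by simp
  then show ?thesis
    unfolding C_def[symmetric] by (simp add: emeasure_eq_measure mult.commute flip: ennreal_mult)
qed

text \<open>The same comparison of two measures with the past event fixed, now on
  \<open>path_sigma\<close> and starting from future cylinders.\<close>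

lemma indep_incr:
  assumes s: "s > 0" and L: "\<Lambda> \<in> sets (path_filtration s)" and B: "B \<in> sets path_sigma"
  shows "measure P (\<Lambda> \<inter> (incr s -` B \<inter> paths)) = measure P \<Lambda> * measure P (incr s -` B \<inter> paths)"
proof -
  have LP: "\<Lambda> \<in> sets P" using L path_filtration_subset sets_P by auto
  then have Lp: "\<Lambda> \<subseteq> paths" using sets.sets_into_space by fastforce
  let ?\<mu> = "distr (density P (indicator \<Lambda>)) path_sigma (incr s)"
  let ?\<mu>' = "scale_measure (emeasure P \<Lambda>) (distr P path_sigma (incr s))"
  have im: "incr s \<in> P \<rightarrow>\<^sub>M path_sigma" using measurable_incr s by simp
  have e1: "emeasure ?\<mu> X = emeasure P (\<Lambda> \<inter> (incr s -` X \<inter> paths))" if "X \<in> sets path_sigma" for X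
    using that im LP measurable_sets[OF im that]
    by (subst emeasure_distr) (auto simp: emeasure_restricted)
  have e2: "emeasure ?\<mu>' X = emeasure P \<Lambda> * emeasure P (incr s -` X \<inter> paths)" if "X \<in> sets path_sigma" for X
    using that im by (simp add: emeasure_distr)
  have "?\<mu> = ?\<mu>'"
  proof (rule coord_sigma_eqI)
    show "finite_measure ?\<mu>"
      using e1[of paths] sets.top[of path_sigma] by (intro finite_measureI) simp
    fix K :: "real set" and A :: "real \<Rightarrow> real set" assume K: "finite K" "K \<subseteq> {0..}" and A: "\<And>j. A j \<in> sets borel"
    have m: "{\<omega> \<in> paths. \<forall>j\<in>K. \<omega> j \<in> A j} \<in> sets path_sigma"
      by (rule cylinder_in_path_sigma[OF K A])
    have "incr s -` {\<omega> \<in> paths. \<forall>j\<in>K. \<omega> j \<in> A j} \<inter> paths = {\<omega> \<in> paths. \<forall>k\<in>K. incr s \<omega> k \<in> A k}"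
      using s by (auto simp: incr_in_paths)
    then show "emeasure ?\<mu> {\<omega> \<in> paths. \<forall>j\<in>K. \<omega> j \<in> A j} = emeasure ?\<mu>' {\<omega> \<in> paths. \<forall>j\<in>K. \<omega> j \<in> A j}"
      unfolding e1[OF m] e2[OF m]
      using indep_cylinder_incr[OF s K A L] by (simp add: emeasure_eq_measure flip: ennreal_mult)
  qed (simp_all add: sets_path_sigma_coord)
  then show ?thesis using e1[OF B] e2[OF B] by (simp add: emeasure_eq_measure flip: ennreal_mult)
qed

lemma indep_var_incr:
  fixes F G :: "(real \<Rightarrow> real) \<Rightarrow> real"
  assumes s: "s > 0" and F: "F \<in> borel_measurable (path_filtration s)" and G: "G \<in> borel_measurable path_sigma"
  shows "indep_var borel F borel (\<lambda>\<omega>. G (incr s \<omega>))"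
proof -
  have im: "incr s \<in> P \<rightarrow>\<^sub>M path_sigma" using measurable_incr s by simp
  have rv: "F \<in> borel_measurable P" "(\<lambda>\<omega>. G (incr s \<omega>)) \<in> borel_measurable P"
    using measurable_P[OF F] measurable_compose[OF im G] by auto
  let ?S = "{F -` A \<inter> space P |A. A \<in> sets borel}"
  let ?T = "{(\<lambda>\<omega>. G (incr s \<omega>)) -` A \<inter> space P |A. A \<in> sets borel}"
  have "indep_set ?S ?T"
    unfolding indep_sets2_eq
  proof (intro conjI ballI)
    show "?S \<subseteq> events" "?T \<subseteq> events" using measurable_sets[OF rv(1)] measurable_sets[OF rv(2)] by auto
    fix a b assume "a \<in> ?S" "b \<in> ?T"
    then obtain A B where ab: "a = F -` A \<inter> paths" "b = (\<lambda>\<omega>. G (incr s \<omega>)) -` B \<inter> paths"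
      "A \<in> sets borel" "B \<in> sets borel" by auto
    have "b = incr s -` (G -` B \<inter> space path_sigma) \<inter> paths" using s by (auto simp: ab incr_in_paths)
    then show "prob (a \<inter> b) = prob a * prob b"
      using indep_incr[OF s _ measurable_sets[OF G ab(4)]] measurable_sets[OF F ab(3)] ab(1) by simp
  qed
  moreover have stab: "Int_stable {f -` A \<inter> space P |A. A \<in> sets (borel :: real measure)}"
    for f :: "(real \<Rightarrow> real) \<Rightarrow> real"
  proof (rule Int_stableI)
    fix a b assume "a \<in> {f -` A \<inter> space P |A. A \<in> sets borel}" "b \<in> {f -` A \<inter> space P |A. A \<in> sets borel}"
    then obtain A B where "a = f -` A \<inter> space P" "b = f -` B \<inter> space P" "A \<in> sets borel" "B \<in> sets borel"
      by auto
    then have "a \<inter> b = f -` (A \<inter> B) \<inter> space P" "A \<inter> B \<in> sets borel" by auto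
    then show "a \<inter> b \<in> {f -` A \<inter> space P |A. A \<in> sets borel}" by blast
  qed
  ultimately have "indep_set (sigma_sets (space P) ?S) (sigma_sets (space P) ?T)"
    by (intro indep_set_sigma_sets stab)
  then show ?thesis
    using rv unfolding indep_var_eq by simp
qed

text \<open>The Markov property in integrated form. The second factor is
  \<open>expectation G\<close> rather than the mean of the shifted function because
  \<open>incr s\<close> preserves \<open>P\<close>.\<close>

lemma integral_indep_incr:
  fixes F G :: "(real \<Rightarrow> real) \<Rightarrow> real"
  assumes s: "s > 0" and F: "F \<in> borel_measurable (path_filtration s)" "integrable P F"
    and G: "G \<in> borel_measurable path_sigma" "integrable P G"
  shows "integrable P (\<lambda>\<omega>. F \<omega> * G (incr s \<omega>))"
    and "(\<integral>\<omega>. F \<omega> * G (incr s \<omega>) \<partial>P) = expectation F * expectation G"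
proof -
  have im: "incr s \<in> P \<rightarrow>\<^sub>M path_sigma" using measurable_incr s by simp
  have "integrable (distr P path_sigma (incr s)) G" using G(2) distr_incr s by simp
  then have int: "integrable P (\<lambda>\<omega>. G (incr s \<omega>))" by (rule integrable_distr[OF im])
  have "expectation G = (\<integral>\<omega>. G \<omega> \<partial>distr P path_sigma (incr s))" using distr_incr s by simp
  also have "\<dots> = (\<integral>\<omega>. G (incr s \<omega>) \<partial>P)" by (rule integral_distr[OF im G(1)])
  finally show "(\<integral>\<omega>. F \<omega> * G (incr s \<omega>) \<partial>P) = expectation F * expectation G"
    using indep_var_lebesgue_integral[OF indep_var_incr[OF s F(1) G(1)] F(2) int] by simp
  show "integrable P (\<lambda>\<omega>. F \<omega> * G (incr s \<omega>))"
    by (rule indep_var_integrable[OF indep_var_incr[OF s F(1) G(1)] F(2) int])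
qed

section \<open>Girsanov's theorem on path space\<close>

lemma girsanov_distr:
  assumes t: "t > 0"
  shows "distr (density P (\<lambda>\<omega>. ennreal (exp (h * \<omega> t - h\<^sup>2 * t / 2)))) (path_filtration t) (\<lambda>\<omega>. \<omega>) =
    distr P (path_filtration t) (drift h)"
proof -
  have id: "(\<lambda>\<omega>. \<omega>) \<in> P \<rightarrow>\<^sub>M path_filtration t" by (rule measurable_P[of _ t]) simp
  have sh: "drift h \<in> P \<rightarrow>\<^sub>M path_filtration t" by (rule measurable_P[OF measurable_drift])
  have [measurable]: "(\<lambda>\<omega>. \<omega> t) \<in> borel_measurable P" using t by (intro measurable_eval_P) simp
  have "distr P (path_filtration t) (drift h) =
      distr (density P (\<lambda>\<omega>. ennreal (exp (h * \<omega> t - h\<^sup>2 * t / 2)))) (path_filtration t) (\<lambda>\<omega>. \<omega>)"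
  proof (rule coord_sigma_eqI)
    show "finite_measure (distr P (path_filtration t) (drift h))"
      by (rule finite_measure_distr[OF sh])
    fix J :: "real set" and A :: "real \<Rightarrow> real set" assume J: "finite J" "J \<subseteq> {0..t}" and A: "\<And>j. A j \<in> sets borel"
    have m: "{\<omega> \<in> paths. \<forall>j\<in>J. \<omega> j \<in> A j} \<in> sets (path_filtration t)"
      by (rule cylinder_in_path_filtration[OF J A])
    then have mP: "{\<omega> \<in> paths. \<forall>j\<in>J. \<omega> j \<in> A j} \<in> sets P" using path_filtration_subset sets_P by auto
    have "drift h -` {\<omega> \<in> paths. \<forall>j\<in>J. \<omega> j \<in> A j} \<inter> space P = {\<omega> \<in> space P. \<forall>j\<in>J. \<omega> j + h * j \<in> A j}"
      using J by (auto simp: drift_in_paths) (auto simp: drift_def subset_iff)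
    then have "emeasure (distr P (path_filtration t) (drift h)) {\<omega> \<in> paths. \<forall>j\<in>J. \<omega> j \<in> A j} =
        emeasure P {\<omega> \<in> space P. \<forall>j\<in>J. \<omega> j + h * j \<in> A j}"
      using m sh by (simp add: emeasure_distr)
    also have "\<dots> = (\<integral>\<^sup>+\<omega>. ennreal (exp (h * \<omega> t - h\<^sup>2 * t / 2)) *
        indicator {\<omega> \<in> space P. \<forall>j\<in>J. \<omega> j \<in> A j} \<omega> \<partial>P)"
      by (rule girsanov_cylinder[OF BM _ t J A, symmetric]) auto
    also have "\<dots> = emeasure (distr (density P (\<lambda>\<omega>. ennreal (exp (h * \<omega> t - h\<^sup>2 * t / 2))))
        (path_filtration t) (\<lambda>\<omega>. \<omega>)) {\<omega> \<in> paths. \<forall>j\<in>J. \<omega> j \<in> A j}"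
      using m mP id by (subst emeasure_distr) (auto simp: emeasure_density Int_def conj_ac)
    finally show "emeasure (distr P (path_filtration t) (drift h)) {\<omega> \<in> paths. \<forall>j\<in>J. \<omega> j \<in> A j} =
      emeasure (distr (density P (\<lambda>\<omega>. ennreal (exp (h * \<omega> t - h\<^sup>2 * t / 2))))
        (path_filtration t) (\<lambda>\<omega>. \<omega>)) {\<omega> \<in> paths. \<forall>j\<in>J. \<omega> j \<in> A j}" .
  qed (simp_all add: sets_path_filtration_coord)
  then show ?thesis ..
qed

lemma girsanov:
  assumes t: "t > 0" and H: "H \<in> borel_measurable (path_filtration t)"
  shows "(\<integral>\<^sup>+\<omega>. H (drift h \<omega>) \<partial>P) = (\<integral>\<^sup>+\<omega>. ennreal (exp (h * \<omega> t - h\<^sup>2 * t / 2)) * H \<omega> \<partial>P)"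
proof -
  have id: "(\<lambda>\<omega>. \<omega>) \<in> P \<rightarrow>\<^sub>M path_filtration t" by (rule measurable_P[of _ t]) simp
  have sh: "drift h \<in> P \<rightarrow>\<^sub>M path_filtration t" by (rule measurable_P[OF measurable_drift])
  have [measurable]: "(\<lambda>\<omega>. \<omega> t) \<in> borel_measurable P" using t by (intro measurable_eval_P) simp
  have [measurable]: "H \<in> borel_measurable P" by (rule measurable_P[OF H])
  have "(\<integral>\<^sup>+\<omega>. H (drift h \<omega>) \<partial>P) = (\<integral>\<^sup>+\<omega>. H \<omega> \<partial>distr P (path_filtration t) (drift h))"
    using sh H by (simp add: nn_integral_distr)
  also have "\<dots> = (\<integral>\<^sup>+\<omega>. H \<omega> \<partial>density P (\<lambda>\<omega>. ennreal (exp (h * \<omega> t - h\<^sup>2 * t / 2))))"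
    unfolding girsanov_distr[OF t, symmetric] using id H by (simp add: nn_integral_distr)
  also have "\<dots> = (\<integral>\<^sup>+\<omega>. ennreal (exp (h * \<omega> t - h\<^sup>2 * t / 2)) * H \<omega> \<partial>P)"
    by (rule nn_integral_density) measurable
  finally show ?thesis .
qed

end

section \<open>The running maximum of Brownian motion with drift\<close>

lemma running_sup_upper: "\<omega> \<in> paths \<Longrightarrow> 0 \<le> s \<Longrightarrow> s \<le> t \<Longrightarrow> \<omega> s \<le> running_sup t \<omega>"
  unfolding running_sup_def by (rule cSUP_upper[OF _ bdd_above_path]) auto

lemma running_sup_least: "0 \<le> t \<Longrightarrow> (\<And>s. 0 \<le> s \<Longrightarrow> s \<le> t \<Longrightarrow> \<omega> s \<le> c) \<Longrightarrow> running_sup t \<omega> \<le> c"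
  unfolding running_sup_def by (rule cSUP_least) auto

lemma running_sup_mono: "\<omega> \<in> paths \<Longrightarrow> 0 \<le> s \<Longrightarrow> s \<le> t \<Longrightarrow> running_sup s \<omega> \<le> running_sup t \<omega>"
  by (rule running_sup_least) (auto intro: running_sup_upper)

text \<open>By continuity a value above a at a time u persists to the right of u, which yields a
  rational time that is positive even if u = 0. Positivity of the time is required by the change of
  measure.\<close>

lemma running_sup_greater_rat:
  assumes \<omega>: "\<omega> \<in> paths" and t: "0 \<le> t" and a: "a < running_sup t \<omega>"
  obtains q where "q \<in> \<rat>" "q > 0" "a < \<omega> q"
proof -
  obtain u where u: "0 \<le> u" "a < \<omega> u"
    using running_sup_least[OF t, of \<omega> a] a by force
  have cont: "continuous_on {0..} \<omega>" using \<omega> by (simp add: paths_def)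
  have "\<exists>d>0. \<forall>x\<in>{0..}. dist x u < d \<longrightarrow> dist (\<omega> x) (\<omega> u) < \<omega> u - a"
    using cont[unfolded continuous_on_iff, rule_format, of u "\<omega> u - a"] u by auto
  then obtain d where d: "d > 0" "\<And>x. 0 \<le> x \<Longrightarrow> dist x u < d \<Longrightarrow> dist (\<omega> x) (\<omega> u) < \<omega> u - a"
    by auto
  obtain q where q: "q \<in> \<rat>" "u < q" "q < u + d" using Rats_dense_in_real[of u "u + d"] d by auto
  then have "a < \<omega> q" using d(2)[of q] u by (auto simp: dist_real_def abs_less_iff)
  then show ?thesis using that[of q] q u by auto
qed

text \<open>\<open>total_sup\<close> is a junk value on paths with unbounded maximum; for negative drift these form a
  null set.\<close>

definition total_sup :: "(real \<Rightarrow> real) \<Rightarrow> real" where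
  "total_sup \<omega> = lim (\<lambda>n::nat. running_sup (real n) \<omega>)"

text \<open>The limit is defined along integer times; monotonicity in t extends it to real
  t.\<close>

lemma
  assumes \<omega>: "\<omega> \<in> paths" and bdd: "bdd_above (range (\<lambda>n::nat. running_sup (real n) \<omega>))"
  shows running_sup_tendsto: "((\<lambda>t. running_sup t \<omega>) \<longlongrightarrow> total_sup \<omega>) at_top"
    and running_sup_le_total_sup: "t \<ge> 0 \<Longrightarrow> running_sup t \<omega> \<le> total_sup \<omega>"
proof -
  have inc: "incseq (\<lambda>n::nat. running_sup (real n) \<omega>)"
    using running_sup_mono[OF \<omega>] by (intro incseq_SucI) auto
  have lim: "(\<lambda>n::nat. running_sup (real n) \<omega>) \<longlonglongrightarrow> total_sup \<omega>"
    using LIMSEQ_incseq_SUP[OF bdd inc] unfolding total_sup_def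
    by (intro convergent_LIMSEQ_iff[THEN iffD1] convergentI)
  have le: "running_sup t \<omega> \<le> total_sup \<omega>" if "t \<ge> 0" for t
  proof -
    have "running_sup t \<omega> \<le> running_sup (real (nat \<lceil>t\<rceil>)) \<omega>"
      using that by (intro running_sup_mono[OF \<omega>]) linarith+
    also have "\<dots> \<le> total_sup \<omega>" by (rule incseq_le[OF inc lim])
    finally show ?thesis .
  qed
  show "t \<ge> 0 \<Longrightarrow> running_sup t \<omega> \<le> total_sup \<omega>" by (rule le)
  show "((\<lambda>t. running_sup t \<omega>) \<longlongrightarrow> total_sup \<omega>) at_top"
  proof (rule order_tendstoI)
    fix a assume "a < total_sup \<omega>"
    then obtain n :: nat where n: "a < running_sup (real n) \<omega>"
      using order_tendstoD(1)[OF lim] by (auto simp: eventually_sequentially)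
    show "\<forall>\<^sub>F t in at_top. a < running_sup t \<omega>"
      using eventually_ge_at_top[of "real n"]
    proof eventually_elim
      fix t assume "real n \<le> t"
      then show "a < running_sup t \<omega>" using n running_sup_mono[OF \<omega>, of "real n" t] by simp
    qed
  next
    fix a assume a: "total_sup \<omega> < a"
    show "\<forall>\<^sub>F t in at_top. running_sup t \<omega> < a"
      using eventually_ge_at_top[of 0] by eventually_elim (use le a in force)
  qed
qed

text \<open>By continuity this is the event that the path with drift b rises above a at some time.
  Rational times make it a countable union, and positive times admit Girsanov's formula.\<close>

definition exceed :: "real \<Rightarrow> real \<Rightarrow> (real \<Rightarrow> real) set" where
  "exceed b a = {\<omega> \<in> paths. \<exists>q\<in>\<rat> \<inter> {0<..}. drift b \<omega> q > a}"

text \<open>The almost sure properties of the maximum under negative drift, collected so that later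
  estimates can argue path by path outside one null set.\<close>

definition sup_regular :: "real \<Rightarrow> (real \<Rightarrow> real) \<Rightarrow> bool" where
  "sup_regular b \<omega> \<longleftrightarrow> \<omega> \<in> paths \<and>
     ((\<lambda>t. running_sup t (drift b \<omega>)) \<longlongrightarrow> total_sup (drift b \<omega>)) at_top \<and>
     (\<forall>t\<ge>0. 0 \<le> running_sup t (drift b \<omega>) \<and> running_sup t (drift b \<omega>) \<le> total_sup (drift b \<omega>)) \<and>
     (\<forall>a. a < total_sup (drift b \<omega>) \<longrightarrow> \<omega> \<in> exceed b a)"

definition sup_exp :: "real \<Rightarrow> real \<Rightarrow> real \<Rightarrow> (real \<Rightarrow> real) \<Rightarrow> real" where
  "sup_exp \<nu> b t \<omega> = exp (\<nu> * running_sup t (drift b \<omega>))"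

lemma sup_exp_pos [simp]: "0 < sup_exp \<nu> b t \<omega>" "0 \<le> sup_exp \<nu> b t \<omega>" "sup_exp \<nu> b t \<omega> \<noteq> 0"
  by (simp_all add: sup_exp_def)

lemma measurable_sup_exp: "0 \<le> t \<Longrightarrow> sup_exp \<nu> b t \<in> borel_measurable (path_filtration t)"
  unfolding sup_exp_def
  using measurable_compose[OF measurable_drift measurable_running_sup] by measurable

definition total_sup_exp :: "real \<Rightarrow> real \<Rightarrow> (real \<Rightarrow> real) \<Rightarrow> real" where
  "total_sup_exp \<nu> b \<omega> = exp (\<nu> * total_sup (drift b \<omega>))"

lemma total_sup_exp_pos [simp]: "0 < total_sup_exp \<nu> b \<omega>" "0 \<le> total_sup_exp \<nu> b \<omega>" "total_sup_exp \<nu> b \<omega> \<noteq> 0"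
  by (simp_all add: total_sup_exp_def)

context wiener
begin

lemma emeasure_paths [simp]: "emeasure P paths = 1"
  using emeasure_space_1 by simp

lemma measurable_drift_sup: "0 \<le> t \<Longrightarrow> (\<lambda>\<omega>. running_sup t (drift b \<omega>)) \<in> borel_measurable P"
  by (rule measurable_P[OF measurable_compose[OF measurable_drift measurable_running_sup]])

lemma measurable_total_sup: "(\<lambda>\<omega>. total_sup (drift b \<omega>)) \<in> borel_measurable P"
  unfolding total_sup_def by (intro borel_measurable_lim_metric measurable_drift_sup) simp

lemma measurable_total_sup_exp: "total_sup_exp \<nu> b \<in> borel_measurable P"
  unfolding total_sup_exp_def using measurable_total_sup by measurable

lemma measurable_sup_exp_P: "0 \<le> t \<Longrightarrow> sup_exp \<nu> b t \<in> borel_measurable P"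
  by (rule measurable_P[OF measurable_sup_exp])

text \<open>Passing from drift \<open>-c\<close> to drift \<open>c\<close> has density at least \<open>exp (2 * c * a)\<close> on an event on
  which the path is above \<open>a\<close>.\<close>

lemma drift_reversal_le:
  assumes j: "j > 0" and c: "c \<ge> 0" and A: "A \<in> sets (path_filtration j)"
    and a: "\<And>\<omega>. \<omega> \<in> A \<Longrightarrow> \<omega> j > a"
  shows "measure P (drift (-c) -` A \<inter> paths) \<le> exp (- 2 * c * a) * measure P (drift c -` A \<inter> paths)"
proof -
  have [measurable]: "A \<in> sets P" using A path_filtration_subset sets_P by auto
  have [measurable]: "(\<lambda>\<omega>. \<omega> j) \<in> borel_measurable P" using j by (intro measurable_eval_P) simp
  have m: "drift b -` A \<inter> paths \<in> sets P" for b
    using measurable_sets[OF measurable_P[OF measurable_drift] A, of b] by simp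
  have eq: "emeasure P (drift b -` A \<inter> paths) = (\<integral>\<^sup>+\<omega>. ennreal (exp (b * \<omega> j - b\<^sup>2 * j / 2)) * indicator A \<omega> \<partial>P)" for b
  proof -
    have "emeasure P (drift b -` A \<inter> paths) = (\<integral>\<^sup>+\<omega>. indicator A (drift b \<omega>) \<partial>P)"
      unfolding nn_integral_indicator[OF m, symmetric]
      by (intro nn_integral_cong) (auto simp: indicator_def)
    then show ?thesis using girsanov[OF j, of "indicator A" b] A by simp
  qed
  have "emeasure P (drift (-c) -` A \<inter> paths) \<le>
      (\<integral>\<^sup>+\<omega>. ennreal (exp (- 2 * c * a)) * (ennreal (exp (c * \<omega> j - c\<^sup>2 * j / 2)) * indicator A \<omega>) \<partial>P)"
    unfolding eq
  proof (rule nn_integral_mono)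
    fix \<omega>
    show "ennreal (exp (- c * \<omega> j - (- c)\<^sup>2 * j / 2)) * indicator A \<omega> \<le>
        ennreal (exp (- 2 * c * a)) * (ennreal (exp (c * \<omega> j - c\<^sup>2 * j / 2)) * indicator A \<omega>)"
    proof (cases "\<omega> \<in> A")
      case True
      then have "c * a \<le> c * \<omega> j" using a c by (intro mult_left_mono) (auto intro: less_imp_le)
      then show ?thesis using True by (simp flip: ennreal_mult exp_add)
    qed simp
  qed
  also have "\<dots> = ennreal (exp (- 2 * c * a)) * emeasure P (drift c -` A \<inter> paths)"
    unfolding eq by (rule nn_integral_cmult) measurable
  finally show ?thesis by (simp add: emeasure_eq_measure flip: ennreal_mult)
qed

text \<open>Decomposition by the first exceedance: \<open>A j\<close> says that j is the first time
  in J at which the path is above a. These events are disjoint and \<open>A j\<close> is known at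
  time j, so \<open>drift_reversal_le\<close> applies to each of them, and their probabilities under
  drift c sum to at most 1.\<close>

lemma exceed_finite:
  assumes J: "finite J" "J \<subseteq> {0<..}" and c: "c \<ge> 0"
  shows "measure P {\<omega> \<in> paths. \<exists>j\<in>J. drift (-c) \<omega> j > a} \<le> exp (- 2 * c * a)"
proof -
  define A where "A j = {\<omega> \<in> paths. \<omega> j > a \<and> (\<forall>i\<in>{i\<in>J. i < j}. \<omega> i \<le> a)}" for j
  have A: "A j \<in> sets (path_filtration j)" if "j \<in> J" for j
  proof -
    have 1: "{\<omega> \<in> space (path_filtration j). \<forall>i\<in>{i\<in>J. i < j}. \<omega> i \<in> {..a}} \<in> sets (path_filtration j)"
      by (rule sets_Collect_cylinder[where N = borel]) (use J in \<open>auto intro!: measurable_eval\<close>)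
    have "(\<lambda>\<omega>. \<omega> j) \<in> borel_measurable (path_filtration j)" using J that by (intro measurable_eval) auto
    from measurable_sets[OF this, of "{a<..}"] 1
    have "((\<lambda>\<omega>. \<omega> j) -` {a<..} \<inter> paths) \<inter> {\<omega> \<in> paths. \<forall>i\<in>{i\<in>J. i < j}. \<omega> i \<in> {..a}} \<in> sets (path_filtration j)"
      by simp
    also have "((\<lambda>\<omega>. \<omega> j) -` {a<..} \<inter> paths) \<inter> {\<omega> \<in> paths. \<forall>i\<in>{i\<in>J. i < j}. \<omega> i \<in> {..a}} = A j"
      by (auto simp: A_def)
    finally show ?thesis .
  qed
  have m: "drift b -` A j \<inter> paths \<in> sets P" if "j \<in> J" for b j
    using measurable_sets[OF measurable_P[OF measurable_drift] A[OF that], of b] by simp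
  have disj: "disjoint_family_on (\<lambda>j. drift b -` A j \<inter> paths) J" for b
    unfolding disjoint_family_on_def
  proof (intro ballI impI)
    fix i j assume ij: "i \<in> J" "j \<in> J" "i \<noteq> j"
    have "A i \<inter> A j = {}" using ij unfolding A_def by (cases i j rule: linorder_cases) force+
    then show "(drift b -` A i \<inter> paths) \<inter> (drift b -` A j \<inter> paths) = {}" by auto
  qed
  have "{\<omega> \<in> paths. \<exists>j\<in>J. drift (-c) \<omega> j > a} = (\<Union>j\<in>J. drift (-c) -` A j \<inter> paths)"
  proof (intro subset_antisym subsetI)
    fix \<omega> assume \<omega>: "\<omega> \<in> {\<omega> \<in> paths. \<exists>j\<in>J. drift (-c) \<omega> j > a}"
    define K where "K = {j\<in>J. drift (-c) \<omega> j > a}"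
    have K: "finite K" "K \<noteq> {}" using J \<omega> by (auto simp: K_def)
    then have "Min K \<in> K" by simp
    moreover have "drift (-c) \<omega> i \<le> a" if "i \<in> J" "i < Min K" for i
      using Min_le[OF K(1), of i] that by (auto simp: K_def not_less[symmetric])
    ultimately show "\<omega> \<in> (\<Union>j\<in>J. drift (-c) -` A j \<inter> paths)"
      using \<omega> by (auto simp: A_def K_def drift_in_paths intro!: bexI[of _ "Min K"])
  qed (auto simp: A_def)
  then have "measure P {\<omega> \<in> paths. \<exists>j\<in>J. drift (-c) \<omega> j > a} =
      measure P (\<Union>j\<in>J. drift (-c) -` A j \<inter> paths)" by (rule arg_cong)
  also have "\<dots> = (\<Sum>j\<in>J. measure P (drift (-c) -` A j \<inter> paths))"
    by (rule finite_measure_finite_Union[OF J(1) _ disj]) (use m in auto)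
  also have "\<dots> \<le> (\<Sum>j\<in>J. exp (- 2 * c * a) * measure P (drift c -` A j \<inter> paths))"
  proof (rule sum_mono)
    fix j assume j: "j \<in> J"
    show "measure P (drift (-c) -` A j \<inter> paths) \<le> exp (- 2 * c * a) * measure P (drift c -` A j \<inter> paths)"
      by (rule drift_reversal_le[OF _ c A[OF j]]) (use J j in \<open>auto simp: A_def\<close>)
  qed
  also have "\<dots> = exp (- 2 * c * a) * measure P (\<Union>j\<in>J. drift c -` A j \<inter> paths)"
    unfolding sum_distrib_left[symmetric]
    by (subst finite_measure_finite_Union[OF J(1) _ disj]) (use m in auto)
  also have "\<dots> \<le> exp (- 2 * c * a)" by simp
  finally show ?thesis .
qed

text \<open>The positive rationals are exhausted by an increasing sequence of finite sets, and the
  bound of \<open>exceed_finite\<close> does not depend on the set.\<close>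

lemma
  assumes c: "c \<ge> 0"
  shows exceed_measurable: "exceed (-c) a \<in> sets P"
    and measure_exceed: "measure P (exceed (-c) a) \<le> exp (- 2 * c * a)"
proof -
  have "countable (\<rat> \<inter> {0<..} :: real set)" "\<rat> \<inter> {0<..} \<noteq> ({} :: real set)"
    using countable_rat by (auto intro!: exI[of _ 1])
  then obtain q :: "nat \<Rightarrow> real" where q: "range q = \<rat> \<inter> {0<..}" using range_from_nat_into by metis
  define E where "E n = {\<omega> \<in> paths. \<exists>j\<in>q ` {..n}. drift (-c) \<omega> j > a}" for n :: nat
  have qpos: "q i > 0" for i using q by auto
  have E: "E n \<in> sets P" for n
  proof -
    have "{\<omega> \<in> paths. drift (-c) \<omega> (q i) > a} \<in> sets P" for i
    proof -
      have "(\<lambda>\<omega>. drift (-c) \<omega> (q i)) \<in> borel_measurable P"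
        using measurable_compose[OF measurable_P[OF measurable_drift] measurable_eval[of "q i" "q i"]] qpos[of i]
        by simp
      then have "{\<omega> \<in> space P. drift (-c) \<omega> (q i) > a} \<in> sets P" by measurable
      then show ?thesis by simp
    qed
    then have "(\<Union>i\<in>{..n}. {\<omega> \<in> paths. drift (-c) \<omega> (q i) > a}) \<in> sets P" by blast
    also have "(\<Union>i\<in>{..n}. {\<omega> \<in> paths. drift (-c) \<omega> (q i) > a}) = E n" by (auto simp: E_def)
    finally show ?thesis .
  qed
  have U: "exceed (-c) a = (\<Union>n. E n)"
    unfolding exceed_def q[symmetric] E_def by auto
  show "exceed (-c) a \<in> sets P" unfolding U using E by blast
  have "incseq E" by (intro incseq_SucI) (auto simp: E_def)
  then have "(\<lambda>n. measure P (E n)) \<longlonglongrightarrow> measure P (exceed (-c) a)"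
    unfolding U using E by (intro finite_Lim_measure_incseq) auto
  then show "measure P (exceed (-c) a) \<le> exp (- 2 * c * a)"
  proof (rule LIMSEQ_le_const2)
    have "measure P (E n) \<le> exp (- 2 * c * a)" for n
      unfolding E_def by (rule exceed_finite[OF _ _ c]) (use qpos in auto)
    then show "\<exists>N. \<forall>n\<ge>N. measure P (E n) \<le> exp (- 2 * c * a)" by blast
  qed
qed

text \<open>A path with unbounded maximum lies in \<open>exceed (-c) (real k)\<close> for every k,
  and these events have probability at most exp (-2 * c) ^ k.\<close>

lemma AE_bdd_sup:
  assumes c: "c > 0"
  shows "AE \<omega> in P. bdd_above (range (\<lambda>n::nat. running_sup (real n) (drift (-c) \<omega>)))"
proof -
  define N where "N = (\<Inter>k::nat. exceed (-c) (real k))"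
  have N: "N \<in> sets P" unfolding N_def using exceed_measurable c by (intro sets.countable_INT) auto
  have le: "measure P N \<le> exp (- 2 * c) ^ k" for k
  proof -
    have "measure P N \<le> measure P (exceed (-c) (real k))"
      unfolding N_def using exceed_measurable c by (intro finite_measure_mono) auto
    also have "\<dots> \<le> exp (- 2 * c) ^ k"
      using measure_exceed[of c "real k"] c by (simp add: exp_of_nat_mult[symmetric] mult_ac)
    finally show ?thesis .
  qed
  have "(\<lambda>k. exp (- 2 * c) ^ k) \<longlonglongrightarrow> 0" using c by (intro LIMSEQ_realpow_zero) auto
  from LIMSEQ_le_const[OF this, of "measure P N"] le have "measure P N \<le> 0" by blast
  then have "measure P N = 0" using measure_nonneg[of P N] by linarith
  then have "N \<in> null_sets P" using N by (simp add: null_sets_def emeasure_eq_measure)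
  then show ?thesis
  proof (rule AE_I')
    show "{\<omega> \<in> space P. \<not> bdd_above (range (\<lambda>n::nat. running_sup (real n) (drift (-c) \<omega>)))} \<subseteq> N"
    proof (clarsimp simp: N_def)
      fix \<omega> k assume \<omega>: "\<omega> \<in> paths" and nb: "\<not> bdd_above (range (\<lambda>n::nat. running_sup (real n) (drift (-c) \<omega>)))"
      from nb obtain n :: nat where n: "running_sup (real n) (drift (-c) \<omega>) > real k"
        unfolding bdd_above_def by (auto simp: not_le)
      from running_sup_greater_rat[OF drift_in_paths[OF \<omega>] _ this]
      show "\<omega> \<in> exceed (-c) (real k)" using \<omega> unfolding exceed_def by auto
    qed
  qed
qed

lemma AE_sup_nonneg: "AE \<omega> in P. \<forall>t\<ge>0. 0 \<le> running_sup t (drift b \<omega>)"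
  using start_0 AE_space
proof eventually_elim
  fix \<omega> assume "\<omega> 0 = 0" "\<omega> \<in> space P"
  then show "\<forall>t\<ge>0. 0 \<le> running_sup t (drift b \<omega>)"
    using running_sup_upper[OF drift_in_paths, of \<omega> 0 _ b] by (auto simp: drift_def)
qed

lemma AE_sup_regular:
  assumes c: "c > 0"
  shows "AE \<omega> in P. sup_regular (-c) \<omega>"
  using AE_bdd_sup[OF c] AE_sup_nonneg[of "-c"] AE_space
proof eventually_elim
  fix \<omega> assume bdd: "bdd_above (range (\<lambda>n::nat. running_sup (real n) (drift (-c) \<omega>)))"
    and nn: "\<forall>t\<ge>0. 0 \<le> running_sup t (drift (-c) \<omega>)" and \<omega>: "\<omega> \<in> space P"
  have p: "drift (-c) \<omega> \<in> paths" using \<omega> by (simp add: drift_in_paths)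
  note lim = running_sup_tendsto[OF p bdd]
  have "\<omega> \<in> exceed (-c) a" if "a < total_sup (drift (-c) \<omega>)" for a
  proof -
    have "\<forall>\<^sub>F t in at_top. 0 \<le> t \<and> a < running_sup t (drift (-c) \<omega>)"
      using order_tendstoD(1)[OF lim that] eventually_ge_at_top[of 0] by eventually_elim simp
    then obtain t where "0 \<le> t" "a < running_sup t (drift (-c) \<omega>)"
      using eventually_happens'[OF trivial_limit_at_top_linorder] by blast
    from running_sup_greater_rat[OF p this] show ?thesis using \<omega> unfolding exceed_def by auto
  qed
  then show "sup_regular (-c) \<omega>"
    unfolding sup_regular_def using lim nn running_sup_le_total_sup[OF p bdd] \<omega> by auto
qed

text \<open>For \<nu> > 0 the range of the maximum S is cut into unit intervals: k < S \<le> k + 1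
  bounds the weight by exp (\<nu> * (k + 1)) and has probability at most exp (-2 * c * k), so the
  mean is dominated by a geometric series of ratio exp (\<nu> - 2 * c) < 1. For \<nu> \<le> 0 the
  weight is at most 1.\<close>

lemma integrable_total_sup_exp:
  assumes c: "c > 0" and \<nu>: "\<nu> < 2 * c"
  shows "integrable P (total_sup_exp \<nu> (-c))"
proof (cases "\<nu> \<le> 0")
  case True
  have "AE \<omega> in P. norm (total_sup_exp \<nu> (-c) \<omega>) \<le> 1"
    using AE_sup_regular[OF c]
  proof eventually_elim
    fix \<omega> assume "sup_regular (-c) \<omega>"
    then have "0 \<le> total_sup (drift (-c) \<omega>)" unfolding sup_regular_def using order_trans by blast
    then show "norm (total_sup_exp \<nu> (-c) \<omega>) \<le> 1"
      using True by (simp add: total_sup_exp_def mult_nonpos_nonneg)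
  qed
  then show ?thesis by (rule integrable_const_bound) (rule measurable_total_sup_exp)
next
  case False
  then have \<nu>0: "\<nu> > 0" by simp
  let ?S = "\<lambda>\<omega>. total_sup (drift (-c) \<omega>)"
  let ?r = "exp (\<nu> - 2 * c)"
  have term_le: "f k \<le> suminf f" for f :: "nat \<Rightarrow> ennreal" and k
    using sum_le_suminf[OF summableI, of "{k}" f] by simp
  have "(\<integral>\<^sup>+\<omega>. ennreal (total_sup_exp \<nu> (-c) \<omega>) \<partial>P) \<le>
      (\<integral>\<^sup>+\<omega>. ennreal (exp \<nu>) + (\<Sum>k. ennreal (exp (\<nu> * (real k + 1))) * indicator (exceed (-c) (real k)) \<omega>) \<partial>P)"
  proof (rule nn_integral_mono_AE)
    show "AE \<omega> in P. ennreal (total_sup_exp \<nu> (-c) \<omega>) \<le>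
        ennreal (exp \<nu>) + (\<Sum>k. ennreal (exp (\<nu> * (real k + 1))) * indicator (exceed (-c) (real k)) \<omega>)"
      using AE_sup_regular[OF c]
    proof eventually_elim
      fix \<omega> assume H: "sup_regular (-c) \<omega>"
      show "ennreal (total_sup_exp \<nu> (-c) \<omega>) \<le>
        ennreal (exp \<nu>) + (\<Sum>k. ennreal (exp (\<nu> * (real k + 1))) * indicator (exceed (-c) (real k)) \<omega>)"
      proof (cases "?S \<omega> \<le> 1")
        case True
        then have "total_sup_exp \<nu> (-c) \<omega> \<le> exp \<nu>" using \<nu>0 by (simp add: total_sup_exp_def)
        then show ?thesis by (intro order_trans[OF ennreal_leI add_increasing2]) auto
      next
        case False
        \<comment> \<open>The ceiling minus 1 and not the floor: k must lie strictly below the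
          maximum for the path to belong to \<open>exceed (-c) (real k)\<close>.\<close>
        define k where "k = nat (\<lceil>?S \<omega>\<rceil> - 1)"
        have k: "real k < ?S \<omega>" "?S \<omega> \<le> real k + 1" using False unfolding k_def by linarith+
        have ex: "\<omega> \<in> exceed (-c) (real k)" using H k by (auto simp: sup_regular_def)
        have "total_sup_exp \<nu> (-c) \<omega> \<le> exp (\<nu> * (real k + 1))"
          using \<nu>0 k by (simp add: total_sup_exp_def)
        then have "ennreal (total_sup_exp \<nu> (-c) \<omega>) \<le>
            ennreal (exp (\<nu> * (real k + 1))) * indicator (exceed (-c) (real k)) \<omega>"
          using ex by (simp add: ennreal_leI)
        also have "\<dots> \<le> (\<Sum>k. ennreal (exp (\<nu> * (real k + 1))) * indicator (exceed (-c) (real k)) \<omega>)"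
          by (rule term_le)
        finally show ?thesis by (rule add_increasing[rotated]) simp
      qed
    qed
  qed
  also have "\<dots> = ennreal (exp \<nu>) + (\<Sum>k. ennreal (exp (\<nu> * (real k + 1))) * emeasure P (exceed (-c) (real k)))"
  proof -
    have [measurable]: "exceed (-c) a \<in> sets P" for a using c by (intro exceed_measurable) simp
    show ?thesis
      by (subst nn_integral_add)
        (auto simp: nn_integral_suminf nn_integral_cmult intro!: borel_measurable_suminf_order)
  qed
  also have "\<dots> \<le> ennreal (exp \<nu>) + (\<Sum>k. ennreal (exp \<nu> * ?r ^ k))"
  proof (intro add_left_mono suminf_le summableI)
    fix k :: nat
    have "ennreal (exp (\<nu> * (real k + 1))) * emeasure P (exceed (-c) (real k)) \<le>
        ennreal (exp (\<nu> * (real k + 1)) * exp (- 2 * c * real k))"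
      using measure_exceed[of c "real k"] c
      by (simp add: emeasure_eq_measure ennreal_leI flip: ennreal_mult)
    also have "exp (\<nu> * (real k + 1)) * exp (- 2 * c * real k) = exp \<nu> * ?r ^ k"
      by (simp add: exp_of_nat_mult[symmetric] algebra_simps flip: exp_add)
    finally show "ennreal (exp (\<nu> * (real k + 1))) * emeasure P (exceed (-c) (real k)) \<le> ennreal (exp \<nu> * ?r ^ k)" .
  qed
  also have "\<dots> < \<infinity>"
  proof -
    have "summable (\<lambda>k. exp \<nu> * ?r ^ k)" using \<nu> by (intro summable_mult summable_geometric) simp
    then show ?thesis by (simp add: suminf_ennreal2 ennreal_add_eq_top less_top[symmetric])
  qed
  finally show ?thesis
    by (intro integrableI_bounded measurable_total_sup_exp) simp
qed

text \<open>The maximum lies between 0 and its limit: for \<nu> \<ge> 0 the limiting weight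
  dominates, for \<nu> < 0 the constant 1 does. Their sum serves both signs and all t at
  once.\<close>

lemma sup_exp_bound:
  assumes c: "c > 0"
  shows "AE \<omega> in P. \<forall>t\<ge>0. norm (sup_exp \<nu> (-c) t \<omega>) \<le> 1 + total_sup_exp \<nu> (-c) \<omega>"
  using AE_sup_regular[OF c]
proof eventually_elim
  fix \<omega> assume H: "sup_regular (-c) \<omega>"
  show "\<forall>t\<ge>0. norm (sup_exp \<nu> (-c) t \<omega>) \<le> 1 + total_sup_exp \<nu> (-c) \<omega>"
  proof (intro allI impI)
    fix t :: real assume t: "t \<ge> 0"
    show "norm (sup_exp \<nu> (-c) t \<omega>) \<le> 1 + total_sup_exp \<nu> (-c) \<omega>"
    proof (cases "\<nu> \<ge> 0")
      case True
      then have "sup_exp \<nu> (-c) t \<omega> \<le> total_sup_exp \<nu> (-c) \<omega>"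
        using H t by (auto simp: sup_regular_def sup_exp_def total_sup_exp_def intro!: mult_left_mono)
      then show ?thesis by simp
    next
      case False
      then have "sup_exp \<nu> (-c) t \<omega> \<le> 1"
        using H t by (auto simp: sup_regular_def sup_exp_def intro!: mult_nonpos_nonneg)
      then show ?thesis by (simp add: add_increasing2)
    qed
  qed
qed

text \<open>On [0, t], changing the drift from -c to b moves the path, hence its maximum, by at most
  \<bar>b + c\<bar> * t. This reduces any drift to a strongly negative one, with c chosen so that
  \<nu> < 2 * c.\<close>

lemma integrable_sup_exp:
  assumes t: "t \<ge> 0"
  shows "integrable P (sup_exp \<nu> b t)"
proof -
  define c where "c = \<bar>\<nu>\<bar> + 1"
  have c: "c > 0" "\<nu> < 2 * c" by (auto simp: c_def)
  define K where "K = exp (\<bar>\<nu>\<bar> * (\<bar>b + c\<bar> * t))"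
  have "integrable P (\<lambda>\<omega>. K * (1 + total_sup_exp \<nu> (-c) \<omega>))"
    using integrable_total_sup_exp[OF c] by simp
  then show ?thesis
  proof (rule Bochner_Integration.integrable_bound[OF _ measurable_sup_exp_P[OF t]])
    show "AE \<omega> in P. norm (sup_exp \<nu> b t \<omega>) \<le> norm (K * (1 + total_sup_exp \<nu> (-c) \<omega>))"
      using sup_exp_bound[OF c(1), of \<nu>] AE_space
    proof eventually_elim
      fix \<omega> assume H: "\<forall>t\<ge>0. norm (sup_exp \<nu> (-c) t \<omega>) \<le> 1 + total_sup_exp \<nu> (-c) \<omega>" and \<omega>: "\<omega> \<in> space P"
      have p: "drift x \<omega> \<in> paths" for x using \<omega> by (simp add: drift_in_paths)
      have D: "\<bar>drift b \<omega> s - drift (-c) \<omega> s\<bar> \<le> \<bar>b + c\<bar> * t" if "0 \<le> s" "s \<le> t" for s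
      proof -
        have "drift b \<omega> s - drift (-c) \<omega> s = (b + c) * s" using that by (simp add: drift_def algebra_simps)
        then show ?thesis using that by (simp add: abs_mult mult_left_mono)
      qed
      have 1: "running_sup t (drift b \<omega>) \<le> running_sup t (drift (-c) \<omega>) + \<bar>b + c\<bar> * t"
        by (rule running_sup_least[OF t]) (use D running_sup_upper[OF p, of _ t "-c"] in \<open>smt (verit)\<close>)
      have 2: "running_sup t (drift (-c) \<omega>) \<le> running_sup t (drift b \<omega>) + \<bar>b + c\<bar> * t"
        by (rule running_sup_least[OF t]) (use D running_sup_upper[OF p, of _ t b] in \<open>smt (verit)\<close>)
      have "\<nu> * (running_sup t (drift b \<omega>) - running_sup t (drift (-c) \<omega>)) \<le>
          \<bar>\<nu> * (running_sup t (drift b \<omega>) - running_sup t (drift (-c) \<omega>))\<bar>" by simp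
      also have "\<dots> \<le> \<bar>\<nu>\<bar> * (\<bar>b + c\<bar> * t)"
        unfolding abs_mult using 1 2 by (intro mult_left_mono) auto
      finally have "sup_exp \<nu> b t \<omega> \<le> K * sup_exp \<nu> (-c) t \<omega>"
        by (simp add: sup_exp_def K_def algebra_simps flip: exp_add)
      also have "\<dots> \<le> K * (1 + total_sup_exp \<nu> (-c) \<omega>)"
        using H t by (intro mult_left_mono) (auto simp: K_def)
      finally show "norm (sup_exp \<nu> b t \<omega>) \<le> norm (K * (1 + total_sup_exp \<nu> (-c) \<omega>))" by simp
    qed
  qed
qed

lemma sup_exp_L1:
  assumes c: "c > 0" and \<nu>: "\<nu> < 2 * c"
  shows "((\<lambda>t. \<integral>\<omega>. \<bar>sup_exp \<nu> (-c) t \<omega> - total_sup_exp \<nu> (-c) \<omega>\<bar> \<partial>P) \<longlongrightarrow> 0) at_top"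
proof -
  \<comment> \<open>Measurability has to hold for every real t, while at negative t the supremum
    would run over the empty set; \<open>max 0 t\<close> avoids this and changes nothing in the
    limit.\<close>
  let ?D = "\<lambda>t \<omega>. \<bar>sup_exp \<nu> (-c) (max 0 t) \<omega> - total_sup_exp \<nu> (-c) \<omega>\<bar>"
  have "((\<lambda>t. \<integral>\<omega>. ?D t \<omega> \<partial>P) \<longlongrightarrow> (\<integral>\<omega>. 0 \<partial>P)) at_top"
  proof (rule integral_dominated_convergence_at_top[where w = "\<lambda>\<omega>. 1 + 2 * total_sup_exp \<nu> (-c) \<omega>"])
    show "?D t \<in> borel_measurable P" for t
      by (intro borel_measurable_abs borel_measurable_diff measurable_sup_exp_P measurable_total_sup_exp) simp
    show "integrable P (\<lambda>\<omega>. 1 + 2 * total_sup_exp \<nu> (-c) \<omega>)"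
      using integrable_total_sup_exp[OF c \<nu>] by simp
    have "AE \<omega> in P. norm (?D t \<omega>) \<le> 1 + 2 * total_sup_exp \<nu> (-c) \<omega>" for t
      using sup_exp_bound[OF c, of \<nu>]
    proof eventually_elim
      fix \<omega> assume "\<forall>t\<ge>0. norm (sup_exp \<nu> (-c) t \<omega>) \<le> 1 + total_sup_exp \<nu> (-c) \<omega>"
      then have "sup_exp \<nu> (-c) (max 0 t) \<omega> \<le> 1 + total_sup_exp \<nu> (-c) \<omega>" by simp
      moreover have "sup_exp \<nu> (-c) (max 0 t) \<omega> > 0" "total_sup_exp \<nu> (-c) \<omega> > 0" by simp_all
      ultimately show "norm (?D t \<omega>) \<le> 1 + 2 * total_sup_exp \<nu> (-c) \<omega>" unfolding real_norm_def by linarith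
    qed
    then show "\<forall>\<^sub>F t in at_top. AE \<omega> in P. norm (?D t \<omega>) \<le> 1 + 2 * total_sup_exp \<nu> (-c) \<omega>" by simp
    show "AE \<omega> in P. ((\<lambda>t. ?D t \<omega>) \<longlongrightarrow> 0) at_top"
      using AE_sup_regular[OF c]
    proof eventually_elim
      fix \<omega> assume "sup_regular (-c) \<omega>"
      then have "((\<lambda>t. running_sup t (drift (-c) \<omega>)) \<longlongrightarrow> total_sup (drift (-c) \<omega>)) at_top"
        by (simp add: sup_regular_def)
      then have "((\<lambda>t. sup_exp \<nu> (-c) t \<omega>) \<longlongrightarrow> total_sup_exp \<nu> (-c) \<omega>) at_top"
        unfolding sup_exp_def total_sup_exp_def by (intro tendsto_intros)
      then have "((\<lambda>t. \<bar>sup_exp \<nu> (-c) t \<omega> - total_sup_exp \<nu> (-c) \<omega>\<bar>) \<longlongrightarrow> 0) at_top"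
        by (simp add: LIM_zero tendsto_rabs_zero)
      then show "((\<lambda>t. ?D t \<omega>) \<longlongrightarrow> 0) at_top"
        by (rule Lim_transform_eventually) (use eventually_ge_at_top[of 0] in eventually_elim, simp)
    qed
  qed simp
  then have "((\<lambda>t. \<integral>\<omega>. ?D t \<omega> \<partial>P) \<longlongrightarrow> 0) at_top" by simp
  then show ?thesis
    by (rule Lim_transform_eventually) (use eventually_ge_at_top[of 0] in eventually_elim, simp)
qed

text \<open>At \<open>b = - (\<nu> + h)\<close> this is the mean a(t) of the overview, by
  \<open>integral_gap_exp\<close>.\<close>

definition sup_mgf :: "real \<Rightarrow> real \<Rightarrow> real \<Rightarrow> real" where
  "sup_mgf \<nu> b t = expectation (sup_exp \<nu> b t)"

lemma sup_mgf_pos: "t \<ge> 0 \<Longrightarrow> 0 < sup_mgf \<nu> b t"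
  unfolding sup_mgf_def
  using integral_less_AE_space[of "\<lambda>_. 0" "sup_exp \<nu> b t"] integrable_sup_exp[of t \<nu> b]
  by simp

lemma total_sup_mgf_pos: "c > 0 \<Longrightarrow> \<nu> < 2 * c \<Longrightarrow> 0 < expectation (total_sup_exp \<nu> (-c))"
  using integral_less_AE_space[of "\<lambda>_. 0" "total_sup_exp \<nu> (-c)"] integrable_total_sup_exp[of c \<nu>]
  by simp

lemma sup_mgf_tendsto:
  assumes c: "c > 0" and \<nu>: "\<nu> < 2 * c"
  shows "(sup_mgf \<nu> (-c) \<longlongrightarrow> expectation (total_sup_exp \<nu> (-c))) at_top"
proof (rule Lim_null_comparison[OF _ sup_exp_L1[OF assms], THEN LIM_zero_cancel])
  show "\<forall>\<^sub>F t in at_top. norm (sup_mgf \<nu> (-c) t - expectation (total_sup_exp \<nu> (-c))) \<le>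
      (\<integral>\<omega>. \<bar>sup_exp \<nu> (-c) t \<omega> - total_sup_exp \<nu> (-c) \<omega>\<bar> \<partial>P)"
    using eventually_ge_at_top[of 0]
  proof eventually_elim
    fix t :: real assume t: "0 \<le> t"
    have "sup_mgf \<nu> (-c) t - expectation (total_sup_exp \<nu> (-c)) =
        (\<integral>\<omega>. sup_exp \<nu> (-c) t \<omega> - total_sup_exp \<nu> (-c) \<omega> \<partial>P)"
      unfolding sup_mgf_def using integrable_sup_exp[OF t] integrable_total_sup_exp[OF assms] by simp
    also have "norm \<dots> \<le> (\<integral>\<omega>. norm (sup_exp \<nu> (-c) t \<omega> - total_sup_exp \<nu> (-c) \<omega>) \<partial>P)"
      by (rule integral_norm_bound)
    finally show "norm (sup_mgf \<nu> (-c) t - expectation (total_sup_exp \<nu> (-c))) \<le>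
        (\<integral>\<omega>. \<bar>sup_exp \<nu> (-c) t \<omega> - total_sup_exp \<nu> (-c) \<omega>\<bar> \<partial>P)" by simp
  qed
qed

end

section \<open>Asymptotic independence of the rescaled path and the initial segment\<close>

definition bounded_continuous_C01 :: "((real \<Rightarrow> real) \<Rightarrow> real) \<Rightarrow> bool" where
  "bounded_continuous_C01 f \<longleftrightarrow> continuous_map C01 euclideanreal f \<and> bounded (f ` C01_set)"

lemma bounded_continuous_C01_measurable:
  assumes "bounded_continuous_C01 f"
  shows "f \<in> borel_measurable (borel_of C01)"
  unfolding borel_def
proof (rule measurable_measure_of)
  fix V :: "real set" assume "V \<in> {S. open S}"
  then have "openin C01 {x \<in> topspace C01. f x \<in> V}"
    using assms unfolding bounded_continuous_C01_def
    by (intro openin_continuous_map_preimage[of C01 euclideanreal]) auto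
  moreover have "f -` V \<inter> space (borel_of C01) = {x \<in> topspace C01. f x \<in> V}" by auto
  moreover have "{U. openin C01 U} \<subseteq> Pow (topspace C01)" using openin_subset[of C01] by blast
  ultimately show "f -` V \<inter> space (borel_of C01) \<in> sets (borel_of C01)"
    by (simp add: borel_of_def sets_measure_of sigma_sets.Basic)
qed auto

lemma bounded_continuous_C01_bound:
  assumes "bounded_continuous_C01 f"
  obtains C where "C > 0" "\<And>x. x \<in> C01_set \<Longrightarrow> \<bar>f x\<bar> \<le> C"
proof -
  have "bounded (f ` C01_set)" using assms by (simp add: bounded_continuous_C01_def)
  then obtain C where "C > 0" "\<forall>y\<in>f ` C01_set. norm y \<le> C" unfolding bounded_pos by blast
  then show ?thesis by (intro that[of C]) auto
qed

lemma bounded_continuous_C01_at: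
  assumes f: "bounded_continuous_C01 f" and x: "x \<in> C01_set" and e: "e > 0"
  obtains d where "d > 0" "\<And>y. y \<in> C01_set \<Longrightarrow> dist01 x y < d \<Longrightarrow> \<bar>f y - f x\<bar> < e"
proof -
  have "openin C01 {y \<in> topspace C01. f y \<in> ball (f x) e}"
    using f unfolding bounded_continuous_C01_def
    by (intro openin_continuous_map_preimage[of C01 euclideanreal]) auto
  moreover have "x \<in> {y \<in> topspace C01. f y \<in> ball (f x) e}" using x e by simp
  ultimately obtain d where d: "d > 0" "\<forall>y\<in>C01_set. dist01 x y < d \<longrightarrow> y \<in> {y \<in> topspace C01. f y \<in> ball (f x) e}"
    unfolding openin_C01 by blast
  show ?thesis
  proof (rule that[OF d(1)])
    fix y assume "y \<in> C01_set" "dist01 x y < d"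
    then have "f y \<in> ball (f x) e" using d(2) by blast
    then show "\<bar>f y - f x\<bar> < e" by (simp add: dist_real_def abs_minus_commute)
  qed
qed

text \<open>For \<open>x = unit_scale t \<omega>\<close> and \<open>r = s / t\<close> this depends only on the increments of \<open>\<omega>\<close> after time
  \<open>s\<close>, while it is uniformly close to \<open>x\<close> for large \<open>t\<close>.\<close>

definition restart :: "real \<Rightarrow> (real \<Rightarrow> real) \<Rightarrow> real \<Rightarrow> real" where
  "restart r x = (\<lambda>v\<in>{0..1}. x (max v r) - x r)"

lemma C01_set_continuous_on: "x \<in> C01_set \<Longrightarrow> S \<subseteq> {0..1} \<Longrightarrow> continuous_on S x"
  unfolding C01_set_def by (auto intro: continuous_on_subset)

lemma restart_in_C01: "x \<in> C01_set \<Longrightarrow> 0 \<le> r \<Longrightarrow> r \<le> 1 \<Longrightarrow> restart r x \<in> C01_set"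
  unfolding restart_def
  by (intro restrict_in_C01_set continuous_intros continuous_on_compose2[OF C01_set_continuous_on[of x "{0..1}"]]) auto

lemma measurable_restart:
  assumes r: "0 \<le> r" "r \<le> 1"
  shows "restart r \<in> borel_of C01 \<rightarrow>\<^sub>M borel_of C01"
proof (rule measurable_C01I)
  show "restart r x \<in> C01_set" if "x \<in> space (borel_of C01)" for x
    using that r by (simp add: restart_in_C01)
  fix s :: real assume s: "0 \<le> s" "s \<le> 1"
  then have "(\<lambda>x. restart r x s) = (\<lambda>x. x (max s r) - x r)" by (simp add: restart_def)
  moreover have "(\<lambda>x. x (max s r) - x r) \<in> borel_measurable (borel_of C01)"
    using s r by (intro borel_measurable_diff measurable_coord_C01) auto
  ultimately show "(\<lambda>x. restart r x s) \<in> borel_measurable (borel_of C01)" by simp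
qed

text \<open>Up to the restart point the restarted function is 0, and afterwards it is x minus its
  value there. It thus differs from x by at most the size of x near 0, which is small because x 0 =
  0.\<close>

lemma tendsto_restart:
  assumes f: "bounded_continuous_C01 f" and x: "x \<in> C01_set" "x 0 = 0"
    and r: "(r \<longlongrightarrow> 0) F" "\<forall>\<^sub>F t in F. 0 \<le> r t \<and> r t \<le> 1"
  shows "((\<lambda>t. f (restart (r t) x)) \<longlongrightarrow> f x) F"
proof (rule tendstoI)
  fix e :: real assume e: "e > 0"
  obtain d where d: "d > 0" "\<And>y. y \<in> C01_set \<Longrightarrow> dist01 x y < d \<Longrightarrow> \<bar>f y - f x\<bar> < e"
    using bounded_continuous_C01_at[OF f x(1) e] by blast
  have "continuous_on {0..1} x" using x by (simp add: C01_set_def)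
  then obtain a where a: "a > 0" "\<And>v. 0 \<le> v \<Longrightarrow> v \<le> 1 \<Longrightarrow> v < a \<Longrightarrow> \<bar>x v\<bar> < d / 2"
    using d(1) x(2) unfolding continuous_on_iff
    by (drule_tac x = 0 in bspec, simp, drule_tac x = "d / 2" in spec) (auto simp: dist_real_def)
  have "\<forall>\<^sub>F t in F. r t < a" using order_tendstoD(2)[OF r(1) a(1)] .
  with r(2) show "\<forall>\<^sub>F t in F. dist (f (restart (r t) x)) (f x) < e"
  proof eventually_elim
    fix t assume t: "0 \<le> r t \<and> r t \<le> 1" "r t < a"
    have C: "restart (r t) x \<in> C01_set" using restart_in_C01 x t by simp
    have "\<bar>x v - restart (r t) x v\<bar> \<le> d / 2" if "v \<in> {0..1}" for v
      using that a(2)[of v] a(2)[of "r t"] t by (cases "v \<le> r t") (auto simp: restart_def max_def)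
    then have "dist01 x (restart (r t) x) \<le> d / 2" using dist01_le_iff[OF x(1) C, of "d/2"] by blast
    then show "dist (f (restart (r t) x)) (f x) < e"
      using d(1) d(2)[OF C] by (simp add: dist_real_def)
  qed
qed

context wiener
begin

lemma standard_BM_unit: "standard_BM {0..1} P (\<lambda>t \<omega>. \<omega> t)"
proof -
  have "standard_BM {0..1} P (\<lambda>u \<omega>. 1 * \<omega> (0 + 1 * u) + 0)"
    by (rule standard_BM_affine[OF BM]) (use start_0 in auto)
  then show ?thesis by simp
qed

lemma measurable_unit_scale_P: "t \<ge> 0 \<Longrightarrow> unit_scale t \<in> P \<rightarrow>\<^sub>M borel_of C01"
  by (rule measurable_P[OF measurable_unit_scale])

lemma integral_unit_scale:
  fixes g :: "(real \<Rightarrow> real) \<Rightarrow> real"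
  assumes t: "t > 0" and g: "g \<in> borel_measurable (borel_of C01)"
  shows "(\<integral>\<omega>. g (unit_scale t \<omega>) \<partial>P) = (\<integral>\<omega>. g (unit_scale 1 \<omega>) \<partial>P)"
proof -
  have "(\<integral>\<omega>. g (unit_scale t \<omega>) \<partial>P) = (\<integral>x. g x \<partial>distr P (borel_of C01) (unit_scale t))"
    using t by (intro integral_distr[OF measurable_unit_scale_P g, symmetric]) simp
  also have "distr P (borel_of C01) (unit_scale t) = distr P (borel_of C01) (unit_scale 1)"
    using distr_unit_scale[OF t standard_BM_unit] distr_unit_scale[OF _ standard_BM_unit, of 1] by simp
  also have "(\<integral>x. g x \<partial>distr P (borel_of C01) (unit_scale 1)) = (\<integral>\<omega>. g (unit_scale 1 \<omega>) \<partial>P)"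
    by (rule integral_distr[OF measurable_unit_scale_P g]) simp
  finally show ?thesis .
qed

lemma measurable_test:
  "bounded_continuous_C01 f \<Longrightarrow> t \<ge> 0 \<Longrightarrow> (\<lambda>\<omega>. f (unit_scale t \<omega>)) \<in> borel_measurable P"
  by (rule measurable_compose[OF measurable_unit_scale_P bounded_continuous_C01_measurable])

lemma integrable_mult_bounded:
  fixes Y g :: "(real \<Rightarrow> real) \<Rightarrow> real"
  assumes "integrable P Y" "g \<in> borel_measurable P" "\<And>\<omega>. \<omega> \<in> paths \<Longrightarrow> \<bar>g \<omega>\<bar> \<le> C"
  shows "integrable P (\<lambda>\<omega>. Y \<omega> * g \<omega>)"
proof (rule Bochner_Integration.integrable_bound)
  show "integrable P (\<lambda>\<omega>. C * Y \<omega>)" using assms by simp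
  show "AE \<omega> in P. norm (Y \<omega> * g \<omega>) \<le> norm (C * Y \<omega>)"
  proof (rule AE_I2)
    fix \<omega> assume "\<omega> \<in> space P"
    then have "\<bar>g \<omega>\<bar> \<le> \<bar>C\<bar>" using assms(3)[of \<omega>] by simp
    then show "norm (Y \<omega> * g \<omega>) \<le> norm (C * Y \<omega>)"
      using mult_right_mono[of "\<bar>g \<omega>\<bar>" "\<bar>C\<bar>" "\<bar>Y \<omega>\<bar>"] by (simp add: abs_mult mult.commute)
  qed
qed (use assms in auto)

lemma integral_mult_bounded_le:
  fixes Y g :: "(real \<Rightarrow> real) \<Rightarrow> real"
  assumes "integrable P Y" "g \<in> borel_measurable P" "\<And>\<omega>. \<omega> \<in> paths \<Longrightarrow> \<bar>g \<omega>\<bar> \<le> C"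
  shows "\<bar>\<integral>\<omega>. Y \<omega> * g \<omega> \<partial>P\<bar> \<le> C * (\<integral>\<omega>. \<bar>Y \<omega>\<bar> \<partial>P)"
proof -
  have "\<bar>\<integral>\<omega>. Y \<omega> * g \<omega> \<partial>P\<bar> \<le> (\<integral>\<omega>. \<bar>Y \<omega> * g \<omega>\<bar> \<partial>P)"
    using integral_norm_bound[of P "\<lambda>\<omega>. Y \<omega> * g \<omega>"] by simp
  also have "\<dots> \<le> (\<integral>\<omega>. C * \<bar>Y \<omega>\<bar> \<partial>P)"
  proof (rule integral_mono)
    show "integrable P (\<lambda>\<omega>. \<bar>Y \<omega> * g \<omega>\<bar>)" using integrable_mult_bounded[OF assms] by simp
    show "\<bar>Y \<omega> * g \<omega>\<bar> \<le> C * \<bar>Y \<omega>\<bar>" if "\<omega> \<in> space P" for \<omega>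
      using mult_right_mono[of "\<bar>g \<omega>\<bar>" C "\<bar>Y \<omega>\<bar>"] assms(3)[of \<omega>] that
      by (simp add: abs_mult mult.commute)
  qed (use assms in simp)
  finally show ?thesis by simp
qed

text \<open>For a fixed path \<open>unit_scale t \<omega>\<close> changes with t and need not
  converge. Scale invariance replaces it by \<open>unit_scale 1 \<omega>\<close>, so that only the
  restart point s / t moves and dominated convergence applies.\<close>

lemma restart_L1:
  assumes f: "bounded_continuous_C01 f" and s: "s > 0"
  shows "((\<lambda>t. \<integral>\<omega>. \<bar>f (unit_scale t \<omega>) - f (restart (s / t) (unit_scale t \<omega>))\<bar> \<partial>P) \<longlongrightarrow> 0) at_top"
proof -
  obtain C where C: "C > 0" "\<And>x. x \<in> C01_set \<Longrightarrow> \<bar>f x\<bar> \<le> C"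
    using bounded_continuous_C01_bound[OF f] by blast
  \<comment> \<open>Clipping keeps the restart point in [0, 1] for every t; for t \<ge> s it equals
    s / t.\<close>
  define r where "r t = min 1 (s / max s t)" for t
  have r: "0 \<le> r t" "r t \<le> 1" for t using s by (auto simp: r_def)
  have fm: "f \<in> borel_measurable (borel_of C01)" by (rule bounded_continuous_C01_measurable[OF f])
  have gm: "(\<lambda>x. \<bar>f x - f (restart (r t) x)\<bar>) \<in> borel_measurable (borel_of C01)" for t
    by (intro borel_measurable_abs borel_measurable_diff fm measurable_compose[OF measurable_restart[OF r] fm])
  have "((\<lambda>t. \<integral>\<omega>. \<bar>f (unit_scale 1 \<omega>) - f (restart (r t) (unit_scale 1 \<omega>))\<bar> \<partial>P) \<longlongrightarrow> (\<integral>\<omega>. 0 \<partial>P)) at_top"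
  proof (rule integral_dominated_convergence_at_top[where w = "\<lambda>_. 2 * C"])
    show "(\<lambda>\<omega>. \<bar>f (unit_scale 1 \<omega>) - f (restart (r t) (unit_scale 1 \<omega>))\<bar>) \<in> borel_measurable P" for t
      using measurable_compose[OF measurable_unit_scale_P gm] by simp
    have "AE \<omega> in P. norm \<bar>f (unit_scale 1 \<omega>) - f (restart (r t) (unit_scale 1 \<omega>))\<bar> \<le> 2 * C" for t
    proof (rule AE_I2)
      fix \<omega> assume "\<omega> \<in> space P"
      then have "unit_scale 1 \<omega> \<in> C01_set" by (simp add: unit_scale_in_C01)
      then show "norm \<bar>f (unit_scale 1 \<omega>) - f (restart (r t) (unit_scale 1 \<omega>))\<bar> \<le> 2 * C"
        using C(2)[of "unit_scale 1 \<omega>"] C(2)[OF restart_in_C01[OF _ r], of "unit_scale 1 \<omega>" t]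
        unfolding real_norm_def by linarith
    qed
    then show "\<forall>\<^sub>F t in at_top. AE \<omega> in P. norm \<bar>f (unit_scale 1 \<omega>) - f (restart (r t) (unit_scale 1 \<omega>))\<bar> \<le> 2 * C"
      by simp
    have "((\<lambda>t. s / t) \<longlongrightarrow> 0) at_top"
      by (intro tendsto_divide_0[OF tendsto_const] filterlim_at_top_imp_at_infinity filterlim_ident)
    then have r0: "(r \<longlongrightarrow> 0) at_top"
    proof (rule Lim_transform_eventually)
      show "\<forall>\<^sub>F t in at_top. s / t = r t"
        using eventually_ge_at_top[of s] by eventually_elim (use s in \<open>auto simp: r_def\<close>)
    qed
    show "AE \<omega> in P. ((\<lambda>t. \<bar>f (unit_scale 1 \<omega>) - f (restart (r t) (unit_scale 1 \<omega>))\<bar>) \<longlongrightarrow> 0) at_top"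
      using start_0 AE_space
    proof eventually_elim
      fix \<omega> assume \<omega>: "\<omega> 0 = 0" "\<omega> \<in> space P"
      have "((\<lambda>t. f (restart (r t) (unit_scale 1 \<omega>))) \<longlongrightarrow> f (unit_scale 1 \<omega>)) at_top"
        by (rule tendsto_restart[OF f _ _ r0])
          (use \<omega> r in \<open>auto simp: unit_scale_in_C01\<close>, simp add: unit_scale_def)
      from tendsto_diff[OF tendsto_const[of "f (unit_scale 1 \<omega>)"] this]
      show "((\<lambda>t. \<bar>f (unit_scale 1 \<omega>) - f (restart (r t) (unit_scale 1 \<omega>))\<bar>) \<longlongrightarrow> 0) at_top"
        by (simp add: tendsto_rabs_zero)
    qed
  qed auto
  then have "((\<lambda>t. \<integral>\<omega>. \<bar>f (unit_scale 1 \<omega>) - f (restart (r t) (unit_scale 1 \<omega>))\<bar> \<partial>P) \<longlongrightarrow> 0) at_top"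
    by simp
  then show ?thesis
  proof (rule Lim_transform_eventually)
    show "\<forall>\<^sub>F t in at_top. (\<integral>\<omega>. \<bar>f (unit_scale 1 \<omega>) - f (restart (r t) (unit_scale 1 \<omega>))\<bar> \<partial>P) =
        (\<integral>\<omega>. \<bar>f (unit_scale t \<omega>) - f (restart (s / t) (unit_scale t \<omega>))\<bar> \<partial>P)"
      using eventually_ge_at_top[of s]
    proof eventually_elim
      fix t assume t: "s \<le> t"
      then have "r t = s / t" using s by (simp add: r_def)
      then show "(\<integral>\<omega>. \<bar>f (unit_scale 1 \<omega>) - f (restart (r t) (unit_scale 1 \<omega>))\<bar> \<partial>P) =
        (\<integral>\<omega>. \<bar>f (unit_scale t \<omega>) - f (restart (s / t) (unit_scale t \<omega>))\<bar> \<partial>P)"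
        using integral_unit_scale[OF _ gm[of t], of t] s t by simp
    qed
  qed
qed

text \<open>Restarted at s / t, the scaled path is the function \<open>\<Theta>\<close> of the
  increments after time s, hence independent of Y.\<close>

lemma restart_unit_scale_indep:
  assumes f: "bounded_continuous_C01 f" and s: "s > 0" and t: "s \<le> t"
    and Y: "Y \<in> borel_measurable (path_filtration s)" "integrable P Y"
  shows "(\<integral>\<omega>. Y \<omega> * f (restart (s / t) (unit_scale t \<omega>)) \<partial>P) =
    expectation Y * (\<integral>\<omega>. f (restart (s / t) (unit_scale t \<omega>)) \<partial>P)"
proof -
  obtain C where C: "C > 0" "\<And>x. x \<in> C01_set \<Longrightarrow> \<bar>f x\<bar> \<le> C"
    using bounded_continuous_C01_bound[OF f] by blast
  have t0: "t > 0" using s t by simp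
  define \<Theta> where "\<Theta> \<eta> = (\<lambda>v\<in>{0..1}. \<eta> (max 0 (v * t - s)) / sqrt t)" for \<eta> :: "real \<Rightarrow> real"
  have \<Theta>C: "\<Theta> \<eta> \<in> C01_set" if "\<eta> \<in> paths" for \<eta>
    unfolding \<Theta>_def divide_inverse using that
    by (intro restrict_in_C01_set continuous_intros continuous_on_compose2[OF paths_continuous_on[of \<eta> "{0..}"]]) auto
  have \<Theta>m: "\<Theta> \<in> path_sigma \<rightarrow>\<^sub>M borel_of C01"
  proof (rule measurable_C01I)
    fix v :: real assume "0 \<le> v" "v \<le> 1"
    then have "(\<lambda>\<eta>. \<Theta> \<eta> v) = (\<lambda>\<eta>. \<eta> (max 0 (v * t - s)) / sqrt t)" by (simp add: \<Theta>_def)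
    moreover have "(\<lambda>\<eta>. \<eta> (max 0 (v * t - s)) / sqrt t) \<in> borel_measurable path_sigma"
      by (intro borel_measurable_divide measurable_path_sigma[OF measurable_eval[OF _ order_refl]]) auto
    ultimately show "(\<lambda>\<eta>. \<Theta> \<eta> v) \<in> borel_measurable path_sigma" by simp
  qed (simp add: \<Theta>C)
  have eq: "restart (s / t) (unit_scale t \<omega>) = \<Theta> (incr s \<omega>)" for \<omega>
  proof
    fix v
    have "max v (s / t) * t = s + max 0 (v * t - s)" using t0 by (auto simp: max_def field_simps)
    then show "restart (s / t) (unit_scale t \<omega>) v = \<Theta> (incr s \<omega>) v"
      using s t t0 by (auto simp: restart_def unit_scale_def \<Theta>_def incr_def diff_divide_distrib)
  qed
  have G: "(\<lambda>\<eta>. f (\<Theta> \<eta>)) \<in> borel_measurable path_sigma"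
    by (rule measurable_compose[OF \<Theta>m bounded_continuous_C01_measurable[OF f]])
  have Gi: "integrable P (\<lambda>\<eta>. f (\<Theta> \<eta>))"
  proof (rule integrable_const_bound)
    show "AE \<eta> in P. norm (f (\<Theta> \<eta>)) \<le> C" using C(2) \<Theta>C by (intro AE_I2) simp
    show "(\<lambda>\<eta>. f (\<Theta> \<eta>)) \<in> borel_measurable P" using G unfolding measurable_cong_sets[OF sets_P refl] .
  qed
  \<comment> \<open>The instance with constant weight 1 identifies the mean of
    \<open>f (\<Theta> (incr s \<omega>))\<close> with that of
    \<open>f (\<Theta> \<omega>)\<close>.\<close>
  have "(\<integral>\<omega>. 1 * f (\<Theta> (incr s \<omega>)) \<partial>P) = (\<integral>\<omega>. 1 \<partial>P) * (\<integral>\<omega>. f (\<Theta> \<omega>) \<partial>P)"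
    by (rule integral_indep_incr(2)[OF s _ _ G Gi]) auto
  then have "(\<integral>\<omega>. f (\<Theta> (incr s \<omega>)) \<partial>P) = (\<integral>\<omega>. f (\<Theta> \<omega>) \<partial>P)" by (simp add: prob_space[simplified])
  then show ?thesis unfolding eq using integral_indep_incr(2)[OF s Y G Gi] by simp
qed

text \<open>Replacing the scaled path by its restarted version makes the covariance with Y vanish.
  The replacement is made once next to Y and once in the mean of f alone, each at a cost of K times
  the integral in \<open>restart_L1\<close>, whence the factor 2 * K.\<close>

lemma mixing_bounded:
  assumes f: "bounded_continuous_C01 f" and s: "s > 0"
    and Y: "Y \<in> borel_measurable (path_filtration s)" and K: "\<And>\<omega>. \<omega> \<in> paths \<Longrightarrow> \<bar>Y \<omega>\<bar> \<le> K"
  shows "((\<lambda>t. \<integral>\<omega>. Y \<omega> * f (unit_scale t \<omega>) \<partial>P) \<longlongrightarrow>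
    expectation Y * (\<integral>\<omega>. f (unit_scale 1 \<omega>) \<partial>P)) at_top"
proof -
  obtain C where C: "C > 0" "\<And>x. x \<in> C01_set \<Longrightarrow> \<bar>f x\<bar> \<le> C"
    using bounded_continuous_C01_bound[OF f] by blast
  have YP: "Y \<in> borel_measurable P" by (rule measurable_P[OF Y])
  have Yi: "integrable P Y" by (rule integrable_const_bound[of _ K]) (use K YP in auto)
  have fm: "f \<in> borel_measurable (borel_of C01)" by (rule bounded_continuous_C01_measurable[OF f])

  \<comment> \<open>Evaluating the bound at the zero path shows that K is nonnegative.\<close>
  have K0: "K \<ge> 0" using K[of "\<lambda>u\<in>{0..}. 0"] restrict_in_paths[of "\<lambda>_. 0"] by force
  show ?thesis
  proof (rule Lim_null_comparison[THEN LIM_zero_cancel])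
    show "((\<lambda>t. 2 * K * (\<integral>\<omega>. \<bar>f (unit_scale t \<omega>) - f (restart (s / t) (unit_scale t \<omega>))\<bar> \<partial>P)) \<longlongrightarrow> 0) at_top"
      using tendsto_mult_right_zero[OF restart_L1[OF f s], of "2 * K"] by simp
    show "\<forall>\<^sub>F t in at_top. norm ((\<integral>\<omega>. Y \<omega> * f (unit_scale t \<omega>) \<partial>P) - expectation Y * (\<integral>\<omega>. f (unit_scale 1 \<omega>) \<partial>P))
      \<le> 2 * K * (\<integral>\<omega>. \<bar>f (unit_scale t \<omega>) - f (restart (s / t) (unit_scale t \<omega>))\<bar> \<partial>P)"
      using eventually_ge_at_top[of s]
    proof eventually_elim
      fix t assume t: "s \<le> t"
      then have t0: "t > 0" and r: "0 \<le> s / t" "s / t \<le> 1" using s by auto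
      let ?f = "\<lambda>\<omega>. f (unit_scale t \<omega>)" and ?g = "\<lambda>\<omega>. f (restart (s / t) (unit_scale t \<omega>))"
      have fP: "?f \<in> borel_measurable P" using measurable_test[OF f] t0 by simp
      have gP: "?g \<in> borel_measurable P"
        using t0 by (intro measurable_compose[OF measurable_unit_scale_P] measurable_compose[OF measurable_restart[OF r] fm]) simp
      have bf: "\<bar>?f \<omega>\<bar> \<le> C" and bg: "\<bar>?g \<omega>\<bar> \<le> C" if "\<omega> \<in> paths" for \<omega>
        using C(2) restart_in_C01[OF unit_scale_in_C01[OF that] r] unit_scale_in_C01[OF that] t0 by auto
      have i1: "integrable P (\<lambda>_. 1)" by simp
      have fi: "integrable P ?f" and gi: "integrable P ?g"
        using integrable_mult_bounded[OF i1 fP bf] integrable_mult_bounded[OF i1 gP bg] by simp_all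
      have Yf: "integrable P (\<lambda>\<omega>. Y \<omega> * ?f \<omega>)" and Yg: "integrable P (\<lambda>\<omega>. Y \<omega> * ?g \<omega>)"
        using integrable_mult_bounded[OF Yi fP bf] integrable_mult_bounded[OF Yi gP bg] by simp_all
      let ?D = "\<integral>\<omega>. \<bar>?f \<omega> - ?g \<omega>\<bar> \<partial>P"
      have 1: "\<bar>\<integral>\<omega>. (?f \<omega> - ?g \<omega>) * Y \<omega> \<partial>P\<bar> \<le> K * ?D"
        by (rule integral_mult_bounded_le) (use fi gi YP K in auto)
      have 2: "\<bar>\<integral>\<omega>. (?f \<omega> - ?g \<omega>) * 1 \<partial>P\<bar> \<le> 1 * ?D"
        by (rule integral_mult_bounded_le) (use fi gi in auto)
      have "\<bar>\<integral>\<omega>. 1 * Y \<omega> \<partial>P\<bar> \<le> K * (\<integral>\<omega>. \<bar>1\<bar> \<partial>P)"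
        by (rule integral_mult_bounded_le) (use YP K in auto)
      then have 3: "\<bar>\<integral>\<omega>. Y \<omega> \<partial>P\<bar> \<le> K" by (simp add: prob_space[simplified])
      have eq: "(\<integral>\<omega>. Y \<omega> * ?f \<omega> \<partial>P) - expectation Y * (\<integral>\<omega>. f (unit_scale 1 \<omega>) \<partial>P) =
          (\<integral>\<omega>. (?f \<omega> - ?g \<omega>) * Y \<omega> \<partial>P) - expectation Y * (\<integral>\<omega>. (?f \<omega> - ?g \<omega>) * 1 \<partial>P)"
        using restart_unit_scale_indep[OF f s t Y Yi] fi gi Yf Yg integral_unit_scale[OF t0 fm]
        by (simp add: algebra_simps)
      have "\<bar>expectation Y * (\<integral>\<omega>. (?f \<omega> - ?g \<omega>) * 1 \<partial>P)\<bar> \<le> K * ?D"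
        unfolding abs_mult using 2 3 K0 by (intro mult_mono) auto
      with 1 show "norm ((\<integral>\<omega>. Y \<omega> * ?f \<omega> \<partial>P) - expectation Y * (\<integral>\<omega>. f (unit_scale 1 \<omega>) \<partial>P)) \<le> 2 * K * ?D"
        unfolding eq real_norm_def by linarith
    qed
  qed
qed

text \<open>Since f is bounded by C, an L1 change of the weight is felt uniformly in t: exchanging Z
  for Y costs at most C * (e / (4 * C)) = e / 4 in each of the two terms, and e / 2 remains for the
  limit of Y.\<close>

lemma mixing_approx:
  assumes f: "bounded_continuous_C01 f" and Z: "integrable P Z"
    and approx: "\<And>e. e > 0 \<Longrightarrow> \<exists>Y. integrable P Y \<and> (\<integral>\<omega>. \<bar>Y \<omega> - Z \<omega>\<bar> \<partial>P) < e \<and>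
      ((\<lambda>t. \<integral>\<omega>. Y \<omega> * f (unit_scale t \<omega>) \<partial>P) \<longlongrightarrow> expectation Y * (\<integral>\<omega>. f (unit_scale 1 \<omega>) \<partial>P)) at_top"
  shows "((\<lambda>t. \<integral>\<omega>. Z \<omega> * f (unit_scale t \<omega>) \<partial>P) \<longlongrightarrow>
    expectation Z * (\<integral>\<omega>. f (unit_scale 1 \<omega>) \<partial>P)) at_top"
proof (rule tendstoI)
  fix e :: real assume e: "e > 0"
  obtain C where C: "C > 0" "\<And>x. x \<in> C01_set \<Longrightarrow> \<bar>f x\<bar> \<le> C"
    using bounded_continuous_C01_bound[OF f] by blast
  let ?E = "\<integral>\<omega>. f (unit_scale 1 \<omega>) \<partial>P"
  have bf: "\<bar>f (unit_scale t \<omega>)\<bar> \<le> C" if "\<omega> \<in> paths" "t \<ge> 0" for \<omega> t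
    using C(2) unit_scale_in_C01 that by simp
  have "\<bar>\<integral>\<omega>. 1 * f (unit_scale 1 \<omega>) \<partial>P\<bar> \<le> C * (\<integral>\<omega>. \<bar>1\<bar> \<partial>P)"
    by (rule integral_mult_bounded_le) (use measurable_test[OF f] bf in auto)
  then have E: "\<bar>?E\<bar> \<le> C" by (simp add: prob_space[simplified])
  obtain Y where Y: "integrable P Y" "(\<integral>\<omega>. \<bar>Y \<omega> - Z \<omega>\<bar> \<partial>P) < e / (4 * C)"
      "((\<lambda>t. \<integral>\<omega>. Y \<omega> * f (unit_scale t \<omega>) \<partial>P) \<longlongrightarrow> expectation Y * ?E) at_top"
    using approx[of "e / (4 * C)"] e C by auto
  let ?D = "\<integral>\<omega>. \<bar>Y \<omega> - Z \<omega>\<bar> \<partial>P"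
  have D: "C * ?D < e / 4" using Y(2) C(1) by (simp add: field_simps)
  have "\<forall>\<^sub>F t in at_top. dist (\<integral>\<omega>. Y \<omega> * f (unit_scale t \<omega>) \<partial>P) (expectation Y * ?E) < e / 2"
    using tendstoD[OF Y(3), of "e / 2"] e by simp
  with eventually_ge_at_top[of 0]
  show "\<forall>\<^sub>F t in at_top. dist (\<integral>\<omega>. Z \<omega> * f (unit_scale t \<omega>) \<partial>P) (expectation Z * ?E) < e"
  proof eventually_elim
    fix t :: real assume t: "0 \<le> t"
      and d: "dist (\<integral>\<omega>. Y \<omega> * f (unit_scale t \<omega>) \<partial>P) (expectation Y * ?E) < e / 2"
    have fm: "(\<lambda>\<omega>. f (unit_scale t \<omega>)) \<in> borel_measurable P" by (rule measurable_test[OF f t])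
    have "\<bar>\<integral>\<omega>. (Y \<omega> - Z \<omega>) * f (unit_scale t \<omega>) \<partial>P\<bar> \<le> C * ?D"
      by (rule integral_mult_bounded_le) (use Y Z fm bf t in auto)
    then have 1: "\<bar>(\<integral>\<omega>. Y \<omega> * f (unit_scale t \<omega>) \<partial>P) - (\<integral>\<omega>. Z \<omega> * f (unit_scale t \<omega>) \<partial>P)\<bar> \<le> C * ?D"
      using integrable_mult_bounded[OF Y(1) fm bf[OF _ t]] integrable_mult_bounded[OF Z fm bf[OF _ t]]
      by (simp add: left_diff_distrib)
    have "\<bar>\<integral>\<omega>. (Y \<omega> - Z \<omega>) * ?E \<partial>P\<bar> \<le> C * ?D"
      by (rule integral_mult_bounded_le) (use Y Z E in auto)
    then have 2: "\<bar>expectation Y * ?E - expectation Z * ?E\<bar> \<le> C * ?D"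
      using Y Z by (simp add: left_diff_distrib)
    show "dist (\<integral>\<omega>. Z \<omega> * f (unit_scale t \<omega>) \<partial>P) (expectation Z * ?E) < e"
      using 1 2 D d unfolding dist_real_def by linarith
  qed
qed

text \<open>Truncation at level n makes the weight bounded, keeps it adapted and converges in
  L1.\<close>

lemma mixing_adapted:
  assumes f: "bounded_continuous_C01 f" and s: "s > 0"
    and Y: "Y \<in> borel_measurable (path_filtration s)" "integrable P Y"
  shows "((\<lambda>t. \<integral>\<omega>. Y \<omega> * f (unit_scale t \<omega>) \<partial>P) \<longlongrightarrow>
    expectation Y * (\<integral>\<omega>. f (unit_scale 1 \<omega>) \<partial>P)) at_top"
proof (rule mixing_approx[OF f Y(2)])
  fix e :: real assume e: "e > 0"
  define T where "T n \<omega> = max (- real n) (min (real n) (Y \<omega>))" for n :: nat and \<omega>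
  have Tm: "T n \<in> borel_measurable (path_filtration s)" for n
    unfolding T_def using Y(1) by measurable
  have Ti: "integrable P (T n)" for n
    by (rule integrable_const_bound[of _ "real n"]) (use measurable_P[OF Tm[of n]] in \<open>auto simp: T_def\<close>)
  have "(\<lambda>n. \<integral>\<omega>. \<bar>T n \<omega> - Y \<omega>\<bar> \<partial>P) \<longlonglongrightarrow> (\<integral>\<omega>. 0 \<partial>P)"
  proof (rule integral_dominated_convergence[where w = "\<lambda>\<omega>. \<bar>Y \<omega>\<bar>"])
    show "(\<lambda>\<omega>. \<bar>T n \<omega> - Y \<omega>\<bar>) \<in> borel_measurable P" for n using Ti[of n] Y by measurable
    show "AE \<omega> in P. norm \<bar>T n \<omega> - Y \<omega>\<bar> \<le> \<bar>Y \<omega>\<bar>" for n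
      by (rule AE_I2) (auto simp: T_def max_def min_def)
    show "AE \<omega> in P. (\<lambda>n. \<bar>T n \<omega> - Y \<omega>\<bar>) \<longlonglongrightarrow> 0"
    proof (rule AE_I2)
      fix \<omega>
      have "\<forall>\<^sub>F n in sequentially. \<bar>T n \<omega> - Y \<omega>\<bar> = 0"
        using eventually_ge_at_top[of "nat \<lceil>\<bar>Y \<omega>\<bar>\<rceil>"]
      proof eventually_elim
        fix n assume "nat \<lceil>\<bar>Y \<omega>\<bar>\<rceil> \<le> n"
        then have "\<bar>Y \<omega>\<bar> \<le> real n" by linarith
        then show "\<bar>T n \<omega> - Y \<omega>\<bar> = 0" by (auto simp: T_def)
      qed
      then show "(\<lambda>n. \<bar>T n \<omega> - Y \<omega>\<bar>) \<longlonglongrightarrow> 0" by (rule tendsto_eventually)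
    qed
  qed (use Y in auto)
  then have "\<forall>\<^sub>F n in sequentially. (\<integral>\<omega>. \<bar>T n \<omega> - Y \<omega>\<bar> \<partial>P) < e"
    using order_tendstoD(2)[of _ 0 sequentially e] e by simp
  then obtain n where n: "(\<integral>\<omega>. \<bar>T n \<omega> - Y \<omega>\<bar> \<partial>P) < e" by (auto simp: eventually_sequentially)
  have "\<bar>T n \<omega>\<bar> \<le> real n" for \<omega> by (auto simp: T_def)
  from mixing_bounded[OF f s Tm this] n Ti
  show "\<exists>Y'. integrable P Y' \<and> (\<integral>\<omega>. \<bar>Y' \<omega> - Y \<omega>\<bar> \<partial>P) < e \<and>
      ((\<lambda>t. \<integral>\<omega>. Y' \<omega> * f (unit_scale t \<omega>) \<partial>P) \<longlongrightarrow> expectation Y' * (\<integral>\<omega>. f (unit_scale 1 \<omega>) \<partial>P)) at_top"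
    by blast
qed

text \<open>The family U enters twice: at one fixed large time it is an adapted approximation of Z,
  which gives mixing for Z; at the running time t it differs from Z by an error vanishing in L1,
  which transfers the limit to U t.\<close>

lemma
  assumes f: "bounded_continuous_C01 f" and Z: "integrable P Z"
    and U: "\<And>t. t > 0 \<Longrightarrow> U t \<in> borel_measurable (path_filtration t)" "\<And>t. t > 0 \<Longrightarrow> integrable P (U t)"
    and L1: "((\<lambda>t. \<integral>\<omega>. \<bar>U t \<omega> - Z \<omega>\<bar> \<partial>P) \<longlongrightarrow> 0) at_top"
  shows mixing_limit: "((\<lambda>t. \<integral>\<omega>. Z \<omega> * f (unit_scale t \<omega>) \<partial>P) \<longlongrightarrow>
      expectation Z * (\<integral>\<omega>. f (unit_scale 1 \<omega>) \<partial>P)) at_top"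
    and mixing_process: "((\<lambda>t. \<integral>\<omega>. U t \<omega> * f (unit_scale t \<omega>) \<partial>P) \<longlongrightarrow>
      expectation Z * (\<integral>\<omega>. f (unit_scale 1 \<omega>) \<partial>P)) at_top"
proof -
  show lim: "((\<lambda>t. \<integral>\<omega>. Z \<omega> * f (unit_scale t \<omega>) \<partial>P) \<longlongrightarrow>
      expectation Z * (\<integral>\<omega>. f (unit_scale 1 \<omega>) \<partial>P)) at_top"
  proof (rule mixing_approx[OF f Z])
    fix e :: real assume e: "e > 0"
    have "\<forall>\<^sub>F t in at_top. t > 0 \<and> (\<integral>\<omega>. \<bar>U t \<omega> - Z \<omega>\<bar> \<partial>P) < e"
      using order_tendstoD(2)[OF L1 e] eventually_gt_at_top[of 0] by eventually_elim simp
    then obtain t where t: "t > 0" "(\<integral>\<omega>. \<bar>U t \<omega> - Z \<omega>\<bar> \<partial>P) < e"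
      using eventually_happens'[OF trivial_limit_at_top_linorder] by blast
    from mixing_adapted[OF f t(1) U(1)[OF t(1)] U(2)[OF t(1)]] t U(2)
    show "\<exists>Y. integrable P Y \<and> (\<integral>\<omega>. \<bar>Y \<omega> - Z \<omega>\<bar> \<partial>P) < e \<and>
      ((\<lambda>t. \<integral>\<omega>. Y \<omega> * f (unit_scale t \<omega>) \<partial>P) \<longlongrightarrow> expectation Y * (\<integral>\<omega>. f (unit_scale 1 \<omega>) \<partial>P)) at_top"
      by blast
  qed
  obtain C where C: "C > 0" "\<And>x. x \<in> C01_set \<Longrightarrow> \<bar>f x\<bar> \<le> C"
    using bounded_continuous_C01_bound[OF f] by blast
  have "((\<lambda>t. (\<integral>\<omega>. U t \<omega> * f (unit_scale t \<omega>) \<partial>P) - (\<integral>\<omega>. Z \<omega> * f (unit_scale t \<omega>) \<partial>P)) \<longlongrightarrow> 0) at_top"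
  proof (rule Lim_null_comparison)
    show "((\<lambda>t. C * (\<integral>\<omega>. \<bar>U t \<omega> - Z \<omega>\<bar> \<partial>P)) \<longlongrightarrow> 0) at_top"
      by (rule tendsto_mult_right_zero[OF L1])
    show "\<forall>\<^sub>F t in at_top. norm ((\<integral>\<omega>. U t \<omega> * f (unit_scale t \<omega>) \<partial>P) - (\<integral>\<omega>. Z \<omega> * f (unit_scale t \<omega>) \<partial>P))
        \<le> C * (\<integral>\<omega>. \<bar>U t \<omega> - Z \<omega>\<bar> \<partial>P)"
      using eventually_gt_at_top[of 0]
    proof eventually_elim
      fix t :: real assume t: "t > 0"
      have fm: "(\<lambda>\<omega>. f (unit_scale t \<omega>)) \<in> borel_measurable P" using t by (intro measurable_test[OF f]) simp
      have bf: "\<bar>f (unit_scale t \<omega>)\<bar> \<le> C" if "\<omega> \<in> paths" for \<omega>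
        using C(2) unit_scale_in_C01 that t by simp
      have "\<bar>\<integral>\<omega>. (U t \<omega> - Z \<omega>) * f (unit_scale t \<omega>) \<partial>P\<bar> \<le> C * (\<integral>\<omega>. \<bar>U t \<omega> - Z \<omega>\<bar> \<partial>P)"
        by (rule integral_mult_bounded_le) (use U(2)[OF t] Z fm bf in auto)
      then show "norm ((\<integral>\<omega>. U t \<omega> * f (unit_scale t \<omega>) \<partial>P) - (\<integral>\<omega>. Z \<omega> * f (unit_scale t \<omega>) \<partial>P))
        \<le> C * (\<integral>\<omega>. \<bar>U t \<omega> - Z \<omega>\<bar> \<partial>P)"
        using integrable_mult_bounded[OF U(2)[OF t] fm bf] integrable_mult_bounded[OF Z fm bf]
        by (simp add: left_diff_distrib)
    qed
  qed
  from tendsto_add[OF this lim]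
  show "((\<lambda>t. \<integral>\<omega>. U t \<omega> * f (unit_scale t \<omega>) \<partial>P) \<longlongrightarrow>
      expectation Z * (\<integral>\<omega>. f (unit_scale 1 \<omega>) \<partial>P)) at_top" by simp
qed

end

section \<open>Gibbs measures as tilted Brownian motions with drift\<close>

definition gap_exp :: "real \<Rightarrow> real \<Rightarrow> real \<Rightarrow> (real \<Rightarrow> real) \<Rightarrow> real" where
  "gap_exp \<nu> c t \<omega> = exp (\<nu> * (running_sup t (drift c \<omega>) - drift c \<omega> t))"

lemma gap_exp_pos [simp]: "0 < gap_exp \<nu> c t \<omega>" "0 \<le> gap_exp \<nu> c t \<omega>"
  by (simp_all add: gap_exp_def)

lemma drift_eval: "0 \<le> t \<Longrightarrow> drift b \<omega> t = \<omega> t + b * t"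
  by (simp add: drift_def)

text \<open>The reversed path with drift -c at time u is the original path with drift c at time t -
  u, minus its value at t. Its maximum is therefore the distance of the endpoint from the
  maximum.\<close>

lemma gap_exp_backward:
  assumes \<omega>: "\<omega> \<in> paths" and t: "t \<ge> 0"
  shows "sup_exp \<nu> (-c) t (backward t \<omega>) = gap_exp \<nu> c t \<omega>"
proof -
  let ?\<eta> = "drift (-c) (backward t \<omega>)"
  have \<eta>: "?\<eta> \<in> paths" using \<omega> by (simp add: drift_in_paths backward_in_paths)
  have p: "drift c \<omega> \<in> paths" using \<omega> by (rule drift_in_paths)
  have eq: "?\<eta> u = drift c \<omega> (t - u) - drift c \<omega> t" if "0 \<le> u" "u \<le> t" for u
    using that by (simp add: drift_def backward_def max_def algebra_simps)
  have "running_sup t ?\<eta> \<le> running_sup t (drift c \<omega>) - drift c \<omega> t"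
  proof (rule running_sup_least[OF t])
    fix u assume u: "0 \<le> u" "u \<le> t"
    then show "?\<eta> u \<le> running_sup t (drift c \<omega>) - drift c \<omega> t"
      using running_sup_upper[OF p, of "t - u" t] eq[OF u] by simp
  qed
  moreover have "running_sup t (drift c \<omega>) \<le> running_sup t ?\<eta> + drift c \<omega> t"
  proof (rule running_sup_least[OF t])
    fix u assume u: "0 \<le> u" "u \<le> t"
    then show "drift c \<omega> u \<le> running_sup t ?\<eta> + drift c \<omega> t"
      using running_sup_upper[OF \<eta>, of "t - u" t] eq[of "t - u"] by simp
  qed
  ultimately have "running_sup t ?\<eta> = running_sup t (drift c \<omega>) - drift c \<omega> t" by simp
  then show ?thesis unfolding sup_exp_def gap_exp_def by simp
qed

text \<open>Time reversal on the unit interval. Composed with the test function, it compensates for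
  the reversal of the path underneath the weight.\<close>

definition reflect :: "(real \<Rightarrow> real) \<Rightarrow> real \<Rightarrow> real" where
  "reflect x = (\<lambda>v\<in>{0..1}. x (1 - v) - x 1)"

lemma reflect_in_C01: "x \<in> C01_set \<Longrightarrow> reflect x \<in> C01_set"
  unfolding reflect_def
  by (intro restrict_in_C01_set continuous_intros continuous_on_compose2[OF C01_set_continuous_on[of x "{0..1}"]]) auto

lemma reflect_unit_scale_backward:
  assumes "t > 0" "\<omega> 0 = 0"
  shows "reflect (unit_scale t (backward t \<omega>)) = unit_scale t \<omega>"
proof
  fix v
  show "reflect (unit_scale t (backward t \<omega>)) v = unit_scale t \<omega> v"
  proof (cases "v \<in> {0..1}")
    case True
    have "max 0 (t - (1 - v) * t) = v * t" using True assms by (simp add: algebra_simps)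
    then show ?thesis
      using True assms by (simp add: reflect_def unit_scale_def backward_def diff_divide_distrib)
  qed (auto simp: reflect_def unit_scale_def)
qed

text \<open>\<open>reflect\<close> is 2-Lipschitz for the supremum distance, since two evaluations
  enter each of its values.\<close>

lemma bounded_continuous_C01_reflect:
  assumes f: "bounded_continuous_C01 f"
  shows "bounded_continuous_C01 (\<lambda>x. f (reflect x))"
proof -
  have dist: "dist01 (reflect x) (reflect y) \<le> 2 * dist01 x y" if "x \<in> C01_set" "y \<in> C01_set" for x y
  proof -
    have le: "\<bar>x s - y s\<bar> \<le> dist01 x y" if "s \<in> {0..1}" for s
      using dist01_le_iff[OF \<open>x \<in> C01_set\<close> \<open>y \<in> C01_set\<close>, of "dist01 x y"] that by simp
    have "\<bar>reflect x v - reflect y v\<bar> \<le> 2 * dist01 x y" if v: "v \<in> {0..1}" for v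
    proof -
      have "\<bar>x (1 - v) - y (1 - v)\<bar> \<le> dist01 x y" "\<bar>x 1 - y 1\<bar> \<le> dist01 x y"
        using le v by auto
      moreover have "reflect x v - reflect y v = (x (1 - v) - y (1 - v)) - (x 1 - y 1)"
        using v by (simp add: reflect_def)
      ultimately show ?thesis by linarith
    qed
    then show ?thesis
      using dist01_le_iff[OF reflect_in_C01 reflect_in_C01, OF that, of "2 * dist01 x y"] by blast
  qed
  have cont: "continuous_map C01 C01 reflect"
    unfolding continuous_map_def
  proof (intro conjI allI impI)
    show "reflect \<in> topspace C01 \<rightarrow> topspace C01" by (auto simp: reflect_in_C01)
    fix U assume U: "openin C01 U"
    show "openin C01 {x \<in> topspace C01. reflect x \<in> U}"
      unfolding openin_C01
    proof (intro conjI ballI)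
      fix x assume "x \<in> {x \<in> topspace C01. reflect x \<in> U}"
      then have x: "x \<in> C01_set" "reflect x \<in> U" by auto
      obtain e where e: "e > 0" "\<And>y. y \<in> C01_set \<Longrightarrow> dist01 (reflect x) y < e \<Longrightarrow> y \<in> U"
        using U x(2) unfolding openin_C01 by blast
      show "\<exists>d>0. \<forall>y\<in>C01_set. dist01 x y < d \<longrightarrow> y \<in> {x \<in> topspace C01. reflect x \<in> U}"
      proof (intro exI[of _ "e / 2"] conjI ballI impI)
        fix y assume y: "y \<in> C01_set" "dist01 x y < e / 2"
        have "dist01 (reflect x) (reflect y) < e" using dist[OF x(1) y(1)] y(2) by linarith
        then show "y \<in> {x \<in> topspace C01. reflect x \<in> U}"
          using e(2)[OF reflect_in_C01[OF y(1)]] y(1) by simp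
      qed (use e in simp)
    qed auto
  qed
  have "continuous_map C01 euclideanreal (f \<circ> reflect)"
    using f by (intro continuous_map_compose[OF cont]) (simp add: bounded_continuous_C01_def)
  moreover have "(\<lambda>x. f (reflect x)) ` C01_set \<subseteq> f ` C01_set" using reflect_in_C01 by auto
  ultimately show ?thesis
    using f unfolding bounded_continuous_C01_def by (auto simp: o_def intro: bounded_subset)
qed

lemma rescaled_drift: "t \<ge> 0 \<Longrightarrow> rescaled b t (drift b \<omega>) = unit_scale t \<omega>"
  by (auto simp: rescaled_def unit_scale_def drift_def fun_eq_iff)

lemma measurable_rescaled:
  assumes t: "t \<ge> 0"
  shows "rescaled b t \<in> path_filtration t \<rightarrow>\<^sub>M borel_of C01"
proof (rule measurable_C01I)
  show "rescaled b t \<omega> \<in> C01_set" if "\<omega> \<in> space (path_filtration t)" for \<omega>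
    unfolding rescaled_def divide_inverse using that t
    by (intro restrict_in_C01_set continuous_intros continuous_on_compose2[OF paths_continuous_on[of \<omega> "{0..}"]]) auto
  fix s :: real assume s: "0 \<le> s" "s \<le> 1"
  then have "(\<lambda>\<omega>. rescaled b t \<omega> s) = (\<lambda>\<omega>. (\<omega> (s * t) - b * t * s) / sqrt t)" by (simp add: rescaled_def)
  moreover have "(\<lambda>\<omega>. (\<omega> (s * t) - b * t * s) / sqrt t) \<in> borel_measurable (path_filtration t)"
    using s t by (intro borel_measurable_divide borel_measurable_diff measurable_eval borel_measurable_const)
      (auto simp: mult_left_le_one_le)
  ultimately show "(\<lambda>\<omega>. rescaled b t \<omega> s) \<in> borel_measurable (path_filtration t)" by simp
qed

context wiener
begin

lemma paths_in_sets_P [simp]: "paths \<in> sets P"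
  using sets.top[of P] by simp

lemma measurable_drift_P: "drift b \<in> P \<rightarrow>\<^sub>M path_sigma"
proof (rule measurable_path_sigmaI)
  show "drift b \<omega> \<in> paths" if "\<omega> \<in> space P" for \<omega> using that by (simp add: drift_in_paths)
  fix s :: real assume "0 \<le> s"
  then show "(\<lambda>\<omega>. drift b \<omega> s) \<in> borel_measurable P"
    using measurable_compose[OF measurable_P[OF measurable_drift] measurable_eval[of s s]] by simp
qed

text \<open>The centring in \<open>rescaled b t\<close> undoes \<open>drift b\<close> and leaves
  \<open>unit_scale t\<close>. Agreement on \<open>path_filtration t\<close> is enough, because the
  rescaled path is measurable with respect to it.\<close>

lemma rescaled_law_eq:
  assumes t: "t \<ge> 0" and sets: "sets Q = sets P" "sets D = sets P"
    and eq: "\<And>\<Lambda>. \<Lambda> \<in> sets (path_filtration t) \<Longrightarrow> emeasure Q \<Lambda> = emeasure D (drift b -` \<Lambda> \<inter> paths)"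
  shows "rescaled_law Q b t = distr D (borel_of C01) (unit_scale t)"
proof (rule measure_eqI)
  show "sets (rescaled_law Q b t) = sets (distr D (borel_of C01) (unit_scale t))"
    by (simp add: rescaled_law_def)
  fix A assume "A \<in> sets (rescaled_law Q b t)"
  then have A: "A \<in> sets (borel_of C01)" by (simp add: rescaled_law_def)
  have sp: "space Q = paths" "space D = paths"
    using sets_eq_imp_space_eq[OF sets(1)] sets_eq_imp_space_eq[OF sets(2)] by simp_all
  have sub: "subalgebra Q (path_filtration t)"
    unfolding subalgebra_def using path_filtration_subset sp sets sets_P by auto
  let ?R = "restr_to_subalg Q (path_filtration t)"
  have spR: "space ?R = paths" using sp by (simp add: space_restr_to_subalg)
  have L: "rescaled b t -` A \<inter> paths \<in> sets (path_filtration t)"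
    using measurable_sets[OF measurable_rescaled[OF t] A, of b] by simp
  have "rescaled b t \<in> ?R \<rightarrow>\<^sub>M borel_of C01"
    using measurable_rescaled[OF t] unfolding measurable_cong_sets[OF sets_restr_to_subalg[OF sub] refl] .
  then have "emeasure (rescaled_law Q b t) A = emeasure ?R (rescaled b t -` A \<inter> paths)"
    unfolding rescaled_law_def using A by (simp add: emeasure_distr spR)
  also have "\<dots> = emeasure Q (rescaled b t -` A \<inter> paths)"
    by (rule emeasure_restr_to_subalg[OF sub L])
  also have "\<dots> = emeasure D (drift b -` (rescaled b t -` A \<inter> paths) \<inter> paths)"
    by (rule eq[OF L])
  also have "drift b -` (rescaled b t -` A \<inter> paths) \<inter> paths = unit_scale t -` A \<inter> space D"
    using t by (auto simp: sp drift_in_paths rescaled_drift)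
  also have "emeasure D (unit_scale t -` A \<inter> space D) = emeasure (distr D (borel_of C01) (unit_scale t)) A"
    using measurable_unit_scale_P[OF t] A
    by (subst emeasure_distr) (auto simp: measurable_cong_sets[OF sets(2) refl])
  finally show "emeasure (rescaled_law Q b t) A = emeasure (distr D (borel_of C01) (unit_scale t)) A" .
qed

section \<open>Weak convergence as a limit of weighted expectations\<close>

lemma measure_density_real:
  assumes "integrable P V" "\<And>\<omega>. V \<omega> \<ge> 0" "A \<in> sets P"
  shows "measure (density P (\<lambda>\<omega>. ennreal (V \<omega>))) A = (\<integral>\<omega>. V \<omega> * indicator A \<omega> \<partial>P)"
proof -
  have "emeasure (density P (\<lambda>\<omega>. ennreal (V \<omega>))) A = (\<integral>\<^sup>+\<omega>. ennreal (V \<omega> * indicator A \<omega>) \<partial>P)"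
    using assms by (subst emeasure_density) (auto intro!: nn_integral_cong simp: indicator_def)
  also have "\<dots> = ennreal (\<integral>\<omega>. V \<omega> * indicator A \<omega> \<partial>P)"
    using assms by (intro nn_integral_eq_integral integrable_real_mult_indicator) auto
  finally show ?thesis
    using assms by (simp add: measure_def integral_nonneg_AE)
qed

lemma prob_space_density_real:
  assumes "integrable P V" "\<And>\<omega>. V \<omega> \<ge> 0" "expectation V = 1"
  shows "prob_space (density P (\<lambda>\<omega>. ennreal (V \<omega>)))"
proof (rule prob_spaceI)
  have "emeasure (density P (\<lambda>\<omega>. ennreal (V \<omega>))) (space P) = (\<integral>\<^sup>+\<omega>. ennreal (V \<omega>) \<partial>P)"
    using assms by (subst emeasure_density) (auto intro!: nn_integral_cong)
  also have "\<dots> = 1" using assms by (subst nn_integral_eq_integral) auto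
  finally show "emeasure (density P (\<lambda>\<omega>. ennreal (V \<omega>))) (space (density P (\<lambda>\<omega>. ennreal (V \<omega>)))) = 1" by simp
qed

text \<open>The approximating laws are images of densities with respect to \<open>P\<close>, and the
  limit is the law of \<open>unit_scale 1\<close> under \<open>P\<close>; weak convergence thus
  becomes a statement about weighted expectations under \<open>P\<close> alone.\<close>

lemma weakly_converges_density:
  assumes W: "standard_BM {0..1} N W"
    and law: "\<And>t. t > 0 \<Longrightarrow> R t = distr (density P (\<lambda>\<omega>. ennreal (V t \<omega>))) (borel_of C01) (unit_scale t)"
    and V: "\<And>t. t > 0 \<Longrightarrow> integrable P (V t)" "\<And>t \<omega>. V t \<omega> \<ge> 0" "\<And>t. t > 0 \<Longrightarrow> expectation (V t) = 1"
    and lim: "\<And>f. bounded_continuous_C01 f \<Longrightarrow>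
      ((\<lambda>t. \<integral>\<omega>. V t \<omega> * f (unit_scale t \<omega>) \<partial>P) \<longlongrightarrow> (\<integral>\<omega>. f (unit_scale 1 \<omega>) \<partial>P)) at_top"
  shows "weakly_converges C01 R (law_on_C01 N W) at_top"
  unfolding weakly_converges_def
proof (intro conjI allI impI)
  have um: "unit_scale t \<in> density P g \<rightarrow>\<^sub>M borel_of C01" if "t > 0" for t g
    using measurable_unit_scale_P[of t] that by simp
  have "prob_space (R t) \<and> sets (R t) = sets (borel_of C01)" if t: "t > 0" for t
    unfolding law[OF t] using prob_space_density_real[OF V(1,2,3)] t um[OF t]
    by (auto intro!: prob_space.prob_space_distr)
  then show "\<forall>\<^sub>F t in at_top. prob_space (R t) \<and> sets (R t) = sets (borel_of C01)"
    by (intro eventually_mono[OF eventually_gt_at_top[of 0]]) blast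
  have l1: "law_on_C01 N W = distr P (borel_of C01) (unit_scale 1)"
    by (rule distr_unit_scale[OF _ W, symmetric]) simp
  have m1: "unit_scale 1 \<in> P \<rightarrow>\<^sub>M borel_of C01" by (rule measurable_unit_scale_P) simp
  show "prob_space (law_on_C01 N W)" unfolding l1 by (rule prob_space_distr[OF m1])
  show "sets (law_on_C01 N W) = sets (borel_of C01)" unfolding l1 by simp
  fix f assume f': "continuous_map C01 euclideanreal f \<and> bounded (f ` topspace C01)"
  then have f: "bounded_continuous_C01 f" by (simp add: bounded_continuous_C01_def)
  have fm: "f \<in> borel_measurable (borel_of C01)" by (rule bounded_continuous_C01_measurable[OF f])
  have "(\<integral>x. f x \<partial>law_on_C01 N W) = (\<integral>\<omega>. f (unit_scale 1 \<omega>) \<partial>P)"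
    unfolding l1 by (rule integral_distr[OF m1 fm])
  moreover have "((\<lambda>t. \<integral>x. f x \<partial>R t) \<longlongrightarrow> (\<integral>\<omega>. f (unit_scale 1 \<omega>) \<partial>P)) at_top"
  proof (rule Lim_transform_eventually[OF lim[OF f]])
    show "\<forall>\<^sub>F t in at_top. (\<integral>\<omega>. V t \<omega> * f (unit_scale t \<omega>) \<partial>P) = (\<integral>x. f x \<partial>R t)"
      using eventually_gt_at_top[of 0]
    proof eventually_elim
      fix t :: real assume t: "t > 0"
      have "(\<integral>x. f x \<partial>R t) = (\<integral>\<omega>. f (unit_scale t \<omega>) \<partial>density P (\<lambda>\<omega>. ennreal (V t \<omega>)))"
        unfolding law[OF t] by (rule integral_distr[OF um[OF t] fm])
      also have "\<dots> = (\<integral>\<omega>. V t \<omega> *\<^sub>R f (unit_scale t \<omega>) \<partial>P)"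
        using V(1)[OF t] V(2) t measurable_test[OF f, of t] by (intro integral_density) auto
      finally show "(\<integral>\<omega>. V t \<omega> * f (unit_scale t \<omega>) \<partial>P) = (\<integral>x. f x \<partial>R t)" by simp
    qed
  qed
  ultimately show "((\<lambda>t. \<integral>x. f x \<partial>R t) \<longlongrightarrow> (\<integral>x. f x \<partial>law_on_C01 N W)) at_top" by simp
qed

text \<open>Girsanov's formula with drift b removes b from the linear coefficient h and leaves the
  deterministic factor exp (b^2 * t / 2). The number k is a slot for the normalizing
  constant.\<close>

lemma gibbs_girsanov:
  assumes t: "t > 0" and H: "H \<in> borel_measurable (path_filtration t)"
  shows "(\<integral>\<^sup>+\<omega>. ennreal (exp (\<nu> * running_sup t \<omega> + h * \<omega> t) * k) * H \<omega> \<partial>P) =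
    (\<integral>\<^sup>+\<omega>. ennreal (exp (b\<^sup>2 * t / 2) * exp (\<nu> * running_sup t (drift b \<omega>) + (h - b) * drift b \<omega> t) * k) * H (drift b \<omega>) \<partial>P)"
proof -
  let ?H = "\<lambda>\<omega>. ennreal (exp (b\<^sup>2 * t / 2) * exp (\<nu> * running_sup t \<omega> + (h - b) * \<omega> t) * k) * H \<omega>"
  have [measurable]: "running_sup t \<in> borel_measurable (path_filtration t)" "(\<lambda>\<omega>. \<omega> t) \<in> borel_measurable (path_filtration t)"
    using t by (auto intro: measurable_running_sup measurable_eval)
  note [measurable] = H
  have "?H \<in> borel_measurable (path_filtration t)" by measurable
  from girsanov[OF t this, of b]
  have "(\<integral>\<^sup>+\<omega>. ?H (drift b \<omega>) \<partial>P) = (\<integral>\<^sup>+\<omega>. ennreal (exp (b * \<omega> t - b\<^sup>2 * t / 2)) * ?H \<omega> \<partial>P)" .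
  also have "\<dots> = (\<integral>\<^sup>+\<omega>. ennreal (exp (\<nu> * running_sup t \<omega> + h * \<omega> t) * k) * H \<omega> \<partial>P)"
  proof (rule nn_integral_cong)
    fix \<omega>
    let ?x = "exp (b * \<omega> t - b\<^sup>2 * t / 2)"
    let ?y = "exp (b\<^sup>2 * t / 2) * exp (\<nu> * running_sup t \<omega> + (h - b) * \<omega> t) * k"
    have "?x * exp (b\<^sup>2 * t / 2) * exp (\<nu> * running_sup t \<omega> + (h - b) * \<omega> t) =
        exp ((b * \<omega> t - b\<^sup>2 * t / 2) + b\<^sup>2 * t / 2 + (\<nu> * running_sup t \<omega> + (h - b) * \<omega> t))"
      by (simp only: exp_add)
    also have "(b * \<omega> t - b\<^sup>2 * t / 2) + b\<^sup>2 * t / 2 + (\<nu> * running_sup t \<omega> + (h - b) * \<omega> t) =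
        \<nu> * running_sup t \<omega> + h * \<omega> t"
      by (simp add: algebra_simps)
    finally have "?x * ?y = exp (\<nu> * running_sup t \<omega> + h * \<omega> t) * k"
      by (simp only: mult.assoc[symmetric])
    moreover have "ennreal ?x * (ennreal ?y * H \<omega>) = ennreal (?x * ?y) * H \<omega>"
      by (simp only: ennreal_mult'[OF exp_ge_zero] mult.assoc)
    ultimately show "ennreal (exp (b * \<omega> t - b\<^sup>2 * t / 2)) * ?H \<omega> =
        ennreal (exp (\<nu> * running_sup t \<omega> + h * \<omega> t) * k) * H \<omega>"
      by (simp only:)
  qed
  finally show ?thesis ..
qed

text \<open>The factor exp (b^2 * t / 2) occurs both in the numerator and in the normalizing
  constant and cancels. The drift b stays free here and is chosen in
  \<open>emeasure_gibbs_gap\<close> and \<open>emeasure_gibbs_sup\<close>.\<close>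

lemma emeasure_gibbs_drift:
  assumes t: "t > 0" and L: "\<Lambda> \<in> sets (path_filtration t)"
    and Y: "Y = (\<lambda>\<omega>. exp (\<nu> * running_sup t (drift b \<omega>) + (h - b) * drift b \<omega> t))"
    and int: "integrable P Y" and y: "y = expectation Y" "y > 0"
  shows "emeasure (gibbs P \<nu> h t) \<Lambda> = emeasure (density P (\<lambda>\<omega>. ennreal (Y \<omega> / y))) (drift b -` \<Lambda> \<inter> paths)"
proof -
  let ?g = "\<lambda>\<omega>. exp (\<nu> * running_sup t \<omega> + h * \<omega> t)"
  let ?e = "exp (b\<^sup>2 * t / 2)"
  have [measurable]: "running_sup t \<in> borel_measurable P" "(\<lambda>\<omega>. \<omega> t) \<in> borel_measurable P"
    using t by (auto intro: measurable_P[OF measurable_running_sup] measurable_eval_P)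
  have LP [measurable]: "\<Lambda> \<in> sets P" using L path_filtration_subset sets_P by auto
  have dL: "drift b -` \<Lambda> \<inter> paths \<in> sets P"
    using measurable_sets[OF measurable_P[OF measurable_drift] L, of b] by simp
  have Ym: "Y \<in> borel_measurable P" using int by simp
  have "(\<integral>\<^sup>+\<omega>. ennreal (?g \<omega>) \<partial>P) = (\<integral>\<^sup>+\<omega>. ennreal (?e * Y \<omega>) \<partial>P)"
    using gibbs_girsanov[OF t, of "\<lambda>_. 1" \<nu> h 1 b] by (simp add: Y)
  also have "\<dots> = ennreal (?e * y)"
    using int by (subst nn_integral_eq_integral) (auto simp: y(1) Y)
  finally have c: "(\<integral>\<^sup>+\<omega>. ennreal (?g \<omega>) \<partial>P) = ennreal (?e * y)" .
  have "emeasure (gibbs P \<nu> h t) \<Lambda> = (\<integral>\<^sup>+\<omega>. ennreal (?g \<omega>) / ennreal (?e * y) * indicator \<Lambda> \<omega> \<partial>P)"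
    unfolding gibbs_def c by (rule emeasure_density) measurable
  also have "\<dots> = (\<integral>\<^sup>+\<omega>. ennreal (?g \<omega> * (1 / (?e * y))) * indicator \<Lambda> \<omega> \<partial>P)"
    using y(2) by (simp add: divide_ennreal)
  also have "\<dots> = (\<integral>\<^sup>+\<omega>. ennreal (?e * Y \<omega> * (1 / (?e * y))) * indicator \<Lambda> (drift b \<omega>) \<partial>P)"
    using gibbs_girsanov[OF t, of "indicator \<Lambda>" \<nu> h "1 / (?e * y)" b] L by (simp add: Y)
  also have "\<dots> = (\<integral>\<^sup>+\<omega>. ennreal (Y \<omega> / y) * indicator (drift b -` \<Lambda> \<inter> paths) \<omega> \<partial>P)"
    by (intro nn_integral_cong) (auto simp: indicator_def)
  also have "\<dots> = emeasure (density P (\<lambda>\<omega>. ennreal (Y \<omega> / y))) (drift b -` \<Lambda> \<inter> paths)"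
    using dL Ym by (intro emeasure_density[symmetric]) auto
  finally show ?thesis .
qed

lemma sets_gibbs: "sets (gibbs P \<nu> h t) = sets P"
  by (simp add: gibbs_def)

section \<open>Time reversal of weights and test functions\<close>

lemma
  assumes t: "t > 0" and H: "H \<in> borel_measurable (path_filtration t)"
  shows integral_backward: "(\<integral>\<omega>. H (backward t \<omega>) \<partial>P) = (\<integral>\<omega>. H \<omega> \<partial>P :: real)"
    and integrable_backward: "integrable P H \<Longrightarrow> integrable P (\<lambda>\<omega>. H (backward t \<omega>))"
proof -
  have bm: "backward t \<in> P \<rightarrow>\<^sub>M path_filtration t" using t by (intro measurable_backward) simp
  have im: "(\<lambda>\<omega>. \<omega>) \<in> P \<rightarrow>\<^sub>M path_filtration t" by (rule measurable_P[of _ t]) simp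
  show "(\<integral>\<omega>. H (backward t \<omega>) \<partial>P) = expectation H"
    using integral_distr[OF bm H] integral_distr[OF im H] distr_backward[OF t] by simp
  assume "integrable P H"
  then have "integrable (distr P (path_filtration t) (\<lambda>\<omega>. \<omega>)) H"
    by (subst integrable_distr_eq[OF im H])
  then show "integrable P (\<lambda>\<omega>. H (backward t \<omega>))"
    unfolding distr_backward[OF t, symmetric] by (rule integrable_distr[OF bm])
qed

lemma measurable_gap_exp:
  assumes "0 \<le> t"
  shows "gap_exp \<nu> c t \<in> borel_measurable (path_filtration t)"
proof -
  have [measurable]: "(\<lambda>\<omega>. running_sup t (drift c \<omega>)) \<in> borel_measurable (path_filtration t)"
    "(\<lambda>\<omega>. drift c \<omega> t) \<in> borel_measurable (path_filtration t)"
    using measurable_compose[OF measurable_drift measurable_running_sup]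
      measurable_compose[OF measurable_drift measurable_eval] assms by auto
  show ?thesis unfolding gap_exp_def by measurable
qed

lemma
  assumes t: "t > 0"
  shows integrable_gap_exp: "integrable P (gap_exp \<nu> c t)"
    and integral_gap_exp: "expectation (gap_exp \<nu> c t) = sup_mgf \<nu> (-c) t"
proof -
  have m: "sup_exp \<nu> (-c) t \<in> borel_measurable (path_filtration t)" using t by (intro measurable_sup_exp) simp
  have eq: "sup_exp \<nu> (-c) t (backward t \<omega>) = gap_exp \<nu> c t \<omega>" if "\<omega> \<in> space P" for \<omega>
    using that t by (intro gap_exp_backward) auto
  have "integrable P (\<lambda>\<omega>. sup_exp \<nu> (-c) t (backward t \<omega>))"
    using t by (intro integrable_backward[OF t m] integrable_sup_exp) simp
  moreover have "integrable P (\<lambda>\<omega>. sup_exp \<nu> (-c) t (backward t \<omega>)) \<longleftrightarrow> integrable P (gap_exp \<nu> c t)"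
    by (rule Bochner_Integration.integrable_cong[OF refl eq])
  ultimately show "integrable P (gap_exp \<nu> c t)" by simp
  have "expectation (gap_exp \<nu> c t) = (\<integral>\<omega>. sup_exp \<nu> (-c) t (backward t \<omega>) \<partial>P)"
    by (intro Bochner_Integration.integral_cong refl) (simp add: eq)
  also have "\<dots> = sup_mgf \<nu> (-c) t"
    unfolding sup_mgf_def by (rule integral_backward[OF t m])
  finally show "expectation (gap_exp \<nu> c t) = sup_mgf \<nu> (-c) t" .
qed

text \<open>Invariance under \<open>backward t\<close> turns the gap weight into the maximum weight
  and composes the test function with \<open>reflect\<close>. The pathwise identity needs a path
  from 0, hence holds almost surely.\<close>

lemma integral_gap_exp_test:
  assumes t: "t > 0" and f: "bounded_continuous_C01 f"
  shows "(\<integral>\<omega>. gap_exp \<nu> c t \<omega> * f (unit_scale t \<omega>) \<partial>P) =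
    (\<integral>\<omega>. sup_exp \<nu> (-c) t \<omega> * f (reflect (unit_scale t \<omega>)) \<partial>P)"
proof -
  let ?H = "\<lambda>\<omega>. sup_exp \<nu> (-c) t \<omega> * f (reflect (unit_scale t \<omega>))"
  have fr: "bounded_continuous_C01 (\<lambda>x. f (reflect x))" by (rule bounded_continuous_C01_reflect[OF f])
  have H: "?H \<in> borel_measurable (path_filtration t)"
    using t by (intro borel_measurable_times measurable_sup_exp
        measurable_compose[OF measurable_unit_scale bounded_continuous_C01_measurable[OF fr]]) auto
  have "(\<integral>\<omega>. gap_exp \<nu> c t \<omega> * f (unit_scale t \<omega>) \<partial>P) = (\<integral>\<omega>. ?H (backward t \<omega>) \<partial>P)"
  proof (rule integral_cong_AE)
    show "(\<lambda>\<omega>. gap_exp \<nu> c t \<omega> * f (unit_scale t \<omega>)) \<in> borel_measurable P"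
      using t by (intro borel_measurable_times measurable_P[OF measurable_gap_exp] measurable_test[OF f]) auto
    show "(\<lambda>\<omega>. ?H (backward t \<omega>)) \<in> borel_measurable P"
      using t by (intro measurable_compose[OF measurable_backward H]) simp
    show "AE \<omega> in P. gap_exp \<nu> c t \<omega> * f (unit_scale t \<omega>) = ?H (backward t \<omega>)"
      using start_0 AE_space
      by eventually_elim (use t in \<open>simp add: gap_exp_backward reflect_unit_scale_backward\<close>)
  qed
  then show ?thesis using integral_backward[OF t H] by simp
qed

text \<open>The case \<nu> = 0 of \<open>integral_gap_exp_test\<close>, where both weights are 1:
  reflection does not change the mean of a test function under the limit law.\<close>

lemma integral_reflect:
  assumes f: "bounded_continuous_C01 f"
  shows "(\<integral>\<omega>. f (reflect (unit_scale 1 \<omega>)) \<partial>P) = (\<integral>\<omega>. f (unit_scale 1 \<omega>) \<partial>P)"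
  using integral_gap_exp_test[OF _ f, of 1 0 0] by (simp add: gap_exp_def sup_exp_def)

section \<open>Weak convergence\<close>

text \<open>Division by the normalizing constants keeps the mixing limits, because these constants
  converge to a positive number.\<close>

lemma sup_exp_mixing:
  assumes c: "c > 0" and \<nu>: "\<nu> < 2 * c" and f: "bounded_continuous_C01 f"
  shows "((\<lambda>t. \<integral>\<omega>. sup_exp \<nu> (-c) t \<omega> / sup_mgf \<nu> (-c) t * f (unit_scale t \<omega>) \<partial>P) \<longlongrightarrow>
      (\<integral>\<omega>. f (unit_scale 1 \<omega>) \<partial>P)) at_top"
    and "((\<lambda>t. \<integral>\<omega>. total_sup_exp \<nu> (-c) \<omega> / expectation (total_sup_exp \<nu> (-c)) * f (unit_scale t \<omega>) \<partial>P) \<longlongrightarrow>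
      (\<integral>\<omega>. f (unit_scale 1 \<omega>) \<partial>P)) at_top"
proof -
  let ?z = "\<integral>\<omega>. total_sup_exp \<nu> (-c) \<omega> \<partial>P" and ?E = "\<integral>\<omega>. f (unit_scale 1 \<omega>) \<partial>P"
  have z: "?z \<noteq> 0" using total_sup_mgf_pos[OF c \<nu>] by simp
  have m: "sup_exp \<nu> (-c) t \<in> borel_measurable (path_filtration t)" "integrable P (sup_exp \<nu> (-c) t)" if "t > 0" for t
    using that measurable_sup_exp integrable_sup_exp by auto
  note mix = mixing_process[OF f integrable_total_sup_exp[OF c \<nu>] m sup_exp_L1[OF c \<nu>]]
    mixing_limit[OF f integrable_total_sup_exp[OF c \<nu>] m sup_exp_L1[OF c \<nu>]]
  from tendsto_divide[OF mix(1) sup_mgf_tendsto[OF c \<nu>] z]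
  show "((\<lambda>t. \<integral>\<omega>. sup_exp \<nu> (-c) t \<omega> / sup_mgf \<nu> (-c) t * f (unit_scale t \<omega>) \<partial>P) \<longlongrightarrow> ?E) at_top"
    using z by simp
  from tendsto_divide[OF mix(2) tendsto_const z]
  show "((\<lambda>t. \<integral>\<omega>. total_sup_exp \<nu> (-c) \<omega> / ?z * f (unit_scale t \<omega>) \<partial>P) \<longlongrightarrow> ?E) at_top"
    using z by simp
qed

lemma emeasure_gibbs_gap:
  assumes t: "t > 0" and L: "\<Lambda> \<in> sets (path_filtration t)"
  shows "emeasure (gibbs P \<nu> h t) \<Lambda> = emeasure (density P (\<lambda>\<omega>. ennreal (gap_exp \<nu> (\<nu> + h) t \<omega> / sup_mgf \<nu> (- (\<nu> + h)) t)))
      (drift (\<nu> + h) -` \<Lambda> \<inter> paths)"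
proof (rule emeasure_gibbs_drift[OF t L _ integrable_gap_exp[OF t]])
  show "gap_exp \<nu> (\<nu> + h) t =
      (\<lambda>\<omega>. exp (\<nu> * running_sup t (drift (\<nu> + h) \<omega>) + (h - (\<nu> + h)) * drift (\<nu> + h) \<omega> t))"
    by (simp add: gap_exp_def fun_eq_iff algebra_simps)
qed (use t sup_mgf_pos in \<open>simp_all only: integral_gap_exp less_imp_le\<close>)

lemma emeasure_gibbs_sup:
  assumes t: "t > 0" and L: "\<Lambda> \<in> sets (path_filtration t)"
  shows "emeasure (gibbs P \<nu> h t) \<Lambda> =
    emeasure (density P (\<lambda>\<omega>. ennreal (sup_exp \<nu> h t \<omega> / sup_mgf \<nu> h t))) (drift h -` \<Lambda> \<inter> paths)"
proof (rule emeasure_gibbs_drift[OF t L _ integrable_sup_exp])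
  show "sup_exp \<nu> h t = (\<lambda>\<omega>. exp (\<nu> * running_sup t (drift h \<omega>) + (h - h) * drift h \<omega> t))"
    by (simp add: sup_exp_def fun_eq_iff)
qed (use t sup_mgf_pos in \<open>simp_all only: sup_mgf_def less_imp_le\<close>)

lemma gibbs_weakly_converges_R3:
  assumes W: "standard_BM {0..1} N W" and c: "c > 0" and \<nu>: "\<nu> < 2 * c"
  shows "weakly_converges C01 (\<lambda>t. rescaled_law (gibbs P \<nu> (-c) t) (-c) t) (law_on_C01 N W) at_top"
proof (rule weakly_converges_density[OF W])
  show "rescaled_law (gibbs P \<nu> (-c) t) (-c) t =
      distr (density P (\<lambda>\<omega>. ennreal (sup_exp \<nu> (-c) t \<omega> / sup_mgf \<nu> (-c) t))) (borel_of C01) (unit_scale t)"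
    if "t > 0" for t
    using that emeasure_gibbs_sup by (intro rescaled_law_eq) (auto simp: sets_gibbs)
qed (use integrable_sup_exp sup_mgf_pos[of _ \<nu> "-c"] sup_exp_mixing(1)[OF c \<nu>] in
    \<open>auto simp: sup_mgf_def intro!: divide_nonneg_nonneg integral_nonneg_AE less_imp_neq[symmetric]\<close>)

text \<open>Mixing is available for the maximum of a path with negative drift, so the gap weight is
  turned into it by reversal. The test function is reflected in return, which
  \<open>integral_reflect\<close> makes invisible in the limit.\<close>

lemma gibbs_weakly_converges_R2:
  assumes W: "standard_BM {0..1} N W" and c: "\<nu> + h > 0" and \<nu>: "\<nu> < 2 * (\<nu> + h)"
  shows "weakly_converges C01 (\<lambda>t. rescaled_law (gibbs P \<nu> h t) (\<nu> + h) t) (law_on_C01 N W) at_top"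
proof (rule weakly_converges_density[OF W])
  let ?c = "\<nu> + h"
  show "rescaled_law (gibbs P \<nu> h t) ?c t =
      distr (density P (\<lambda>\<omega>. ennreal (gap_exp \<nu> ?c t \<omega> / sup_mgf \<nu> (-?c) t))) (borel_of C01) (unit_scale t)"
    if "t > 0" for t
    using that emeasure_gibbs_gap by (intro rescaled_law_eq) (auto simp: sets_gibbs)
  show "integrable P (\<lambda>\<omega>. gap_exp \<nu> ?c t \<omega> / sup_mgf \<nu> (-?c) t)" if "t > 0" for t
    using integrable_gap_exp[OF that] by simp
  show "0 \<le> gap_exp \<nu> ?c t \<omega> / sup_mgf \<nu> (-?c) t" for t \<omega>
    by (simp add: sup_mgf_def integral_nonneg_AE)
  show "(\<integral>\<omega>. gap_exp \<nu> ?c t \<omega> / sup_mgf \<nu> (-?c) t \<partial>P) = 1" if "t > 0" for t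
    using integral_gap_exp[OF that, of \<nu> ?c] sup_mgf_pos[of t \<nu> "-?c"] that by simp
  fix f assume f: "bounded_continuous_C01 f"
  have fr: "bounded_continuous_C01 (\<lambda>x. f (reflect x))" by (rule bounded_continuous_C01_reflect[OF f])
  show "((\<lambda>t. \<integral>\<omega>. gap_exp \<nu> ?c t \<omega> / sup_mgf \<nu> (-?c) t * f (unit_scale t \<omega>) \<partial>P) \<longlongrightarrow>
      (\<integral>\<omega>. f (unit_scale 1 \<omega>) \<partial>P)) at_top"
  proof (rule Lim_transform_eventually)
    show "((\<lambda>t. \<integral>\<omega>. sup_exp \<nu> (-?c) t \<omega> / sup_mgf \<nu> (-?c) t * f (reflect (unit_scale t \<omega>)) \<partial>P) \<longlongrightarrow>
        (\<integral>\<omega>. f (unit_scale 1 \<omega>) \<partial>P)) at_top"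
      using sup_exp_mixing(1)[OF c \<nu> fr] unfolding integral_reflect[OF f] .
    show "\<forall>\<^sub>F t in at_top. (\<integral>\<omega>. sup_exp \<nu> (-?c) t \<omega> / sup_mgf \<nu> (-?c) t * f (reflect (unit_scale t \<omega>)) \<partial>P) =
        (\<integral>\<omega>. gap_exp \<nu> ?c t \<omega> / sup_mgf \<nu> (-?c) t * f (unit_scale t \<omega>) \<partial>P)"
      using eventually_gt_at_top[of 0]
    proof eventually_elim
      fix t :: real assume t: "t > 0"
      show "(\<integral>\<omega>. sup_exp \<nu> (-?c) t \<omega> / sup_mgf \<nu> (-?c) t * f (reflect (unit_scale t \<omega>)) \<partial>P) =
        (\<integral>\<omega>. gap_exp \<nu> ?c t \<omega> / sup_mgf \<nu> (-?c) t * f (unit_scale t \<omega>) \<partial>P)"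
        using integral_gap_exp_test[OF t f, of \<nu> ?c] by simp
    qed
  qed
qed

end

section \<open>The penalized measures\<close>

context wiener
begin

lemma measure_density_drift:
  assumes Q: "emeasure Q \<Lambda> = emeasure (density P (\<lambda>\<omega>. ennreal (Y \<omega> / y))) (drift b -` \<Lambda> \<inter> paths)"
    and L: "\<Lambda> \<in> sets path_sigma" and Y: "integrable P Y" "\<And>\<omega>. 0 \<le> Y \<omega>" and y: "0 < y"
  shows "measure Q \<Lambda> = (\<integral>\<omega>. indicator \<Lambda> (drift b \<omega>) * Y \<omega> \<partial>P) / y"
proof -
  have m: "drift b -` \<Lambda> \<inter> paths \<in> sets P"
    using measurable_sets[OF measurable_drift_P L, of b] by simp
  have "measure Q \<Lambda> = measure (density P (\<lambda>\<omega>. ennreal (Y \<omega> / y))) (drift b -` \<Lambda> \<inter> paths)"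
    unfolding measure_def Q ..
  also have "\<dots> = (\<integral>\<omega>. Y \<omega> / y * indicator (drift b -` \<Lambda> \<inter> paths) \<omega> \<partial>P)"
    by (rule measure_density_real[OF _ _ m]) (use Y y in auto)
  also have "\<dots> = (\<integral>\<omega>. indicator \<Lambda> (drift b \<omega>) * Y \<omega> / y \<partial>P)"
    by (intro Bochner_Integration.integral_cong refl) (auto simp: indicator_def)
  finally show ?thesis by simp
qed

lemma measure_gibbs_gap:
  assumes t: "t > 0" and L: "\<Lambda> \<in> sets (path_filtration t)"
  shows "measure (gibbs P \<nu> h t) \<Lambda> =
    (\<integral>\<omega>. indicator \<Lambda> (drift (\<nu> + h) \<omega>) * gap_exp \<nu> (\<nu> + h) t \<omega> \<partial>P) / sup_mgf \<nu> (- (\<nu> + h)) t"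
  by (rule measure_density_drift[OF emeasure_gibbs_gap[OF t L] _ integrable_gap_exp[OF t]])
    (use L path_filtration_subset t in \<open>auto intro: sup_mgf_pos\<close>)

lemma measure_gibbs_sup:
  assumes t: "t > 0" and L: "\<Lambda> \<in> sets (path_filtration t)"
  shows "measure (gibbs P \<nu> h t) \<Lambda> =
    (\<integral>\<omega>. indicator \<Lambda> (drift h \<omega>) * sup_exp \<nu> h t \<omega> \<partial>P) / sup_mgf \<nu> h t"
  by (rule measure_density_drift[OF emeasure_gibbs_sup[OF t L] _ integrable_sup_exp])
    (use L path_filtration_subset t in \<open>auto intro: sup_mgf_pos\<close>)

text \<open>Convergence of the densities in L1 controls the probability of every event at once; the
  candidate is the limiting density, normalized by its mean.\<close>

lemma is_penalized_R3:
  assumes c: "c > 0" and \<nu>: "\<nu> < 2 * c"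
  shows "is_penalized P \<nu> (-c) (distr (density P (\<lambda>\<omega>. ennreal
    (total_sup_exp \<nu> (-c) \<omega> / expectation (total_sup_exp \<nu> (-c))))) path_sigma (drift (-c)))"
  unfolding is_penalized_def
proof (intro conjI allI impI ballI)
  let ?Z = "total_sup_exp \<nu> (-c)" and ?z = "\<integral>\<omega>. total_sup_exp \<nu> (-c) \<omega> \<partial>P"
  let ?D = "density P (\<lambda>\<omega>. ennreal (?Z \<omega> / ?z))"
  have z: "?z > 0" by (rule total_sup_mgf_pos[OF c \<nu>])
  have Zi: "integrable P ?Z" by (rule integrable_total_sup_exp[OF c \<nu>])
  have dm: "drift (-c) \<in> ?D \<rightarrow>\<^sub>M path_sigma" using measurable_drift_P by simp
  have "prob_space ?D"
    by (rule prob_space_density_real) (use z Zi in auto)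
  then show "prob_space (distr ?D path_sigma (drift (-c)))" by (rule prob_space.prob_space_distr[OF _ dm])
  show "sets (distr ?D path_sigma (drift (-c))) = sets path_sigma" by simp
  fix s \<Lambda> assume s: "s \<ge> (0::real)" and L: "\<Lambda> \<in> sets (path_filtration s)"
  have LP: "\<Lambda> \<in> sets path_sigma" using L path_filtration_subset by auto
  define Y where "Y \<omega> = (indicator \<Lambda> (drift (-c) \<omega>) :: real)" for \<omega>
  have Ym: "Y \<in> borel_measurable P"
    unfolding Y_def using measurable_compose[OF measurable_drift_P borel_measurable_indicator[OF LP]] .
  have Yb: "\<bar>Y \<omega>\<bar> \<le> 1" for \<omega> by (simp add: Y_def)
  have "emeasure (distr ?D path_sigma (drift (-c))) \<Lambda> = emeasure ?D (drift (-c) -` \<Lambda> \<inter> paths)"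
    using LP dm by (simp add: emeasure_distr)
  from measure_density_drift[OF this LP Zi _ z]
  have Q: "measure (distr ?D path_sigma (drift (-c))) \<Lambda> = (\<integral>\<omega>. ?Z \<omega> * Y \<omega> \<partial>P) / ?z"
    by (simp add: Y_def mult.commute)
  have "((\<lambda>t. \<integral>\<omega>. sup_exp \<nu> (-c) t \<omega> * Y \<omega> \<partial>P) \<longlongrightarrow> (\<integral>\<omega>. ?Z \<omega> * Y \<omega> \<partial>P)) at_top"
  proof (rule Lim_null_comparison[OF _ sup_exp_L1[OF c \<nu>], THEN LIM_zero_cancel])
    show "\<forall>\<^sub>F t in at_top. norm ((\<integral>\<omega>. sup_exp \<nu> (-c) t \<omega> * Y \<omega> \<partial>P) - (\<integral>\<omega>. ?Z \<omega> * Y \<omega> \<partial>P)) \<le>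
        (\<integral>\<omega>. \<bar>sup_exp \<nu> (-c) t \<omega> - ?Z \<omega>\<bar> \<partial>P)"
      using eventually_ge_at_top[of 0]
    proof eventually_elim
      fix t :: real assume t: "0 \<le> t"
      have Ui: "integrable P (sup_exp \<nu> (-c) t)" by (rule integrable_sup_exp[OF t])
      have "\<bar>\<integral>\<omega>. (sup_exp \<nu> (-c) t \<omega> - ?Z \<omega>) * Y \<omega> \<partial>P\<bar> \<le> 1 * (\<integral>\<omega>. \<bar>sup_exp \<nu> (-c) t \<omega> - ?Z \<omega>\<bar> \<partial>P)"
        by (rule integral_mult_bounded_le) (use Ui Zi Ym Yb in auto)
      then show "norm ((\<integral>\<omega>. sup_exp \<nu> (-c) t \<omega> * Y \<omega> \<partial>P) - (\<integral>\<omega>. ?Z \<omega> * Y \<omega> \<partial>P)) \<le>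
        (\<integral>\<omega>. \<bar>sup_exp \<nu> (-c) t \<omega> - ?Z \<omega>\<bar> \<partial>P)"
        using integrable_mult_bounded[OF Ui Ym Yb] integrable_mult_bounded[OF Zi Ym Yb]
        by (simp add: left_diff_distrib)
    qed
  qed
  from tendsto_divide[OF this sup_mgf_tendsto[OF c \<nu>]] z
  have "((\<lambda>t. (\<integral>\<omega>. sup_exp \<nu> (-c) t \<omega> * Y \<omega> \<partial>P) / sup_mgf \<nu> (-c) t) \<longlongrightarrow> (\<integral>\<omega>. ?Z \<omega> * Y \<omega> \<partial>P) / ?z) at_top"
    by simp
  then show "((\<lambda>t. measure (gibbs P \<nu> (-c) t) \<Lambda>) \<longlongrightarrow> measure (distr ?D path_sigma (drift (-c))) \<Lambda>) at_top"
    unfolding Q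
  proof (rule Lim_transform_eventually)
    show "\<forall>\<^sub>F t in at_top. (\<integral>\<omega>. sup_exp \<nu> (-c) t \<omega> * Y \<omega> \<partial>P) / sup_mgf \<nu> (-c) t = measure (gibbs P \<nu> (-c) t) \<Lambda>"
      using eventually_ge_at_top[of s] eventually_gt_at_top[of 0]
    proof eventually_elim
      fix t assume t: "s \<le> t" "0 < t"
      have "\<Lambda> \<in> sets (path_filtration t)" using L sets_path_filtration_mono[OF t(1)] by auto
      from measure_gibbs_sup[OF t(2) this, of \<nu> "-c"]
      show "(\<integral>\<omega>. sup_exp \<nu> (-c) t \<omega> * Y \<omega> \<partial>P) / sup_mgf \<nu> (-c) t = measure (gibbs P \<nu> (-c) t) \<Lambda>"
        by (simp add: Y_def mult.commute)
    qed
  qed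
qed

text \<open>The maximum on [0, t] is attained before or after s. Once the endpoint is subtracted,
  the part after s is the gap of the restarted path and the part before s is the earlier maximum
  minus the endpoint. The second inequality serves the critical line.\<close>

lemma gap_incr_le:
  assumes \<omega>: "\<omega> \<in> paths" and s: "0 \<le> s" "s \<le> t"
  shows "running_sup (t - s) (drift c (incr s \<omega>)) - drift c (incr s \<omega>) (t - s) \<le>
      running_sup t (drift c \<omega>) - drift c \<omega> t" (is ?le)
    and "running_sup t (drift c \<omega>) - drift c \<omega> t \<le>
      max (running_sup (t - s) (drift c (incr s \<omega>)) - drift c (incr s \<omega>) (t - s))
        (running_sup s (drift c \<omega>) - drift c \<omega> t)" (is ?max)
proof -
  let ?\<eta> = "drift c \<omega>" and ?\<theta> = "drift c (incr s \<omega>)"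
  have \<eta>: "?\<eta> \<in> paths" and \<theta>: "?\<theta> \<in> paths" using \<omega> s by (simp_all add: drift_in_paths incr_in_paths)
  have eq: "?\<theta> u = ?\<eta> (s + u) - ?\<eta> s" if "0 \<le> u" for u
    using that s by (simp add: drift_def incr_def algebra_simps)
  have "running_sup (t - s) ?\<theta> \<le> running_sup t ?\<eta> - ?\<eta> s"
  proof (rule running_sup_least)
    fix u assume u: "0 \<le> u" "u \<le> t - s"
    then show "?\<theta> u \<le> running_sup t ?\<eta> - ?\<eta> s"
      using eq running_sup_upper[OF \<eta>, of "s + u" t] s by simp
  qed (use s in simp)
  then show ?le using eq[of "t - s"] s by simp
  have "running_sup t ?\<eta> \<le> max (running_sup (t - s) ?\<theta> + ?\<eta> s) (running_sup s ?\<eta>)"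
  proof (rule running_sup_least)
    fix u assume u: "0 \<le> u" "u \<le> t"
    show "?\<eta> u \<le> max (running_sup (t - s) ?\<theta> + ?\<eta> s) (running_sup s ?\<eta>)"
    proof (cases "u \<le> s")
      case True
      then show ?thesis using running_sup_upper[OF \<eta>, of u s] u by simp
    next
      case False
      then show ?thesis using running_sup_upper[OF \<theta>, of "u - s" "t - s"] eq[of "u - s"] u by simp
    qed
  qed (use s in simp)
  then show ?max using eq[of "t - s"] s by (simp add: max_def split: if_splits)
qed

text \<open>By \<open>gap_incr_le\<close> the difference of the two weights has a constant sign,
  that of \<nu>, so its L1 norm is the absolute difference of the means. The error estimate is
  thereby reduced to the growth of \<open>sup_mgf\<close>.\<close>

lemma gap_exp_incr_L1:
  assumes s: "0 < s" "s < t"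
  shows "(\<integral>\<omega>. \<bar>gap_exp \<nu> c t \<omega> - gap_exp \<nu> c (t - s) (incr s \<omega>)\<bar> \<partial>P) =
      \<bar>sup_mgf \<nu> (-c) t - sup_mgf \<nu> (-c) (t - s)\<bar>"
    and "integrable P (\<lambda>\<omega>. gap_exp \<nu> c (t - s) (incr s \<omega>))"
    and "(\<integral>\<omega>. gap_exp \<nu> c (t - s) (incr s \<omega>) \<partial>P) = sup_mgf \<nu> (-c) (t - s)"
proof -
  have G: "gap_exp \<nu> c (t - s) \<in> borel_measurable path_sigma" "integrable P (gap_exp \<nu> c (t - s))"
    using s by (auto intro!: measurable_path_sigma[OF measurable_gap_exp] integrable_gap_exp)
  have "(\<lambda>_. 1 :: real) \<in> borel_measurable (path_filtration s)" "integrable P (\<lambda>_. 1 :: real)"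
    by simp_all
  note ind = integral_indep_incr[OF s(1) this G]
  show int: "integrable P (\<lambda>\<omega>. gap_exp \<nu> c (t - s) (incr s \<omega>))" using ind(1) by simp
  show val: "(\<integral>\<omega>. gap_exp \<nu> c (t - s) (incr s \<omega>) \<partial>P) = sup_mgf \<nu> (-c) (t - s)"
    using ind(2) integral_gap_exp[of "t - s" \<nu> c] s by (simp add: prob_space[simplified])
  have int': "integrable P (gap_exp \<nu> c t)" and val': "expectation (gap_exp \<nu> c t) = sup_mgf \<nu> (-c) t"
    using integrable_gap_exp integral_gap_exp s by auto
  define d where "d \<omega> = gap_exp \<nu> c t \<omega> - gap_exp \<nu> c (t - s) (incr s \<omega>)" for \<omega>
  have di: "integrable P d" and dv: "expectation d = sup_mgf \<nu> (-c) t - sup_mgf \<nu> (-c) (t - s)"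
    unfolding d_def using int int' val val' by auto
  have "(\<integral>\<omega>. \<bar>d \<omega>\<bar> \<partial>P) = \<bar>\<integral>\<omega>. d \<omega> \<partial>P\<bar>"
  proof (cases "\<nu> \<ge> 0")
    case True
    have nn: "0 \<le> d \<omega>" if "\<omega> \<in> space P" for \<omega>
      using gap_incr_le(1)[of \<omega> s t c] that s True by (auto simp: d_def gap_exp_def intro!: mult_left_mono)
    then have "(\<integral>\<omega>. \<bar>d \<omega>\<bar> \<partial>P) = expectation d"
      by (intro Bochner_Integration.integral_cong refl) simp
    moreover have "0 \<le> expectation d" by (intro integral_nonneg_AE AE_I2 nn)
    ultimately show ?thesis by simp
  next
    case False
    have np: "d \<omega> \<le> 0" if "\<omega> \<in> space P" for \<omega>
      using gap_incr_le(1)[of \<omega> s t c] that s False by (auto simp: d_def gap_exp_def intro!: mult_left_mono_neg)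
    then have "(\<integral>\<omega>. \<bar>d \<omega>\<bar> \<partial>P) = (\<integral>\<omega>. - d \<omega> \<partial>P)"
      by (intro Bochner_Integration.integral_cong refl) simp
    moreover have "0 \<le> (\<integral>\<omega>. - d \<omega> \<partial>P)" by (intro integral_nonneg_AE AE_I2) (use np in simp)
    ultimately show ?thesis by simp
  qed
  then show "(\<integral>\<omega>. \<bar>gap_exp \<nu> c t \<omega> - gap_exp \<nu> c (t - s) (incr s \<omega>)\<bar> \<partial>P) =
      \<bar>sup_mgf \<nu> (-c) t - sup_mgf \<nu> (-c) (t - s)\<bar>"
    unfolding dv unfolding d_def .
qed

text \<open>Up to the given relative error, the Gibbs weight can be replaced by a function of the
  increments after time \<open>s\<close>, which are independent of the events up to time \<open>s\<close>.\<close>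

lemma is_penalized_positive_drift:
  assumes rate: "\<And>s. s > 0 \<Longrightarrow> ((\<lambda>t. (sup_mgf \<nu> (- (\<nu> + h)) t - sup_mgf \<nu> (- (\<nu> + h)) (t - s)) /
      sup_mgf \<nu> (- (\<nu> + h)) t) \<longlongrightarrow> 0) at_top"
  shows "is_penalized P \<nu> h (distr P path_sigma (drift (\<nu> + h)))"
  unfolding is_penalized_def
proof (intro conjI allI impI ballI)
  let ?c = "\<nu> + h"
  let ?Q = "distr P path_sigma (drift ?c)" and ?a = "sup_mgf \<nu> (-?c)"
  show "prob_space ?Q" by (rule prob_space_distr[OF measurable_drift_P])
  show "sets ?Q = sets path_sigma" by simp
  fix s' \<Lambda> assume s': "s' \<ge> (0::real)" and L': "\<Lambda> \<in> sets (path_filtration s')"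
  \<comment> \<open>Independence of the increments is stated for strictly positive times, while s'
    may be 0.\<close>
  define s where "s = s' + 1"
  have s: "s > 0" using s' by (simp add: s_def)
  have L: "\<Lambda> \<in> sets (path_filtration s)"
    using L' sets_path_filtration_mono[of s' s] by (auto simp: s_def)
  have LP: "\<Lambda> \<in> sets path_sigma" using L path_filtration_subset by auto
  define Y where "Y \<omega> = (indicator \<Lambda> (drift ?c \<omega>) :: real)" for \<omega>
  have Ym: "Y \<in> borel_measurable (path_filtration s)"
    unfolding Y_def using measurable_compose[OF measurable_drift borel_measurable_indicator[OF L]] .
  have YP: "Y \<in> borel_measurable P" by (rule measurable_P[OF Ym])
  have Yb: "\<bar>Y \<omega>\<bar> \<le> 1" for \<omega> by (simp add: Y_def)
  have Yi: "integrable P Y" by (rule integrable_const_bound[of _ 1]) (use YP Yb in auto)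
  have Q: "measure ?Q \<Lambda> = expectation Y"
  proof -
    have "measure ?Q \<Lambda> = (\<integral>x. indicator \<Lambda> x \<partial>?Q)" using LP sets.sets_into_space[OF LP] by (simp add: Int_absorb2)
    also have "\<dots> = expectation Y"
      unfolding Y_def by (rule integral_distr[OF measurable_drift_P]) (use LP in simp)
    finally show ?thesis .
  qed
  \<comment> \<open>Two errors with the same bound are added: one from exchanging the weight next to
    Y, one from exchanging its mean next to the mean of Y.\<close>
  have tri: "\<bar>x - z\<bar> \<le> 2 * d" if "\<bar>x - y\<bar> \<le> d" "\<bar>y - z\<bar> \<le> d" for x y z d :: real
    using that by linarith
  let ?p = "\<integral>\<omega>. Y \<omega> \<partial>P"
  have p: "\<bar>?p\<bar> \<le> 1"
    using integral_mult_bounded_le[of "\<lambda>_. 1" Y 1] YP Yb by (simp add: prob_space[simplified])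
  have "((\<lambda>t. 2 * \<bar>(?a t - ?a (t - s)) / ?a t\<bar>) \<longlongrightarrow> 0) at_top"
    using tendsto_mult_right_zero[OF tendsto_rabs_zero[OF rate[OF s]], of 2] by simp
  then show "((\<lambda>t. measure (gibbs P \<nu> h t) \<Lambda>) \<longlongrightarrow> measure ?Q \<Lambda>) at_top"
    unfolding Q
  proof (rule Lim_null_comparison[rotated, THEN LIM_zero_cancel])
    show "\<forall>\<^sub>F t in at_top. norm (measure (gibbs P \<nu> h t) \<Lambda> - ?p) \<le> 2 * \<bar>(?a t - ?a (t - s)) / ?a t\<bar>"
      using eventually_gt_at_top[of s]
    proof eventually_elim
      fix t assume t: "s < t"
      then have t0: "t > 0" using s by simp
      have a: "?a t > 0" using t0 by (intro sup_mgf_pos) simp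
      have Lt: "\<Lambda> \<in> sets (path_filtration t)" using L sets_path_filtration_mono[of s t] t by auto
      have G: "gap_exp \<nu> ?c (t - s) \<in> borel_measurable path_sigma" "integrable P (gap_exp \<nu> ?c (t - s))"
        using t by (auto intro!: measurable_path_sigma[OF measurable_gap_exp] integrable_gap_exp)
      let ?g = "gap_exp \<nu> ?c t" and ?g' = "\<lambda>\<omega>. gap_exp \<nu> ?c (t - s) (incr s \<omega>)"
      have gi: "integrable P ?g" "integrable P ?g'"
        using integrable_gap_exp[OF t0] gap_exp_incr_L1(2)[OF s t] by auto
      have i': "(\<integral>\<omega>. Y \<omega> * ?g' \<omega> \<partial>P) = ?p * ?a (t - s)"
        using integral_indep_incr(2)[OF s Ym Yi G] integral_gap_exp[of "t - s" \<nu> ?c] t by simp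
      have "\<bar>\<integral>\<omega>. (?g \<omega> - ?g' \<omega>) * Y \<omega> \<partial>P\<bar> \<le> 1 * (\<integral>\<omega>. \<bar>?g \<omega> - ?g' \<omega>\<bar> \<partial>P)"
        by (rule integral_mult_bounded_le) (use gi YP Yb in auto)
      moreover have "(\<integral>\<omega>. (?g \<omega> - ?g' \<omega>) * Y \<omega> \<partial>P) = (\<integral>\<omega>. Y \<omega> * ?g \<omega> \<partial>P) - ?p * ?a (t - s)"
        using integrable_mult_bounded[OF gi(1) YP Yb] integrable_mult_bounded[OF gi(2) YP Yb]
        unfolding i'[symmetric] by (simp add: right_diff_distrib mult.commute)
      ultimately have 1: "\<bar>(\<integral>\<omega>. Y \<omega> * ?g \<omega> \<partial>P) - ?p * ?a (t - s)\<bar> \<le> \<bar>?a t - ?a (t - s)\<bar>"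
        using gap_exp_incr_L1(1)[OF s t, of \<nu> ?c] by simp
      have "\<bar>?p * (?a (t - s) - ?a t)\<bar> \<le> 1 * \<bar>?a (t - s) - ?a t\<bar>"
        unfolding abs_mult using p by (intro mult_right_mono) auto
      then have 2: "\<bar>?p * ?a (t - s) - ?p * ?a t\<bar> \<le> \<bar>?a t - ?a (t - s)\<bar>"
        by (simp add: right_diff_distrib abs_minus_commute)
      have "\<bar>(\<integral>\<omega>. Y \<omega> * ?g \<omega> \<partial>P) - ?p * ?a t\<bar> \<le> 2 * \<bar>?a t - ?a (t - s)\<bar>"
        by (rule tri[OF 1 2])
      then have "\<bar>(\<integral>\<omega>. Y \<omega> * ?g \<omega> \<partial>P) - ?p * ?a t\<bar> / ?a t \<le> 2 * \<bar>?a t - ?a (t - s)\<bar> / ?a t"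
        using a by (intro divide_right_mono) auto
      moreover have "measure (gibbs P \<nu> h t) \<Lambda> - ?p = ((\<integral>\<omega>. Y \<omega> * ?g \<omega> \<partial>P) - ?p * ?a t) / ?a t"
        unfolding measure_gibbs_gap[OF t0 Lt] Y_def[symmetric] using a by (simp add: field_simps)
      ultimately show "norm (measure (gibbs P \<nu> h t) \<Lambda> - ?p) \<le> 2 * \<bar>(?a t - ?a (t - s)) / ?a t\<bar>"
        using a by (simp add: abs_divide)
    qed
  qed
qed

lemma filterlim_minus_const_at_top: "filterlim (\<lambda>t. t - s) at_top (at_top :: real filter)"
  using filterlim_tendsto_add_at_top[OF tendsto_const filterlim_ident, of "- s"] by simp

lemma is_penalized_R2:
  assumes c: "\<nu> + h > 0" and \<nu>: "\<nu> < 2 * (\<nu> + h)"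
  shows "is_penalized P \<nu> h (distr P path_sigma (drift (\<nu> + h)))"
proof (rule is_penalized_positive_drift)
  fix s :: real
  note lim = sup_mgf_tendsto[OF c \<nu>]
  have "((\<lambda>t. sup_mgf \<nu> (- (\<nu> + h)) (t - s)) \<longlongrightarrow> expectation (total_sup_exp \<nu> (- (\<nu> + h)))) at_top"
    by (rule filterlim_compose[OF lim filterlim_minus_const_at_top])
  from tendsto_divide[OF tendsto_diff[OF lim this] lim] total_sup_mgf_pos[OF c \<nu>]
  show "((\<lambda>t. (sup_mgf \<nu> (- (\<nu> + h)) t - sup_mgf \<nu> (- (\<nu> + h)) (t - s)) / sup_mgf \<nu> (- (\<nu> + h)) t) \<longlongrightarrow> 0) at_top"
    by simp
qed

section \<open>The critical line \<nu> = 2 * c\<close>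

lemma
  assumes t: "t > 0"
  shows integrable_exp_eval: "integrable P (\<lambda>\<omega>. exp (b * \<omega> t - b\<^sup>2 * t / 2))"
    and integral_exp_eval: "(\<integral>\<omega>. exp (b * \<omega> t - b\<^sup>2 * t / 2) \<partial>P) = 1"
proof -
  have [measurable]: "(\<lambda>\<omega>. \<omega> t) \<in> borel_measurable P" using t by (intro measurable_eval_P) simp
  have 1: "(\<integral>\<^sup>+\<omega>. ennreal (exp (b * \<omega> t - b\<^sup>2 * t / 2)) \<partial>P) = 1"
    using girsanov[OF t, of "\<lambda>_. 1" b] by simp
  then show "integrable P (\<lambda>\<omega>. exp (b * \<omega> t - b\<^sup>2 * t / 2))"
    by (intro integrableI_nonneg) auto
  show "(\<integral>\<omega>. exp (b * \<omega> t - b\<^sup>2 * t / 2) \<partial>P) = 1"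
    using 1 by (subst integral_eq_nn_integral) auto
qed

lemma sup_mgf_mono:
  assumes "\<nu> \<ge> 0" "0 \<le> s" "s \<le> t"
  shows "sup_mgf \<nu> b s \<le> sup_mgf \<nu> b t"
  unfolding sup_mgf_def
proof (rule integral_mono)
  fix \<omega> assume "\<omega> \<in> space P"
  then show "sup_exp \<nu> b s \<omega> \<le> sup_exp \<nu> b t \<omega>"
    using assms running_sup_mono[OF drift_in_paths, of \<omega> s t b] by (auto simp: sup_exp_def intro!: mult_left_mono)
qed (use assms in \<open>auto intro: integrable_sup_exp\<close>)

text \<open>In the critical case \<open>\<nu> = 2 * c\<close> the martingale \<open>exp (2 * c * X\<^sub>t)\<close> of Brownian motion \<open>X\<close> with
  drift \<open>-c\<close> has mean 1 and tends to 0, so its maximum is not integrable.\<close>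

lemma sup_mgf_critical_at_top:
  assumes c: "c > 0"
  shows "filterlim (sup_mgf (2 * c) (-c)) at_top at_top"
proof (rule ccontr)
  let ?a = "sup_mgf (2 * c) (-c)"
  assume "\<not> filterlim ?a at_top at_top"
  then obtain A where A: "\<not> (\<forall>\<^sub>F t in at_top. A \<le> ?a t)" unfolding filterlim_at_top by blast
  \<comment> \<open>By monotonicity a single value of at least A would keep all later ones at or
    above A; hence A bounds the whole function.\<close>
  have bd: "?a t < A" if t: "t \<ge> 0" for t
  proof (rule ccontr)
    assume "\<not> ?a t < A"
    then have "A \<le> ?a u" if "t \<le> u" for u
      using sup_mgf_mono[of "2 * c" t u "-c"] t c that by simp
    then have "\<forall>\<^sub>F t in at_top. A \<le> ?a t" unfolding eventually_at_top_linorder by blast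
    with A show False ..
  qed
  let ?Z = "total_sup_exp (2 * c) (-c)"
  \<comment> \<open>Fatou's lemma along integer times, with the uniform bound A.\<close>
  have Zint: "integrable P ?Z"
  proof (rule integrableI_nonneg[OF measurable_total_sup_exp])
    have lim: "AE \<omega> in P. (\<lambda>n::nat. ennreal (sup_exp (2 * c) (-c) (real n) \<omega>)) \<longlonglongrightarrow> ennreal (?Z \<omega>)"
      using AE_sup_regular[OF c]
    proof eventually_elim
      fix \<omega> assume "sup_regular (-c) \<omega>"
      then have "((\<lambda>t. running_sup t (drift (-c) \<omega>)) \<longlongrightarrow> total_sup (drift (-c) \<omega>)) at_top"
        by (simp add: sup_regular_def)
      then have "(\<lambda>n::nat. running_sup (real n) (drift (-c) \<omega>)) \<longlonglongrightarrow> total_sup (drift (-c) \<omega>)"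
        by (rule filterlim_compose[OF _ filterlim_real_sequentially])
      then show "(\<lambda>n::nat. ennreal (sup_exp (2 * c) (-c) (real n) \<omega>)) \<longlonglongrightarrow> ennreal (?Z \<omega>)"
        unfolding sup_exp_def total_sup_exp_def by (intro tendsto_intros)
    qed
    have "(\<integral>\<^sup>+\<omega>. ennreal (?Z \<omega>) \<partial>P) = (\<integral>\<^sup>+\<omega>. liminf (\<lambda>n::nat. ennreal (sup_exp (2 * c) (-c) (real n) \<omega>)) \<partial>P)"
    proof (rule nn_integral_cong_AE)
      show "AE \<omega> in P. ennreal (?Z \<omega>) = liminf (\<lambda>n::nat. ennreal (sup_exp (2 * c) (-c) (real n) \<omega>))"
        using lim by eventually_elim (rule lim_imp_Liminf[OF sequentially_bot, symmetric])
    qed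
    also have "\<dots> \<le> liminf (\<lambda>n::nat. \<integral>\<^sup>+\<omega>. ennreal (sup_exp (2 * c) (-c) (real n) \<omega>) \<partial>P)"
      using measurable_sup_exp_P by (intro nn_integral_liminf) simp
    also have "\<dots> \<le> liminf (\<lambda>n::nat. ennreal A)"
    proof (rule Liminf_mono, rule always_eventually, rule allI)
      fix n :: nat
      have "(\<integral>\<^sup>+\<omega>. ennreal (sup_exp (2 * c) (-c) (real n) \<omega>) \<partial>P) = ennreal (?a (real n))"
        unfolding sup_mgf_def by (rule nn_integral_eq_integral) (auto intro: integrable_sup_exp)
      also have "\<dots> \<le> ennreal A" using bd[of "real n"] by (intro ennreal_leI) simp
      finally show "(\<integral>\<^sup>+\<omega>. ennreal (sup_exp (2 * c) (-c) (real n) \<omega>) \<partial>P) \<le> ennreal A" .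
    qed
    also have "\<dots> < \<infinity>" by (simp add: Liminf_const)
    finally show "(\<integral>\<^sup>+\<omega>. ennreal (?Z \<omega>) \<partial>P) < \<infinity>" .
  qed simp
  \<comment> \<open>The mean of M b n is exp ((b^2 / 2 - b * c) * (n + 1)): it equals 1 at b = 2 * c
    and decays geometrically at b = c. The time n + 1 is positive, as
    \<open>integral_exp_eval\<close> requires.\<close>
  define M where "M b n \<omega> = exp (b * drift (-c) \<omega> (real (Suc n)))" for b n \<omega>
  have M: "M b n \<omega> = exp ((b\<^sup>2 / 2 - b * c) * real (Suc n)) * exp (b * \<omega> (real (Suc n)) - b\<^sup>2 * real (Suc n) / 2)" for b n \<omega>
    unfolding M_def exp_add[symmetric] by (simp add: drift_eval algebra_simps)
  have Mi: "integrable P (M b n)" and Mv: "expectation (M b n) = exp ((b\<^sup>2 / 2 - b * c) * real (Suc n))" for b n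
    unfolding M using integrable_exp_eval[of "real (Suc n)" b] integral_exp_eval[of "real (Suc n)" b] by simp_all
  have "(\<lambda>n. \<integral>\<omega>. norm (M c n \<omega>) \<partial>P) \<longlonglongrightarrow> 0"
  proof -
    have e: "(\<integral>\<omega>. norm (M c n \<omega>) \<partial>P) = exp (- (c\<^sup>2 / 2)) ^ Suc n" for n
    proof -
      have "(\<integral>\<omega>. norm (M c n \<omega>) \<partial>P) = expectation (M c n)"
        by (intro Bochner_Integration.integral_cong refl) (simp add: M_def)
      also have "\<dots> = exp (real (Suc n) * - (c\<^sup>2 / 2))"
        unfolding Mv by (simp add: power2_eq_square algebra_simps)
      finally show ?thesis unfolding exp_of_nat_mult .
    qed
    show ?thesis unfolding e using c by (intro LIMSEQ_Suc LIMSEQ_realpow_zero) auto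
  qed
  from tendsto_L1_AE_subseq[OF Mi this]
  obtain r where r: "strict_mono r" "AE \<omega> in P. (\<lambda>n. M c (r n) \<omega>) \<longlonglongrightarrow> 0" by blast
  \<comment> \<open>The martingale is the square of a process that tends to 0 in L1, hence almost
    surely along a subsequence.\<close>
  have sq: "M (2 * c) n \<omega> = M c n \<omega> * M c n \<omega>" for n \<omega>
    unfolding M_def exp_add[symmetric] by simp
  \<comment> \<open>The supposedly integrable \<open>?Z\<close> dominates the martingale at all
    times, so the means would tend to 0 although each of them is 1.\<close>
  have "(\<lambda>n. \<integral>\<omega>. M (2 * c) (r n) \<omega> \<partial>P) \<longlonglongrightarrow> (\<integral>\<omega>. 0 \<partial>P)"
  proof (rule integral_dominated_convergence[OF _ _ Zint])
    show "AE \<omega> in P. (\<lambda>n. M (2 * c) (r n) \<omega>) \<longlonglongrightarrow> 0"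
      using r(2) by eventually_elim (use sq in \<open>auto intro!: tendsto_mult_zero\<close>)
    show "AE \<omega> in P. norm (M (2 * c) (r n) \<omega>) \<le> ?Z \<omega>" for n
      using AE_sup_regular[OF c]
    proof eventually_elim
      fix \<omega> assume H: "sup_regular (-c) \<omega>"
      let ?t = "real (Suc (r n))"
      have "drift (-c) \<omega> ?t \<le> running_sup ?t (drift (-c) \<omega>)"
        using H by (intro running_sup_upper drift_in_paths) (auto simp: sup_regular_def)
      also have "\<dots> \<le> total_sup (drift (-c) \<omega>)" using H unfolding sup_regular_def by (meson of_nat_0_le_iff)
      finally show "norm (M (2 * c) (r n) \<omega>) \<le> ?Z \<omega>" using c by (simp add: M_def total_sup_exp_def)
    qed
    show "M (2 * c) (r n) \<in> borel_measurable P" for n using Mi by simp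
  qed simp
  moreover have "(\<integral>\<omega>. M (2 * c) (r n) \<omega> \<partial>P) = 1" for n
    unfolding Mv by (simp add: power2_eq_square)
  ultimately show False by (simp add: LIMSEQ_const_iff)
qed

text \<open>If the maximum is attained before s, the weight is \<open>gap_exp\<close> at time s
  times exp (-2 * c * D), where D is the increment from s to t with drift c. At the critical
  exponent this independent factor is an exponential martingale of mean 1. Bounding the larger of
  the two cases by their sum gives subadditivity.\<close>

lemma sup_mgf_critical_increment:
  assumes c: "c > 0" and s: "0 < s" "s < t"
  shows "sup_mgf (2 * c) (-c) t \<le> sup_mgf (2 * c) (-c) (t - s) + sup_mgf (2 * c) (-c) s"
proof -
  let ?g = "gap_exp (2 * c) c"
  let ?m = "\<lambda>\<eta>. exp (- (2 * c) * \<eta> (t - s) - (- (2 * c))\<^sup>2 * (t - s) / 2)"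
  have ts: "t - s > 0" using s by simp
  have m: "?m \<in> borel_measurable path_sigma"
  proof -
    have [measurable]: "(\<lambda>\<eta>. \<eta> (t - s)) \<in> borel_measurable path_sigma"
      using measurable_path_sigma[OF measurable_eval[of "t - s" "t - s"]] ts by simp
    show ?thesis by measurable
  qed
  have gm: "?g s \<in> borel_measurable (path_filtration s)" using s by (intro measurable_gap_exp) simp
  note ind = integral_indep_incr[OF s(1) gm integrable_gap_exp[OF s(1)] m integrable_exp_eval[OF ts]]
  have le: "?g t \<omega> \<le> ?g (t - s) (incr s \<omega>) + ?g s \<omega> * ?m (incr s \<omega>)" if \<omega>: "\<omega> \<in> space P" for \<omega>
  proof -
    let ?A = "running_sup (t - s) (drift c (incr s \<omega>)) - drift c (incr s \<omega>) (t - s)"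
    let ?B = "running_sup s (drift c \<omega>) - drift c \<omega> t"
    have "running_sup t (drift c \<omega>) - drift c \<omega> t \<le> max ?A ?B"
      using gap_incr_le(2)[of \<omega> s t c] \<omega> s by simp
    then have "?g t \<omega> \<le> exp (2 * c * max ?A ?B)" using c by (simp add: gap_exp_def)
    also have "\<dots> \<le> exp (2 * c * ?A) + exp (2 * c * ?B)" by (simp add: max_def)
    also have "exp (2 * c * ?A) = ?g (t - s) (incr s \<omega>)" by (simp add: gap_exp_def)
    \<comment> \<open>The drift contributes -2 * c^2 * (t - s) to the exponent, which is exactly the
      compensator in \<open>?m\<close>.\<close>
    also have "exp (2 * c * ?B) = ?g s \<omega> * ?m (incr s \<omega>)"
      unfolding gap_exp_def exp_add[symmetric] using s
      by (simp add: drift_eval incr_def power2_eq_square field_simps)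
    finally show ?thesis by simp
  qed
  have v: "(\<integral>\<omega>. ?g s \<omega> * ?m (incr s \<omega>) \<partial>P) = sup_mgf (2 * c) (-c) s"
    unfolding ind(2) integral_exp_eval[OF ts] using s by (simp add: integral_gap_exp)
  have "sup_mgf (2 * c) (-c) t = expectation (?g t)" using s by (simp add: integral_gap_exp)
  also have "\<dots> \<le> (\<integral>\<omega>. ?g (t - s) (incr s \<omega>) + ?g s \<omega> * ?m (incr s \<omega>) \<partial>P)"
    using le s ind(1) gap_exp_incr_L1(2)[OF s]
    by (intro integral_mono Bochner_Integration.integrable_add integrable_gap_exp) auto
  also have "\<dots> = (\<integral>\<omega>. ?g (t - s) (incr s \<omega>) \<partial>P) + (\<integral>\<omega>. ?g s \<omega> * ?m (incr s \<omega>) \<partial>P)"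
    by (rule Bochner_Integration.integral_add[OF gap_exp_incr_L1(2)[OF s] ind(1)])
  also have "\<dots> = sup_mgf (2 * c) (-c) (t - s) + sup_mgf (2 * c) (-c) s"
    by (simp only: v gap_exp_incr_L1(3)[OF s])
  finally show ?thesis .
qed

lemma is_penalized_L3:
  assumes c: "c > 0"
  shows "is_penalized P (2 * c) (-c) (distr P path_sigma (drift c))"
proof -
  let ?a = "sup_mgf (2 * c) (-c)"
  have "((\<lambda>t. (?a t - ?a (t - s)) / ?a t) \<longlongrightarrow> 0) at_top" if s: "s > 0" for s
  proof (rule tendsto_sandwich)
    show "\<forall>\<^sub>F t in at_top. 0 \<le> (?a t - ?a (t - s)) / ?a t"
      using eventually_gt_at_top[of s]
    proof eventually_elim
      fix t assume "s < t"
      then show "0 \<le> (?a t - ?a (t - s)) / ?a t"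
        using sup_mgf_mono[of "2 * c" "t - s" t "-c"] sup_mgf_pos[of t "2 * c" "-c"] c s
        by (intro divide_nonneg_pos) auto
    qed
    show "\<forall>\<^sub>F t in at_top. (?a t - ?a (t - s)) / ?a t \<le> ?a s / ?a t"
      using eventually_gt_at_top[of s]
    proof eventually_elim
      fix t assume "s < t"
      then show "(?a t - ?a (t - s)) / ?a t \<le> ?a s / ?a t"
        using sup_mgf_critical_increment[OF c s, of t] sup_mgf_pos[of t "2 * c" "-c"] s
        by (intro divide_right_mono) auto
    qed
    show "((\<lambda>t. ?a s / ?a t) \<longlongrightarrow> 0) at_top"
      by (intro tendsto_divide_0[OF tendsto_const] filterlim_at_top_imp_at_infinity sup_mgf_critical_at_top[OF c])
  qed auto
  then show ?thesis using is_penalized_positive_drift[of "2 * c" "-c"] by simp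
qed

section \<open>Weak convergence under the penalized measures\<close>

lemma penalized_weakly_converges_R3:
  assumes W: "standard_BM {0..1} N W" and c: "c > 0" and \<nu>: "\<nu> < 2 * c"
  shows "weakly_converges C01 (\<lambda>t. rescaled_law (penalized P \<nu> (-c)) (-c) t) (law_on_C01 N W) at_top"
proof (rule weakly_converges_density[OF W])
  let ?z = "\<integral>\<omega>. total_sup_exp \<nu> (-c) \<omega> \<partial>P"
  let ?D = "density P (\<lambda>\<omega>. ennreal (total_sup_exp \<nu> (-c) \<omega> / ?z))"
  have z: "?z > 0" by (rule total_sup_mgf_pos[OF c \<nu>])
  have dm: "drift (-c) \<in> ?D \<rightarrow>\<^sub>M path_sigma" using measurable_drift_P by simp
  show "rescaled_law (penalized P \<nu> (-c)) (-c) t = distr ?D (borel_of C01) (unit_scale t)" if "t > 0" for t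
    unfolding penalized_eqI[OF is_penalized_R3[OF c \<nu>]]
  proof (rule rescaled_law_eq)
    fix \<Lambda> assume "\<Lambda> \<in> sets (path_filtration t)"
    then have "\<Lambda> \<in> sets path_sigma" using path_filtration_subset by auto
    then show "emeasure (distr ?D path_sigma (drift (-c))) \<Lambda> = emeasure ?D (drift (-c) -` \<Lambda> \<inter> paths)"
      using dm by (simp add: emeasure_distr)
  qed (use that in \<open>auto simp: sets_P\<close>)
  show "integrable P (\<lambda>\<omega>. total_sup_exp \<nu> (-c) \<omega> / ?z)" using integrable_total_sup_exp[OF c \<nu>] by simp
  show "0 \<le> total_sup_exp \<nu> (-c) \<omega> / ?z" for \<omega> using z by simp
  show "(\<integral>\<omega>. total_sup_exp \<nu> (-c) \<omega> / ?z \<partial>P) = 1" using z by simp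
qed (rule sup_exp_mixing(2)[OF c \<nu>])

lemma penalized_weakly_converges_positive_drift:
  assumes W: "standard_BM {0..1} N W" and pen: "is_penalized P \<nu> h (distr P path_sigma (drift c))"
  shows "weakly_converges C01 (\<lambda>t. rescaled_law (penalized P \<nu> h) c t) (law_on_C01 N W) at_top"
proof (rule weakly_converges_density[OF W])
  \<comment> \<open>The constant density 1 brings \<open>P\<close> itself under
    \<open>weakly_converges_density\<close>; by scale invariance the expectations do not depend on
    t.\<close>
  let ?D = "density P (\<lambda>\<omega>. ennreal 1)"
  have D: "?D = P" by (simp add: density_1)
  show "rescaled_law (penalized P \<nu> h) c t = distr ?D (borel_of C01) (unit_scale t)" if "t > 0" for t
    unfolding penalized_eqI[OF pen] D
  proof (rule rescaled_law_eq)
    fix \<Lambda> assume "\<Lambda> \<in> sets (path_filtration t)"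
    then have "\<Lambda> \<in> sets path_sigma" using path_filtration_subset by auto
    then show "emeasure (distr P path_sigma (drift c)) \<Lambda> = emeasure P (drift c -` \<Lambda> \<inter> paths)"
      using measurable_drift_P by (simp add: emeasure_distr)
  qed (use that in \<open>auto simp: sets_P\<close>)
  fix f assume f: "bounded_continuous_C01 f"
  show "((\<lambda>t. \<integral>\<omega>. 1 * f (unit_scale t \<omega>) \<partial>P) \<longlongrightarrow> (\<integral>\<omega>. f (unit_scale 1 \<omega>) \<partial>P)) at_top"
  proof (rule tendsto_eventually, rule eventually_mono[OF eventually_gt_at_top[of 0]])
    fix t :: real assume "0 < t"
    from integral_unit_scale[OF this bounded_continuous_C01_measurable[OF f]]
    show "(\<integral>\<omega>. 1 * f (unit_scale t \<omega>) \<partial>P) = (\<integral>\<omega>. f (unit_scale 1 \<omega>) \<partial>P)" unfolding mult_1 .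
  qed
qed (simp_all add: prob_space[simplified])

end

theorem theorem1p2:
  fixes \<nu> h :: real
    and P0 :: "(real \<Rightarrow> real) measure"
    and N :: "'a measure" and W :: "real \<Rightarrow> 'a \<Rightarrow> real"
  assumes "wiener_measure P0"
    and "standard_BM {0..1} N W"
  shows
    "((\<nu>, h) \<in> R2 \<longrightarrow>
        weakly_converges C01 (\<lambda>t. rescaled_law (penalized P0 \<nu> h) (\<nu> + h) t) (law_on_C01 N W) at_top \<and>
        weakly_converges C01 (\<lambda>t. rescaled_law (gibbs P0 \<nu> h t) (\<nu> + h) t) (law_on_C01 N W) at_top) \<and>
     ((\<nu>, h) \<in> L3 \<longrightarrow>
        weakly_converges C01 (\<lambda>t. rescaled_law (penalized P0 \<nu> h) (\<nu> + h) t) (law_on_C01 N W) at_top) \<and>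
     ((\<nu>, h) \<in> R3 \<longrightarrow>
        weakly_converges C01 (\<lambda>t. rescaled_law (penalized P0 \<nu> h) h t) (law_on_C01 N W) at_top \<and>
        weakly_converges C01 (\<lambda>t. rescaled_law (gibbs P0 \<nu> h t) h t) (law_on_C01 N W) at_top)"
proof (intro conjI impI)
  interpret wiener P0 using assms(1) by unfold_locales
  note W = assms(2)
  show "weakly_converges C01 (\<lambda>t. rescaled_law (penalized P0 \<nu> h) (\<nu> + h) t) (law_on_C01 N W) at_top"
    "weakly_converges C01 (\<lambda>t. rescaled_law (gibbs P0 \<nu> h t) (\<nu> + h) t) (law_on_C01 N W) at_top"
    if "(\<nu>, h) \<in> R2"
  proof -
    \<comment> \<open>This is \<open>R2\<close> in terms of c = \<nu> + h: the path reversed in time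
      has drift -c, and its maximum has a finite exponential moment of order \<nu>.\<close>
    have c: "\<nu> + h > 0" "\<nu> < 2 * (\<nu> + h)" using that by (auto simp: R2_def)
    show "weakly_converges C01 (\<lambda>t. rescaled_law (penalized P0 \<nu> h) (\<nu> + h) t) (law_on_C01 N W) at_top"
      by (rule penalized_weakly_converges_positive_drift[OF W is_penalized_R2[OF c]])
    show "weakly_converges C01 (\<lambda>t. rescaled_law (gibbs P0 \<nu> h t) (\<nu> + h) t) (law_on_C01 N W) at_top"
      by (rule gibbs_weakly_converges_R2[OF W c])
  qed
  show "weakly_converges C01 (\<lambda>t. rescaled_law (penalized P0 \<nu> h) (\<nu> + h) t) (law_on_C01 N W) at_top"
    if "(\<nu>, h) \<in> L3"
  proof -
    \<comment> \<open>On \<open>L3\<close> the two drifts have the same size: \<nu> + h = c and h =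
      -c.\<close>
    define c where "c = \<nu> / 2"
    have c: "c > 0" and eq: "\<nu> = 2 * c" "h = - c" using that by (auto simp: L3_def c_def)
    show ?thesis
      using penalized_weakly_converges_positive_drift[OF W is_penalized_L3[OF c]] unfolding eq by simp
  qed
  show "weakly_converges C01 (\<lambda>t. rescaled_law (penalized P0 \<nu> h) h t) (law_on_C01 N W) at_top"
    "weakly_converges C01 (\<lambda>t. rescaled_law (gibbs P0 \<nu> h t) h t) (law_on_C01 N W) at_top"
    if "(\<nu>, h) \<in> R3"
  proof -
    have c: "- h > 0" "\<nu> < 2 * (- h)" using that by (auto simp: R3_def)
    show "weakly_converges C01 (\<lambda>t. rescaled_law (penalized P0 \<nu> h) h t) (law_on_C01 N W) at_top"
      using penalized_weakly_converges_R3[OF W c] by simp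
    show "weakly_converges C01 (\<lambda>t. rescaled_law (gibbs P0 \<nu> h t) h t) (law_on_C01 N W) at_top"
      using gibbs_weakly_converges_R3[OF W c] by simp
  qed
qed

end
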